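(* If there exist functions $f:\mathbb{R}_+\to\mathbb{R}_+$ and $g:\mathbb{R}_+\to\mathbb{R}$ such that $(\rho^\ast(x)-g(x))/f(x)$ converges weakly, as $x\to\infty$, to some non-degenerate and proper distribution, then also $(X_n-b_n)/a_n$ converges weakly, as $n\to\infty$, to the same distribution, where $X_n$ can be either $K_n$ or $N^\ast(\log n)$, and the constants are given by $$b_n=\int_0^{\log n} g(\log n-y)\,\mathbb{P}\{|\log (1-W)|\in \mathrm{d}y\},\qquad a_n=f(\log n).$$
   Context: Let $W$ be a random variable with values in $(0,1)$ such that the distribution of $|\log W|$ is non-lattice, and let $(W_k)_{k\in\mathbb{N}}$ be independent copies of $W$. Put $Q_0:=1$, $Q_j:=\prod_{i=1}^jW_i$ for $j\in\mathbb{N}$, and $P_k:=W_1W_2\cdots W_{k-1}(1-W_k)=Q_{k-1}-Q_k$ for $k\in\mathbb{N}$. Bernoulli sieve: this is the infinite occupancy scheme with random frequencies $(P_k)$, in which, conditionally on $(P_k)$, balls are thrown independently, each hitting box $k$ with probability $P_k$. Equivalently, the boxes are the intervals $(Q_k,Q_{k-1})$, $k\in\mathbb{N}$, and the balls are points $U_1,\ldots,U_n$ of a sample from the uniform distribution on $[0,1]$ independent of $(Q_k)$. $K_n$ is the number of boxes occupied by at least one of $n$ balls. For $x\ge 0$: $\rho^\ast(x):=\inf\{k\in\mathbb{N}: W_1\cdots W_k<e^{-x}\}$. For $x>0$: $N^\ast(x):=\#\{k\in\mathbb{N}:P_k\ge e^{-x}\}$. Here $\mathbb{R}_+=[0,\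infty)$.
   Formalization: Assumes also that g is bounded on bounded intervals and that the integrals b_n exist; otherwise the claim fails: the hypothesis constrains g only at infinity, while b_n uses g near 0, and atoms of |log(1-W)| can then make b_n far too large. *)

theory Defs
  imports "HOL-Probability.Probability"
begin

(* Sequences (W_k) and (U_i) are indexed by k, i >= 1; the values at index 0 are never used. *)

definition sieve_Q :: "(nat \<Rightarrow> 'a \<Rightarrow> real) \<Rightarrow> nat \<Rightarrow> 'a \<Rightarrow> real" where
  "sieve_Q W j \<omega> = (\<Prod>i=1..j. W i \<omega>)"

definition sieve_P :: "(nat \<Rightarrow> 'a \<Rightarrow> real) \<Rightarrow> nat \<Rightarrow> 'a \<Rightarrow> real" where
  "sieve_P W k \<omega> = (\<Prod>i=1..k - 1. W i \<omega>) * (1 - W k \<omega>)"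

(* If W_1 ... W_k >= exp (-x) for all k, a null event for i.i.d. (0,1)-valued W_k, the
   infimum in nat is 0 instead of infinity. *)
definition rho_star :: "(nat \<Rightarrow> 'a \<Rightarrow> real) \<Rightarrow> real \<Rightarrow> 'a \<Rightarrow> nat" where
  "rho_star W x \<omega> = Inf {k. 1 \<le> k \<and> (\<Prod>i=1..k. W i \<omega>) < exp (- x)}"

(* For (0,1)-valued W_k the set is finite, because the P_k are positive with sum at most 1. *)
definition N_star :: "(nat \<Rightarrow> 'a \<Rightarrow> real) \<Rightarrow> real \<Rightarrow> 'a \<Rightarrow> nat" where
  "N_star W x \<omega> = card {k. 1 \<le> k \<and> sieve_P W k \<omega> \<ge> exp (- x)}"

(* Box k is the interval (Q_k, Q_{k-1}); the boxes are disjoint, so at most n are occupied. *)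
definition occupied_boxes ::
  "(nat \<Rightarrow> 'a \<Rightarrow> real) \<Rightarrow> (nat \<Rightarrow> 'a \<Rightarrow> real) \<Rightarrow> nat \<Rightarrow> 'a \<Rightarrow> nat" where
  "occupied_boxes W U n \<omega> =
     card {k. 1 \<le> k \<and> (\<exists>i\<in>{1..n}. U i \<omega> \<in> {sieve_Q W k \<omega> <..< sieve_Q W (k - 1) \<omega>})}"

(* Lattices are the sets d * Z without shift, as in renewal theory. *)
definition non_lattice :: "real measure \<Rightarrow> bool" where
  "non_lattice \<mu> \<longleftrightarrow> \<not> (\<exists>d>0. AE y in \<mu>. \<exists>k::int. y = d * of_int k)"

(* The library's weak_conv_m with an arbitrary filter in place of sequentially. *)
definition weak_conv_along :: "('b \<Rightarrow> real measure) \<Rightarrow> real measure \<Rightarrow> 'b filter \<Rightarrow> bool" where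
  "weak_conv_along \<mu>s \<mu> F \<longleftrightarrow>
     (\<forall>t. isCont (cdf \<mu>) t \<longrightarrow> ((\<lambda>x. cdf (\<mu>s x) t) \<longlongrightarrow> cdf \<mu> t) F)"

lemma weak_conv_along_sequentially: "weak_conv_along \<mu>s \<mu> sequentially \<longleftrightarrow> weak_conv_m \<mu>s \<mu>"
  by (simp add: weak_conv_along_def weak_conv_m_def weak_conv_def)

definition centering :: "real measure \<Rightarrow> (real \<Rightarrow> real) \<Rightarrow> nat \<Rightarrow> real" where
  "centering \<nu> g n = (LINT y:{0..ln (real n)}|\<nu>. g (ln (real n) - y))"

end

theory Submission
  imports Defs
begin

text \<open>
  With \<open>\<xi>\<^sub>k = |log W\<^sub>k|\<close>, \<open>\<eta>\<^sub>k = |log (1 - W\<^sub>k)|\<close> and \<open>S\<^sub>k = \<xi>\<^sub>1 + ... + \<xi>\<^sub>k\<close> the boxes have sizes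
  \<open>exp (- T\<^sub>k)\<close>, where \<open>T\<^sub>k = S\<^sub>k\<^sub>-\<^sub>1 + \<eta>\<^sub>k\<close>. So \<open>N*(x)\<close> counts the points \<open>T\<^sub>k \<le> x\<close> of a perturbed
  random walk and \<open>\<rho>*(x)\<close> is the first passage time of \<open>S\<close> over \<open>x\<close>. The theorem compares three
  quantities with each other, each time with an error that is negligible against \<open>f(x)\<close>.

  Boxes against large boxes. With \<open>n\<close> balls, box \<open>k\<close> violates the rule "occupied iff \<open>T\<^sub>k \<le> log n\<close>" with
  probability at most the expectation of \<open>exp (- |T\<^sub>k - log n|)\<close>. The walk spends a bounded expected
  number of steps in any unit interval, so \<open>K\<^sub>n - N*(log n)\<close> is bounded in mean
  (\<open>prob_occupied_N_diff\<close>).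

  Perturbed against smoothed. Averaging over the \<open>\<eta>\<^sub>k\<close> turns \<open>N*(x)\<close> into \<open>\<integral> \<rho>*(x - y) d\<nu>(y)\<close>, where \<open>\<nu>\<close> is the law
  of \<open>\<eta>\<close>. The difference is a martingale whose variance is \<open>o(m(x))\<close>, \<open>m(x)\<close> being the median of
  \<open>\<rho>*(x)\<close> (\<open>expectation_Z_square\<close>, \<open>N_decomposition\<close>).

  Smoothed against first passage. The remaining difference is
  \<open>\<integral> ((\<rho>*(x - y) - g(x - y)) - (\<rho>*(x) - g(x))) d\<nu>(y)\<close> up to a tail of \<open>\<nu>\<close>. For bounded \<open>y\<close> the integrand is
  \<open>o(f(x))\<close>, because \<open>\<rho>*\<close> has tight increments and \<open>g(x) - g(x - y) = o(f(x))\<close> by a convergence of types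
  argument (\<open>centering_local\<close>). For large \<open>y\<close> it is enough that \<open>sup {|\<rho>*(z) - g(z)| : z \<le> x} / f(x)\<close> is
  tight (\<open>uniform_tightness\<close>), since \<open>\<nu>\<close> has little mass there.

  The facts about \<open>f\<close> and \<open>g\<close> come from splitting the walk at a level or at an index. Concatenating
  independent stretches that cross \<open>z\<close> and \<open>x - z\<close> shows that the spread of \<open>\<rho>*(z)\<close> is at most of the
  order of that of \<open>\<rho>*(x)\<close> for \<open>z \<le> x\<close>, so that \<open>f\<close> is monotone up to a constant (\<open>scale_quasi_mono\<close>),
  and that \<open>g(x)\<close> is \<open>g(z) + m(x - z)\<close> up to \<open>O(f(x))\<close> (\<open>med_approx\<close>). The latter is exactly the condition
  under which an inequality of Ottaviani's type controls the supremum (\<open>maximal_inequality\<close>).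

  Finally, \<open>m(x) = O(f(x)\<^sup>2)\<close> (\<open>med_le_square\<close>) makes the martingale negligible and forces \<open>f\<close> to diverge.
  The reason is that if \<open>\<rho>*(x)\<close> lives on a window of length \<open>K\<close>, then \<open>S\<^sub>l\<close>, with \<open>l\<close> the lower end of the
  window, is concentrated on an interval of the size of a typical \<open>S\<^sub>K\<close>, and an estimate of
  characteristic functions bounds \<open>l\<close> by a multiple of \<open>K\<^sup>2\<close> (\<open>concentration_bound\<close>).
\<close>

section \<open>Distribution functions and weak convergence\<close>

context real_distribution
begin

lemma ex_isCont_cdf:
  assumes "a < b"
  shows "\<exists>s. a < s \<and> s < b \<and> isCont (cdf M) s"
proof -
  have "uncountable ({a<..<b} - {x. \<not> isCont (cdf M) x})"
    using assms countable_atoms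
    by (intro uncountable_minus_countable)
      (simp_all add: isCont_cdf uncountable_open_interval zero_less_measure_iff)
  then have "{a<..<b} - {x. \<not> isCont (cdf M) x} \<noteq> {}"
    using countable_empty by fastforce
  then show ?thesis by auto
qed

text \<open>Right continuity in the form in which it is used: a strict upper bound persists a little to the right.\<close>

lemma cdf_right_less:
  assumes "cdf M t < p"
  shows "\<exists>d>0. \<forall>s<t + d. cdf M s < p"
proof -
  have "(cdf M \<longlongrightarrow> cdf M t) (at_right t)"
    using cdf_is_right_cont[of t] by (simp add: continuous_within)
  then have "\<forall>\<^sub>F s in at_right t. cdf M s < p" using assms by (rule order_tendstoD)
  then obtain b where b: "t < b" "\<And>s. t < s \<Longrightarrow> s < b \<Longrightarrow> cdf M s < p"
    unfolding eventually_at_right_field by blast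
  have "cdf M s < p" if "s < b" for s
  proof (cases "s \<le> t")
    case True
    then show ?thesis using assms cdf_nondecreasing[of s t] by simp
  qed (use b that in auto)
  then show ?thesis using b by (intro exI[of _ "b - t"]) auto
qed

text \<open>Points of increase of the distribution function, obtained as quantiles. They replace continuity
  points where it matters that slightly smaller and slightly larger arguments have different values.\<close>

lemma ex_increase_point:
  assumes "0 < p" "p < 1"
  shows "\<exists>\<tau>. \<forall>d>0. cdf M (\<tau> - d) < p \<and> p \<le> cdf M (\<tau> + d)"
proof -
  let ?Y = "{t. p \<le> cdf M t}"
  have "\<forall>\<^sub>F x in at_top. p < cdf M x" using cdf_lim_at_top_prob assms by (intro order_tendstoD) auto
  then obtain y where "p < cdf M y" by (auto simp: eventually_at_top_linorder)
  then have ne: "?Y \<noteq> {}" by (auto intro: less_imp_le)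
  have "\<forall>\<^sub>F x in at_bot. cdf M x < p" using cdf_lim_at_bot assms by (intro order_tendstoD) auto
  then obtain l where "\<And>x. x \<le> l \<Longrightarrow> cdf M x < p" by (auto simp: eventually_at_bot_linorder)
  then have bdd: "bdd_below ?Y" by (intro bdd_belowI[of _ l]) (metis linorder_le_cases linorder_not_le mem_Collect_eq)
  have "cdf M (Inf ?Y - d) < p \<and> p \<le> cdf M (Inf ?Y + d)" if "0 < d" for d
  proof
    show "cdf M (Inf ?Y - d) < p"
      using cInf_lower[OF _ bdd, of "Inf ?Y - d"] that by (auto simp: not_le[symmetric])
    have "Inf ?Y < Inf ?Y + d" using that by simp
    from cInf_less_iff[OF ne bdd, THEN iffD1, OF this]
    obtain t where "t \<in> ?Y" "t < Inf ?Y + d" by blast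
    then show "p \<le> cdf M (Inf ?Y + d)" using cdf_nondecreasing[of t "Inf ?Y + d"] by auto
  qed
  then show ?thesis by blast
qed

text \<open>A distribution function with values in \<open>{0, 1}\<close> only belongs to a point mass. A value strictly
  in between persists to the right, where continuity points are dense.\<close>

lemma ex_cdf_strictly_between:
  assumes "\<And>c. M \<noteq> return borel c"
  shows "\<exists>t. isCont (cdf M) t \<and> 0 < cdf M t \<and> cdf M t < 1"
proof -
  have "\<exists>t. 0 < cdf M t \<and> cdf M t < 1"
  proof (rule ccontr)
    assume "\<not> ?thesis"
    then have "\<not> (0 < cdf M t \<and> cdf M t < 1)" for t by blast
    then have 01: "cdf M t = 0 \<or> cdf M t = 1" for t
      using cdf_nonneg[of t] cdf_bounded_prob[of t] unfolding less_le by (metis (no_types))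
    obtain c where c: "\<And>d. d > 0 \<Longrightarrow> cdf M (c - d) < 1/2 \<and> 1/2 \<le> cdf M (c + d)"
      using ex_increase_point[of "1/2"] by auto
    have low: "cdf M t = 0" if "t < c" for t using c[of "c - t"] that 01[of t] by auto
    have high: "cdf M t = 1" if "c < t" for t using c[of "t - c"] that 01[of t] by auto
    have at: "cdf M c = 1"
    proof (rule ccontr)
      assume "cdf M c \<noteq> 1"
      then have "cdf M c < 1" using 01[of c] by auto
      then obtain d where d: "d > 0" "\<forall>s<c + d. cdf M s < 1" using cdf_right_less by blast
      then have "cdf M (c + d / 2) < 1" by simp
      then show False using high[of "c + d / 2"] d by simp
    qed
    have "cdf M = cdf (return borel c)"
    proof
      fix t
      have "cdf (return borel c) t = indicator {..t} c" by (simp add: cdf_def measure_return)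
      then show "cdf M t = cdf (return borel c) t"
        using low[of t] high[of t] at by (cases t c rule: linorder_cases) auto
    qed
    moreover have "real_distribution (return borel c)"
      by (auto intro!: real_distribution.intro prob_space_return simp: real_distribution_axioms_def)
    ultimately have "M = return borel c"
      by (intro cdf_unique) (auto intro: real_distribution_axioms)
    with assms show False by blast
  qed
  then obtain t where t: "0 < cdf M t" "cdf M t < 1" by blast
  obtain d where d: "d > 0" "\<forall>s<t + d. cdf M s < 1" using cdf_right_less[OF t(2)] by blast
  obtain s where "t < s" "s < t + d" "isCont (cdf M) s" using ex_isCont_cdf[of t "t + d"] d by auto
  then show ?thesis using t d cdf_nondecreasing[of t s] by (intro exI[of _ s]) auto
qed

end

text \<open>Slutsky's lemma for distribution functions: the continuity points of the limit are dense, so the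
  error in the argument can be absorbed between two of them.\<close>

lemma weak_conv_along_perturb:
  fixes X Y :: "'b \<Rightarrow> 'a \<Rightarrow> real"
  assumes "prob_space M" and \<mu>: "real_distribution \<mu>"
    and X [measurable]: "\<And>n. X n \<in> borel_measurable M"
    and Y [measurable]: "\<And>n. Y n \<in> borel_measurable M"
    and conv: "weak_conv_along (\<lambda>n. distr M borel (X n)) \<mu> F"
    and close: "\<And>\<delta> \<epsilon>. 0 < \<delta> \<Longrightarrow> 0 < \<epsilon> \<Longrightarrow>
      \<forall>\<^sub>F n in F. measure M {\<omega> \<in> space M. \<delta> < \<bar>X n \<omega> - Y n \<omega>\<bar>} \<le> \<epsilon>"
  shows "weak_conv_along (\<lambda>n. distr M borel (Y n)) \<mu> F"
proof -
  interpret prob_space M by fact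
  interpret mu: real_distribution \<mu> by fact
  have cX: "cdf (distr M borel (X n)) t = prob {\<omega> \<in> space M. X n \<omega> \<le> t}"
   and cY: "cdf (distr M borel (Y n)) t = prob {\<omega> \<in> space M. Y n \<omega> \<le> t}" for n t
    by (auto simp: cdf_def measure_distr intro!: arg_cong[where f=prob])
  show ?thesis
    unfolding weak_conv_along_def
  proof (intro allI impI tendstoI)
    fix t e :: real assume t: "isCont (cdf \<mu>) t" and e: "0 < e"
    from t e obtain d where d: "d > 0" "\<And>s. dist s t < d \<Longrightarrow> dist (cdf \<mu> s) (cdf \<mu> t) < e / 3"
      unfolding continuous_at_eps_delta by (metis divide_pos_pos zero_less_numeral)
    obtain a where a: "t - d < a" "a < t" "isCont (cdf \<mu>) a" using mu.ex_isCont_cdf[of "t - d" t] d by auto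
    obtain b where b: "t < b" "b < t + d" "isCont (cdf \<mu>) b" using mu.ex_isCont_cdf[of t "t + d"] d by auto
    define \<delta> where "\<delta> = min (t - a) (b - t)"
    have "\<delta> > 0" using a b by (auto simp: \<delta>_def)
    have da: "dist (cdf \<mu> a) (cdf \<mu> t) < e / 3" "dist (cdf \<mu> b) (cdf \<mu> t) < e / 3"
      using a b by (auto intro!: d(2) simp del: less_divide_eq_numeral1) (auto simp: dist_real_def)
    have "\<forall>\<^sub>F n in F. dist (cdf (distr M borel (X n)) a) (cdf \<mu> a) < e / 3"
         "\<forall>\<^sub>F n in F. dist (cdf (distr M borel (X n)) b) (cdf \<mu> b) < e / 3"
      using conv a(3) b(3) e unfolding weak_conv_along_def by (intro tendstoD; simp)+
    moreover have "\<forall>\<^sub>F n in F. prob {\<omega> \<in> space M. \<delta> < \<bar>X n \<omega> - Y n \<omega>\<bar>} \<le> e/3"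
      by (rule close) (use \<open>\<delta> > 0\<close> e in simp_all)
    ultimately show "\<forall>\<^sub>F n in F. dist (cdf (distr M borel (Y n)) t) (cdf \<mu> t) < e"
    proof eventually_elim
      case (elim n)
      let ?B = "{\<omega> \<in> space M. \<delta> < \<bar>X n \<omega> - Y n \<omega>\<bar>}"
      have "prob {\<omega> \<in> space M. Y n \<omega> \<le> t} \<le> prob ({\<omega> \<in> space M. X n \<omega> \<le> b} \<union> ?B)"
        by (intro finite_measure_mono) (auto simp: \<delta>_def)
      also have "\<dots> \<le> prob {\<omega> \<in> space M. X n \<omega> \<le> b} + prob ?B"
        by (intro measure_Un_le) auto
      finally have 1: "cdf (distr M borel (Y n)) t \<le> cdf (distr M borel (X n)) b + e/3"
        unfolding cX cY using elim by simp
      have "prob {\<omega> \<in> space M. X n \<omega> \<le> a} \<le> prob ({\<omega> \<in> space M. Y n \<omega> \<le> t} \<union> ?B)"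
        by (intro finite_measure_mono) (auto simp: \<delta>_def)
      also have "\<dots> \<le> prob {\<omega> \<in> space M. Y n \<omega> \<le> t} + prob ?B"
        by (intro measure_Un_le) auto
      finally have 2: "cdf (distr M borel (X n)) a \<le> cdf (distr M borel (Y n)) t + e/3"
        unfolding cX cY using elim by simp
      show ?case
        using 1 2 da elim(1,2) unfolding dist_real_def abs_less_iff by argo
    qed
  qed
qed

section \<open>Walks with positive steps\<close>

text \<open>The pairs \<open>(\<xi>\<^sub>k, \<eta>\<^sub>k)\<close> are i.i.d.; within a pair there may be any dependence, and in the sieve \<open>\<eta>\<^sub>k\<close> is
  a function of \<open>\<xi>\<^sub>k\<close>. Indices start at \<open>0\<close>, so the point with index \<open>k\<close> is \<open>S k + \<eta> k\<close>.\<close>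

locale perturbed_walk = prob_space M for M :: "'a measure" +
  fixes \<xi> \<eta> :: "nat \<Rightarrow> 'a \<Rightarrow> real"
  assumes indep: "indep_vars (\<lambda>_. borel) (\<lambda>i \<omega>. (\<xi> i \<omega>, \<eta> i \<omega>)) UNIV"
    and ident: "\<And>i. distr M borel (\<lambda>\<omega>. (\<xi> i \<omega>, \<eta> i \<omega>)) = distr M borel (\<lambda>\<omega>. (\<xi> 0 \<omega>, \<eta> 0 \<omega>))"
    and xi_pos: "\<And>i \<omega>. \<omega> \<in> space M \<Longrightarrow> 0 < \<xi> i \<omega>"
    and eta_nonneg: "\<And>i \<omega>. \<omega> \<in> space M \<Longrightarrow> 0 \<le> \<eta> i \<omega>"
begin

definition S :: "nat \<Rightarrow> 'a \<Rightarrow> real" where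
  "S k \<omega> = (\<Sum>i<k. \<xi> i \<omega>)"

text \<open>The sigma-algebra of the pairs with index in \<open>I\<close>, as a measure space on the same sample space, so
  that being determined by certain steps is an ordinary measurability statement.\<close>

definition steps :: "nat set \<Rightarrow> 'a measure" where
  "steps I = vimage_algebra (space M) (\<lambda>\<omega>. \<lambda>i\<in>I. (\<xi> i \<omega>, \<eta> i \<omega>)) (PiM I (\<lambda>_. borel))"

abbreviation "past k \<equiv> steps {..<k}"
abbreviation "future k \<equiv> steps {k..}"

lemma space_steps [simp]: "space (steps I) = space M"
  by (simp add: steps_def)

lemma pair_measurable [measurable]: "(\<lambda>\<omega>. (\<xi> i \<omega>, \<eta> i \<omega>)) \<in> borel_measurable M"
  using indep unfolding indep_vars_def by auto

lemma xi_measurable [measurable]: "\<xi> i \<in> borel_measurable M"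
  and eta_measurable [measurable]: "\<eta> i \<in> borel_measurable M"
proof -
  have "(\<lambda>\<omega>. fst (\<xi> i \<omega>, \<eta> i \<omega>)) \<in> borel_measurable M" "(\<lambda>\<omega>. snd (\<xi> i \<omega>, \<eta> i \<omega>)) \<in> borel_measurable M"
    by (intro measurable_compose[OF pair_measurable]; simp add: borel_prod[symmetric])+
  then show "\<xi> i \<in> borel_measurable M" "\<eta> i \<in> borel_measurable M" by simp_all
qed

lemma S_measurable [measurable]: "S k \<in> borel_measurable M"
  unfolding S_def[abs_def] by measurable

lemma pair_steps: "i \<in> I \<Longrightarrow> (\<lambda>\<omega>. (\<xi> i \<omega>, \<eta> i \<omega>)) \<in> borel_measurable (steps I)"
proof -
  assume i: "i \<in> I"
  have "(\<lambda>\<omega>. \<lambda>i\<in>I. (\<xi> i \<omega>, \<eta> i \<omega>)) \<in> measurable (steps I) (PiM I (\<lambda>_. borel))"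
    unfolding steps_def by (rule measurable_vimage_algebra1) (auto simp: space_PiM)
  from measurable_compose[OF this measurable_component_singleton[OF i]]
  show ?thesis using i by simp
qed

lemma xi_steps: "i \<in> I \<Longrightarrow> \<xi> i \<in> borel_measurable (steps I)"
  and eta_steps: "i \<in> I \<Longrightarrow> \<eta> i \<in> borel_measurable (steps I)"
proof -
  assume i: "i \<in> I"
  have "(\<lambda>\<omega>. fst (\<xi> i \<omega>, \<eta> i \<omega>)) \<in> borel_measurable (steps I)"
       "(\<lambda>\<omega>. snd (\<xi> i \<omega>, \<eta> i \<omega>)) \<in> borel_measurable (steps I)"
    by (intro measurable_compose[OF pair_steps[OF i]]; simp add: borel_prod[symmetric])+
  then show "\<xi> i \<in> borel_measurable (steps I)" "\<eta> i \<in> borel_measurable (steps I)" by simp_all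
qed

lemma S_past: "i \<le> k \<Longrightarrow> S i \<in> borel_measurable (past k)"
  unfolding S_def[abs_def] by (intro borel_measurable_sum xi_steps) auto

lemma S_diff: "i \<le> j \<Longrightarrow> S j \<omega> - S i \<omega> = (\<Sum>l=i..<j. \<xi> l \<omega>)"
  unfolding S_def using sum_diff_nat_ivl[of 0 i j "\<lambda>l. \<xi> l \<omega>"] by (simp add: atLeast0LessThan)

lemma S_future: "k \<le> i \<Longrightarrow> i \<le> j \<Longrightarrow> (\<lambda>\<omega>. S j \<omega> - S i \<omega>) \<in> borel_measurable (future k)"
  by (simp add: S_diff) (intro borel_measurable_sum xi_steps, auto)

lemma steps_subalgebra: "A \<in> sets (steps I) \<Longrightarrow> A \<in> events"
proof -
  have "(\<lambda>\<omega>. \<lambda>i\<in>I. (\<xi> i \<omega>, \<eta> i \<omega>)) \<in> measurable M (PiM I (\<lambda>_. borel))"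
    by (rule measurable_restrict) simp
  then have "sets (steps I) \<subseteq> sets M"
    unfolding steps_def sets_vimage_algebra
    by (intro sets.sigma_sets_subset) (auto intro: measurable_sets)
  then show "A \<in> sets (steps I) \<Longrightarrow> A \<in> events" by auto
qed

lemma indep_past_future:
  assumes X: "X \<in> measurable (past k) N" and Y: "Y \<in> measurable (future k) N'"
  shows "indep_var N X N' Y"
proof -
  have ind: "indep_var (PiM {..<k} (\<lambda>_. borel)) (\<lambda>\<omega>. \<lambda>i\<in>{..<k}. (\<xi> i \<omega>, \<eta> i \<omega>))
       (PiM {k..} (\<lambda>_. borel)) (\<lambda>\<omega>. \<lambda>i\<in>{k..}. (\<xi> i \<omega>, \<eta> i \<omega>))"
    by (rule indep_var_restrict[OF indep]) auto
  have *: "indep_set (sets (past k)) (sets (future k))"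
    using ind unfolding indep_var_eq steps_def sets_vimage_algebra by simp
  have sub: "sigma_sets (space M) {Z -` A \<inter> space M |A. A \<in> sets K} \<subseteq> sets (steps I)"
    if "Z \<in> measurable (steps I) K" for Z I and K :: "'z measure"
  proof -
    have "{Z -` A \<inter> space M |A. A \<in> sets K} \<subseteq> sets (steps I)"
      using measurable_sets[OF that] by auto
    from sets.sigma_sets_subset[OF this] show ?thesis by simp
  qed
  have meas: "Z \<in> measurable M K" if "Z \<in> measurable (steps I) K" for Z I and K :: "'z measure"
    using that unfolding measurable_def by (auto intro: steps_subalgebra)
  have "indep_set (sigma_sets (space M) {X -` A \<inter> space M |A. A \<in> sets N})
      (sigma_sets (space M) {Y -` A \<inter> space M |A. A \<in> sets N'})"
    using * unfolding indep_set_def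
  proof (rule indep_sets_mono_sets)
    fix i :: bool
    show "(case i of True \<Rightarrow> sigma_sets (space M) {X -` A \<inter> space M |A. A \<in> sets N}
        | False \<Rightarrow> sigma_sets (space M) {Y -` A \<inter> space M |A. A \<in> sets N'})
      \<subseteq> (case i of True \<Rightarrow> sets (past k) | False \<Rightarrow> sets (future k))"
      using sub[OF X] sub[OF Y] by (cases i) simp_all
  qed
  then show ?thesis
    unfolding indep_var_eq using meas[OF X] meas[OF Y] by simp
qed

lemma prob_past_future:
  assumes "A \<in> sets (past k)" "B \<in> sets (future k)"
  shows "prob (A \<inter> B) = prob A * prob B"
proof -
  have "indep_var (past k) (\<lambda>x. x) (future k) (\<lambda>x. x)"
    by (rule indep_past_future[where k=k]) auto
  moreover have "(\<lambda>x. (x, x)) -` (A \<times> B) \<inter> space M = A \<inter> B" "(\<lambda>x. x) -` A \<inter> space M = A" "(\<lambda>x. x) -` B \<inter> space M = B"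
    using sets.sets_into_space[OF assms(1)] sets.sets_into_space[OF assms(2)] by auto
  ultimately show ?thesis
    using indep_varD[OF _ assms, of "\<lambda>x. x" "\<lambda>x. x"] by simp
qed

lemma distr_xi: "distr M borel (\<xi> i) = distr M borel (\<xi> 0)"
  and distr_eta: "distr M borel (\<eta> i) = distr M borel (\<eta> 0)"
proof -
  have "distr (distr M borel (\<lambda>\<omega>. (\<xi> i \<omega>, \<eta> i \<omega>))) borel fst = distr (distr M borel (\<lambda>\<omega>. (\<xi> 0 \<omega>, \<eta> 0 \<omega>))) borel fst"
       "distr (distr M borel (\<lambda>\<omega>. (\<xi> i \<omega>, \<eta> i \<omega>))) borel snd = distr (distr M borel (\<lambda>\<omega>. (\<xi> 0 \<omega>, \<eta> 0 \<omega>))) borel snd"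
    by (simp_all add: ident[of i])
  moreover have "fst \<in> borel_measurable (borel :: (real \<times> real) measure)" "snd \<in> borel_measurable (borel :: (real \<times> real) measure)"
    by (simp_all add: borel_prod[symmetric])
  ultimately show "distr M borel (\<xi> i) = distr M borel (\<xi> 0)" "distr M borel (\<eta> i) = distr M borel (\<eta> 0)"
    by (simp_all add: distr_distr comp_def)
qed

lemma distr_S_shift: "distr M borel (\<lambda>\<omega>. S (k + j) \<omega> - S k \<omega>) = distr M borel (S j)"
proof (induction j)
  case 0
  then show ?case by (simp add: S_def[abs_def])
next
  case (Suc j)
  have step: "distr M borel (\<lambda>\<omega>. S (k + Suc j) \<omega> - S k \<omega>)
      = distr (distr M borel (\<lambda>\<omega>. S (k + j) \<omega> - S k \<omega>) \<Otimes>\<^sub>M distr M borel (\<xi> 0)) borel (\<lambda>(a, b). a + b)" for k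
  proof -
    have "indep_var borel (\<lambda>\<omega>. S (k + j) \<omega> - S k \<omega>) borel (\<xi> (k + j))"
      by (rule indep_past_future[where k="k+j"]) (auto intro!: borel_measurable_diff S_past xi_steps)
    then have "distr M borel (\<lambda>\<omega>. S (k + j) \<omega> - S k \<omega>) \<Otimes>\<^sub>M distr M borel (\<xi> (k+j))
       = distr M (borel \<Otimes>\<^sub>M borel) (\<lambda>\<omega>. (S (k + j) \<omega> - S k \<omega>, \<xi> (k+j) \<omega>))"
      unfolding indep_var_distribution_eq by simp
    then have "distr M borel (\<lambda>\<omega>. S (k + j) \<omega> - S k \<omega>) \<Otimes>\<^sub>M distr M borel (\<xi> 0)
       = distr M (borel \<Otimes>\<^sub>M borel) (\<lambda>\<omega>. (S (k + j) \<omega> - S k \<omega>, \<xi> (k+j) \<omega>))"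
      by (simp add: distr_xi[of "k+j"])
    then show ?thesis
      by (simp add: distr_distr comp_def) (simp add: S_def algebra_simps)
  qed
  show ?case
    using step[of k] step[of 0] Suc by (simp add: S_def[of 0])
qed

definition S_cdf :: "nat \<Rightarrow> real \<Rightarrow> real" where
  "S_cdf k x = prob {\<omega> \<in> space M. S k \<omega> \<le> x}"

lemma prob_S_shift: "A \<in> sets borel \<Longrightarrow> prob {\<omega> \<in> space M. S (k + j) \<omega> - S k \<omega> \<in> A} = prob {\<omega> \<in> space M. S j \<omega> \<in> A}"
proof -
  assume A: "A \<in> sets borel"
  have "measure (distr M borel (\<lambda>\<omega>. S (k + j) \<omega> - S k \<omega>)) A = measure (distr M borel (S j)) A"
    by (simp add: distr_S_shift)
  then show ?thesis
    using A by (simp add: measure_distr vimage_def Int_def conj_commute)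
qed

lemma S_cdf_shift: "prob {\<omega> \<in> space M. S (k + j) \<omega> - S k \<omega> \<le> x} = S_cdf j x"
  using prob_S_shift[of "{..x}" k j] by (simp add: S_cdf_def)

lemma prob_gt: "prob {\<omega> \<in> space M. x < S k \<omega>} = 1 - S_cdf k x"
proof -
  have "{\<omega> \<in> space M. x < S k \<omega>} = space M - {\<omega> \<in> space M. S k \<omega> \<le> x}" by auto
  then show ?thesis by (simp add: prob_compl S_cdf_def)
qed

lemma prob_gt_shift: "prob {\<omega> \<in> space M. x < S (k + j) \<omega> - S k \<omega>} = 1 - S_cdf j x"
  using prob_S_shift[of "{x<..}" k j] by (simp add: prob_gt)

lemma prob_past_le:
  assumes "A \<in> sets (past k)"
  shows "prob (A \<inter> {\<omega> \<in> space M. S (k + j) \<omega> - S k \<omega> \<le> x}) = prob A * S_cdf j x"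
proof -
  have "{\<omega> \<in> space M. S (k + j) \<omega> - S k \<omega> \<le> x} \<in> sets (future k)"
    using measurable_sets[OF S_future[of k k "k+j"], of "{..x}"] by (simp add: vimage_def Int_def conj_commute)
  from prob_past_future[OF assms this] show ?thesis by (simp add: S_cdf_shift)
qed

lemma prob_past_gt:
  assumes "A \<in> sets (past k)"
  shows "prob (A \<inter> {\<omega> \<in> space M. x < S (k + j) \<omega> - S k \<omega>}) = prob A * (1 - S_cdf j x)"
proof -
  have "{\<omega> \<in> space M. x < S (k + j) \<omega> - S k \<omega>} \<in> sets (future k)"
    using measurable_sets[OF S_future[of k k "k+j"], of "{x<..}"] by (simp add: vimage_def Int_def conj_commute)
  from prob_past_future[OF assms this] show ?thesis by (simp add: prob_gt_shift)
qed

lemma le_S_past: "i \<le> k \<Longrightarrow> {\<omega> \<in> space M. S i \<omega> \<le> x} \<in> sets (past k)"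
  using measurable_sets[OF S_past[of i k], of "{..x}"] by (simp add: vimage_def Int_def conj_commute)

lemma gt_S_past: "i \<le> k \<Longrightarrow> {\<omega> \<in> space M. x < S i \<omega>} \<in> sets (past k)"
  using measurable_sets[OF S_past[of i k], of "{x<..}"] by (simp add: vimage_def Int_def conj_commute)

lemma S_mono: "\<omega> \<in> space M \<Longrightarrow> i \<le> j \<Longrightarrow> S i \<omega> \<le> S j \<omega>"
  using S_diff[of i j \<omega>] sum_nonneg[of "{i..<j}" "\<lambda>l. \<xi> l \<omega>"] xi_pos[of \<omega>] by (auto simp: less_imp_le)

lemma S_0 [simp]: "S 0 \<omega> = 0"
  by (simp add: S_def)

lemma S_nonneg: "\<omega> \<in> space M \<Longrightarrow> 0 \<le> S k \<omega>"
  using S_mono[of \<omega> 0 k] by simp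

lemma S_cdf_nonneg [simp]: "0 \<le> S_cdf k x" and S_cdf_le_1 [simp]: "S_cdf k x \<le> 1"
  by (simp_all add: S_cdf_def)

lemma S_cdf_mono: "l \<le> k \<Longrightarrow> x \<le> y \<Longrightarrow> S_cdf k x \<le> S_cdf l y"
  unfolding S_cdf_def by (intro finite_measure_mono) (auto dest: S_mono[of _ l k])

text \<open>Both stretches of the walk have to stay below \<open>x\<close>, since steps are positive.\<close>

lemma S_cdf_mult_le: "S_cdf (k + l) x \<le> S_cdf k x * S_cdf l x"
proof -
  have "S_cdf (k + l) x \<le> prob ({\<omega> \<in> space M. S k \<omega> \<le> x} \<inter> {\<omega> \<in> space M. S (k + l) \<omega> - S k \<omega> \<le> x})"
    unfolding S_cdf_def
  proof (intro finite_measure_mono subsetI)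
    fix \<omega> assume "\<omega> \<in> {\<omega> \<in> space M. S (k + l) \<omega> \<le> x}"
    then show "\<omega> \<in> {\<omega> \<in> space M. S k \<omega> \<le> x} \<inter> {\<omega> \<in> space M. S (k + l) \<omega> - S k \<omega> \<le> x}"
      using S_mono[of \<omega> k "k+l"] S_nonneg[of \<omega> k] by auto
  qed measurable
  also have "\<dots> = S_cdf k x * S_cdf l x"
    by (subst prob_past_le[OF le_S_past]) (simp_all add: S_cdf_def)
  finally show ?thesis .
qed

lemma S_cdf_add_ge: "S_cdf k x * S_cdf l y \<le> S_cdf (k + l) (x + y)"
proof -
  have "S_cdf k x * S_cdf l y = prob ({\<omega> \<in> space M. S k \<omega> \<le> x} \<inter> {\<omega> \<in> space M. S (k + l) \<omega> - S k \<omega> \<le> y})"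
    by (subst prob_past_le[OF le_S_past]) (simp_all add: S_cdf_def)
  also have "\<dots> \<le> S_cdf (k + l) (x + y)"
    unfolding S_cdf_def by (intro finite_measure_mono) auto
  finally show ?thesis .
qed

lemma S_cdf_add_le: "(1 - S_cdf k x) * (1 - S_cdf l y) \<le> 1 - S_cdf (k + l) (x + y)"
proof -
  have "(1 - S_cdf k x) * (1 - S_cdf l y) = prob ({\<omega> \<in> space M. x < S k \<omega>} \<inter> {\<omega> \<in> space M. y < S (k + l) \<omega> - S k \<omega>})"
    by (subst prob_past_gt[OF gt_S_past]) (simp_all add: prob_gt)
  also have "\<dots> \<le> prob {\<omega> \<in> space M. x + y < S (k + l) \<omega>}"
    by (intro finite_measure_mono) auto
  finally show ?thesis by (simp add: prob_gt)
qed

text \<open>With positive probability finitely many steps carry the walk beyond \<open>x\<close>; by submultiplicativity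
  the probability of staying below then decays geometrically.\<close>

lemma S_cdf_tendsto_0: "(\<lambda>k. S_cdf k x) \<longlonglongrightarrow> 0"
proof -
  \<comment> \<open>some step exceeds \<open>\<delta>\<close> with positive probability\<close>
  have "\<exists>n. S_cdf 1 (1 / Suc n) < 1"
  proof (rule ccontr)
    assume "\<not> ?thesis"
    then have "prob {\<omega> \<in> space M. S 1 \<omega> \<le> 1 / Suc n} = 1" for n
      using S_cdf_le_1[of 1 "1 / Suc n"] unfolding S_cdf_def not_ex not_less by (intro antisym) auto
    then have "AE \<omega> in M. S 1 \<omega> \<le> 1 / Suc n" for n
      by (subst (asm) prob_Collect_eq_1) auto
    then have "AE \<omega> in M. \<forall>n. S 1 \<omega> \<le> 1 / Suc n" by (simp add: AE_all_countable)
    from this AE_space have "AE \<omega> in M. False"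
    proof (eventually_elim)
      case (elim \<omega>)
      have "0 < S 1 \<omega>" using xi_pos[OF elim(2)] by (simp add: S_def)
      then show ?case using elim(1) nat_approx_posE[of "S 1 \<omega>"] by (metis not_less)
    qed
    then show False by simp
  qed
  then obtain n where n: "S_cdf 1 (1 / Suc n) < 1" by auto
  define \<delta> where "\<delta> = 1 / Suc n"
  have d: "\<delta> > 0" "S_cdf 1 \<delta> < 1" using n by (auto simp: \<delta>_def)
  have "S_cdf c (c * \<delta>) < 1" if "c > 0" for c :: nat
    using that
  proof (induction c rule: nat_induct_non_zero)
    case 1 then show ?case using d by simp
  next
    case (Suc c)
    have "0 < (1 - S_cdf c (c * \<delta>)) * (1 - S_cdf 1 \<delta>)" using Suc d by simp
    also have "\<dots> \<le> 1 - S_cdf (c + 1) (c * \<delta> + \<delta>)" by (rule S_cdf_add_le)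
    finally show ?case by (simp add: algebra_simps)
  qed
  moreover obtain c :: nat where c: "x / \<delta> < c" using reals_Archimedean2 by blast
  ultimately have "S_cdf (Suc c) (Suc c * \<delta>) < 1" by blast
  moreover have "x \<le> Suc c * \<delta>" using c d by (simp add: field_simps)
  ultimately have p: "S_cdf (Suc c) x < 1" using S_cdf_mono[of "Suc c" "Suc c" x] by force
  have pow: "S_cdf (j * Suc c) x \<le> S_cdf (Suc c) x ^ j" for j
  proof (induction j)
    case (Suc j)
    have "S_cdf (Suc j * Suc c) x \<le> S_cdf (Suc c) x * S_cdf (j * Suc c) x"
      using S_cdf_mult_le[of "Suc c" "j * Suc c" x] by (simp add: algebra_simps)
    also have "\<dots> \<le> S_cdf (Suc c) x * S_cdf (Suc c) x ^ j" by (intro mult_left_mono Suc) simp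
    finally show ?case by simp
  qed simp
  show ?thesis
  proof (rule tendstoI)
    fix e :: real assume "e > 0"
    then obtain j where j: "S_cdf (Suc c) x ^ j < e" using real_arch_pow_inv p by blast
    show "\<forall>\<^sub>F k in sequentially. dist (S_cdf k x) 0 < e"
      using eventually_ge_at_top[of "j * Suc c"]
    proof eventually_elim
      case (elim k)
      then show ?case using S_cdf_mono[of "j * Suc c" k x x] pow[of j] j by simp
    qed
  qed
qed

lemma S_cdf_tendsto_1: "((\<lambda>x. S_cdf k x) \<longlongrightarrow> 1) at_top"
proof -
  interpret d: real_distribution "distr M borel (S k)" by (rule real_distribution_distr) simp
  have "cdf (distr M borel (S k)) = S_cdf k"
    by (auto simp: fun_eq_iff cdf_def S_cdf_def measure_distr intro!: arg_cong[where f=prob])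
  then show ?thesis using d.cdf_lim_at_top_prob by simp
qed

section \<open>First passage times and their medians\<close>

definition \<rho> :: "real \<Rightarrow> 'a \<Rightarrow> nat" where
  "\<rho> x \<omega> = (LEAST k. x < S k \<omega>)"

definition rho_cdf :: "real \<Rightarrow> real \<Rightarrow> real" where
  "rho_cdf x r = prob {\<omega> \<in> space M. real (\<rho> x \<omega>) \<le> r}"

text \<open>A median of the first passage time over \<open>x\<close>, which also measures the mean (\<open>sum_S_cdf_le\<close>).\<close>

definition med :: "real \<Rightarrow> nat" where
  "med x = (LEAST k. S_cdf k x \<le> 1 / 2)"

lemma rho_measurable [measurable]: "\<rho> x \<in> measurable M (count_space UNIV)"
  unfolding \<rho>_def[abs_def] by measurable

lemma AE_unbounded: "AE \<omega> in M. \<forall>x. \<exists>k. x < S k \<omega>"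
proof -
  have "AE \<omega> in M. \<exists>k. real n < S k \<omega>" for n
  proof -
    let ?A = "{\<omega> \<in> space M. \<not> (\<exists>k. real n < S k \<omega>)}"
    have "prob ?A \<le> S_cdf k (real n)" for k
      unfolding S_cdf_def by (intro finite_measure_mono) (auto simp: not_less)
    then have "prob ?A \<le> 0"
      by (intro LIMSEQ_le_const[OF S_cdf_tendsto_0[of "real n"]]) auto
    then have "?A \<in> null_sets M"
      by (simp add: null_sets_def emeasure_eq_measure measure_le_0_iff)
    then show ?thesis by (rule AE_I') auto
  qed
  then have "AE \<omega> in M. \<forall>n. \<exists>k. real n < S k \<omega>"
    by (simp add: AE_all_countable)
  then show ?thesis
  proof eventually_elim
    case (elim \<omega>)
    show ?case
    proof
      fix x
      obtain n where "x < real n" using reals_Archimedean2 by blast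
      with elim show "\<exists>k. x < S k \<omega>" by (meson less_trans)
    qed
  qed
qed

lemma rho_le_iff: "\<omega> \<in> space M \<Longrightarrow> \<exists>k. x < S k \<omega> \<Longrightarrow> \<rho> x \<omega> \<le> k \<longleftrightarrow> x < S k \<omega>"
  unfolding \<rho>_def by (metis (mono_tags, lifting) LeastI_ex Least_le S_mono order_less_le_trans)

lemma less_rho_iff: "\<omega> \<in> space M \<Longrightarrow> \<exists>k. x < S k \<omega> \<Longrightarrow> k < \<rho> x \<omega> \<longleftrightarrow> S k \<omega> \<le> x"
  using rho_le_iff[of \<omega> x k] by (simp add: not_le[symmetric])

lemma rho_mono: "\<omega> \<in> space M \<Longrightarrow> \<exists>k. y < S k \<omega> \<Longrightarrow> x \<le> y \<Longrightarrow> \<rho> x \<omega> \<le> \<rho> y \<omega>"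
  by (meson order_le_less_trans order_refl rho_le_iff)

lemma real_rho_le_iff:
  assumes "\<omega> \<in> space M" "\<exists>k. x < S k \<omega>"
  shows "real (\<rho> x \<omega>) \<le> r \<longleftrightarrow> 0 \<le> r \<and> x < S (nat \<lfloor>r\<rfloor>) \<omega>"
proof -
  have "real (\<rho> x \<omega>) \<le> r \<longleftrightarrow> 0 \<le> r \<and> \<rho> x \<omega> \<le> nat \<lfloor>r\<rfloor>"
    by (metis le_nat_floor of_nat_0_le_iff of_nat_floor order_trans of_nat_le_iff)
  then show ?thesis using rho_le_iff[OF assms] by simp
qed

text \<open>The duality between the walk and its first passage times.\<close>

lemma rho_cdf_eq: "rho_cdf x r = (if r < 0 then 0 else 1 - S_cdf (nat \<lfloor>r\<rfloor>) x)"
proof (cases "r < 0")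
  case True
  then show ?thesis by (auto simp: rho_cdf_def)
next
  case False
  have "rho_cdf x r = prob {\<omega> \<in> space M. x < S (nat \<lfloor>r\<rfloor>) \<omega>}"
    unfolding rho_cdf_def
  proof (rule finite_measure_eq_AE)
    show "AE \<omega> in M. (\<omega> \<in> {\<omega> \<in> space M. real (\<rho> x \<omega>) \<le> r}) = (\<omega> \<in> {\<omega> \<in> space M. x < S (nat \<lfloor>r\<rfloor>) \<omega>})"
      using AE_unbounded by eventually_elim (use False real_rho_le_iff in auto)
  qed auto
  then show ?thesis using False prob_gt by simp
qed

lemma rho_cdf_nonneg [simp]: "0 \<le> rho_cdf x r" and rho_cdf_le_1 [simp]: "rho_cdf x r \<le> 1"
  by (simp_all add: rho_cdf_def)

lemma prob_rho_gt: "prob {\<omega> \<in> space M. r < real (\<rho> x \<omega>)} = 1 - rho_cdf x r"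
proof -
  have "{\<omega> \<in> space M. r < real (\<rho> x \<omega>)} = space M - {\<omega> \<in> space M. real (\<rho> x \<omega>) \<le> r}" by auto
  then show ?thesis by (simp add: prob_compl rho_cdf_def)
qed

lemma rho_cdf_mono: "r \<le> s \<Longrightarrow> y \<le> x \<Longrightarrow> rho_cdf x r \<le> rho_cdf y s"
  by (auto simp: rho_cdf_eq intro!: S_cdf_mono nat_mono floor_mono)

text \<open>Two independent stretches that cross \<open>x\<close> and \<open>y\<close> cross \<open>x + y\<close> together: first passage times are
  stochastically subadditive.\<close>

lemma rho_cdf_add_ge: "rho_cdf x r * rho_cdf y s \<le> rho_cdf (x + y) (r + s)"
proof (cases "r < 0 \<or> s < 0")
  case False
  then have "nat \<lfloor>r\<rfloor> + nat \<lfloor>s\<rfloor> \<le> nat \<lfloor>r + s\<rfloor>" by linarith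
  then have "S_cdf (nat \<lfloor>r + s\<rfloor>) (x + y) \<le> S_cdf (nat \<lfloor>r\<rfloor> + nat \<lfloor>s\<rfloor>) (x + y)" by (intro S_cdf_mono) auto
  then show ?thesis using False S_cdf_add_le[of "nat \<lfloor>r\<rfloor>" x "nat \<lfloor>s\<rfloor>" y] by (simp add: rho_cdf_eq)
qed (auto simp: rho_cdf_eq[of x] rho_cdf_eq[of y])

text \<open>The converse estimate: two stretches that stay below \<open>x\<close> and \<open>y\<close> stay below \<open>x + y\<close> together. The
  loss of \<open>1\<close> comes from rounding \<open>r\<close> and \<open>s\<close> to integers.\<close>

lemma rho_cdf_add_le:
  assumes "0 \<le> x" "0 \<le> y"
  shows "(1 - rho_cdf x r) * (1 - rho_cdf y s) \<le> 1 - rho_cdf (x + y) (r + s - 1)"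
proof -
  consider "r < 0" | "s < 0" | "0 \<le> r" "0 \<le> s" by linarith
  then show ?thesis
  proof cases
    case 1
    then have "rho_cdf (x + y) (r + s - 1) \<le> rho_cdf y s" using assms by (intro rho_cdf_mono) auto
    then show ?thesis using 1 by (simp add: rho_cdf_eq[of x])
  next
    case 2
    then have "rho_cdf (x + y) (r + s - 1) \<le> rho_cdf x r" using assms by (intro rho_cdf_mono) auto
    then show ?thesis using 2 by (simp add: rho_cdf_eq[of y])
  next
    case 3
    have le: "nat \<lfloor>r + s - 1\<rfloor> \<le> nat \<lfloor>r\<rfloor> + nat \<lfloor>s\<rfloor>" by linarith
    have "S_cdf (nat \<lfloor>r\<rfloor>) x * S_cdf (nat \<lfloor>s\<rfloor>) y \<le> S_cdf (nat \<lfloor>r\<rfloor> + nat \<lfloor>s\<rfloor>) (x + y)" by (rule S_cdf_add_ge)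
    also have "\<dots> \<le> S_cdf (nat \<lfloor>r + s - 1\<rfloor>) (x + y)" by (intro S_cdf_mono le) auto
    finally show ?thesis using 3 by (simp add: rho_cdf_eq mult_le_one)
  qed
qed

lemma S_cdf_med: "S_cdf (med x) x \<le> 1 / 2"
proof -
  have "\<forall>\<^sub>F k in sequentially. S_cdf k x < 1/2"
    using S_cdf_tendsto_0 by (rule order_tendstoD) simp
  then obtain k where "S_cdf k x \<le> 1/2" by (auto simp: eventually_sequentially intro: less_imp_le)
  then show ?thesis unfolding med_def by (rule LeastI)
qed

lemma less_med: "k < med x \<Longrightarrow> 1 / 2 < S_cdf k x"
  unfolding med_def using not_less_Least not_le by blast

lemma S_cdf_0: "0 \<le> x \<Longrightarrow> S_cdf 0 x = 1"
  by (simp add: S_cdf_def prob_space)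

lemma med_pos: "0 \<le> x \<Longrightarrow> 0 < med x"
  using S_cdf_med[of x] S_cdf_0[of x] by (cases "med x") auto

lemma rho_cdf_med: "1 / 2 \<le> rho_cdf x (real (med x))"
  using S_cdf_med[of x] by (simp add: rho_cdf_eq)

lemma rho_cdf_med_minus:
  assumes "0 \<le> x"
  shows "rho_cdf x (real (med x) - 1) < 1 / 2"
proof -
  have "nat \<lfloor>real (med x) - 1\<rfloor> = med x - 1" "0 \<le> real (med x) - 1"
    using med_pos[OF assms] by linarith+
  then show ?thesis using less_med[of "med x - 1" x] med_pos[OF assms] by (simp add: rho_cdf_eq)
qed

lemma med_mono: "x \<le> y \<Longrightarrow> med x \<le> med y"
  unfolding med_def[of x] by (intro Least_le) (meson order_trans S_cdf_med S_cdf_mono order_refl)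

text \<open>The renewal function is at most twice the median: after \<open>med x\<close> further steps all probabilities
  have at least halved, so the sum \<open>U\<close> satisfies \<open>U \<le> med x + U / 2\<close>.\<close>

lemma sum_S_cdf_le: "(\<Sum>k<n. S_cdf k x) \<le> 2 * real (med x)"
proof -
  have split: "(\<Sum>k<m + n. f k) = (\<Sum>k<m. f k) + (\<Sum>k<n. f (k + m))" for m and f :: "nat \<Rightarrow> real"
    by (induction n) (simp_all add: algebra_simps)
  have "(\<Sum>k<n. S_cdf k x) \<le> (\<Sum>k<med x + n. S_cdf k x)" by (intro sum_mono2) auto
  also have "\<dots> = (\<Sum>k<med x. S_cdf k x) + (\<Sum>k<n. S_cdf (k + med x) x)" by (rule split)
  also have "\<dots> \<le> (\<Sum>k<med x. 1) + (\<Sum>k<n. S_cdf k x * (1/2))"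
  proof (intro add_mono sum_mono)
    fix k show "S_cdf (k + med x) x \<le> S_cdf k x * (1/2)"
      by (rule order_trans[OF S_cdf_mult_le mult_left_mono[OF S_cdf_med]]) simp
  qed simp
  finally show ?thesis by (simp add: sum_divide_distrib[symmetric])
qed

lemma filterlim_med: "filterlim med at_top at_top"
  unfolding filterlim_at_top
proof
  fix K :: nat
  have "((\<lambda>x. S_cdf K x) \<longlongrightarrow> 1) at_top" by (rule S_cdf_tendsto_1)
  then have "\<forall>\<^sub>F x in at_top. 1/2 < S_cdf K x" by (rule order_tendstoD) simp
  then show "\<forall>\<^sub>F x in at_top. K \<le> med x"
  proof eventually_elim
    case (elim x)
    show ?case
    proof (rule ccontr)
      assume "\<not> K \<le> med x"
      then have "S_cdf K x \<le> S_cdf (med x) x" by (intro S_cdf_mono) auto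
      with S_cdf_med[of x] elim show False by simp
    qed
  qed
qed

section \<open>Restarting the walk and a maximal inequality\<close>

lemma steps_mono: "I \<subseteq> J \<Longrightarrow> A \<in> sets (steps I) \<Longrightarrow> A \<in> sets (steps J)"
proof -
  assume I: "I \<subseteq> J" and A: "A \<in> sets (steps I)"
  have "(\<lambda>\<omega>. \<lambda>i\<in>I. (\<xi> i \<omega>, \<eta> i \<omega>)) \<in> measurable (steps J) (PiM I (\<lambda>_. borel))"
    using I by (intro measurable_restrict pair_steps) auto
  then have "(\<lambda>\<omega>. \<omega>) \<in> measurable (steps J) (steps I)"
    unfolding steps_def[of I] by (intro measurable_vimage_algebra2) auto
  from measurable_sets[OF this A] show ?thesis
    using sets.sets_into_space[OF A] by (simp add: Int_absorb2)
qed

text \<open>The strong Markov property at the first passage over \<open>a\<close>, by summing over its value.\<close>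

lemma prob_after_passage: "prob {\<omega> \<in> space M. S (\<rho> a \<omega> + j) \<omega> - S (\<rho> a \<omega>) \<omega> \<le> y} = S_cdf j y"
proof -
  \<comment> \<open>the event that the first passage over \<open>a\<close> happens at time \<open>k\<close>\<close>
  define E where "E k = {\<omega> \<in> space M. a < S k \<omega>} \<inter> (\<Inter>i\<in>{..<k}. {\<omega> \<in> space M. S i \<omega> \<le> a}) \<inter> space M" for k
  have E_past: "E k \<in> sets (past k)" for k
  proof -
    have "(\<Inter>i\<in>{..<k}. {\<omega> \<in> space M. S i \<omega> \<le> a}) \<inter> space (past k) \<in> sets (past k)"
      by (cases "k = 0") (auto intro!: sets.Int sets.finite_INT le_S_past simp del: space_steps)
    then show ?thesis using gt_S_past[of k k a] by (simp add: E_def Int_assoc)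
  qed
  have E_ev [measurable]: "E k \<in> events" for k using E_past steps_subalgebra by blast
  have E_rho: "\<rho> a \<omega> = k" if "\<omega> \<in> E k" for \<omega> k
    unfolding \<rho>_def using that by (intro Least_equality) (auto simp: E_def not_less[symmetric])
  have disj: "disjoint_family E"
    unfolding disjoint_family_on_def using E_rho by blast
  have AE_E: "AE \<omega> in M. \<omega> \<in> (\<Union>k. E k)"
    using AE_unbounded AE_space
  proof eventually_elim
    case (elim \<omega>)
    then have "\<omega> \<in> E (\<rho> a \<omega>)"
      using rho_le_iff[of \<omega> a] less_rho_iff[of \<omega> a] by (auto simp: E_def)
    then show ?case by blast
  qed
  let ?F = "\<lambda>k. {\<omega> \<in> space M. S (k + j) \<omega> - S k \<omega> \<le> y}"
  have "(\<lambda>k. prob (E k)) sums prob (\<Union>k. E k)"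
    by (intro finite_measure_UNION disj) auto
  also have "prob (\<Union>k. E k) = 1" using AE_E by (subst prob_eq_1) auto
  finally have "(\<lambda>k. prob (E k) * S_cdf j y) sums (1 * S_cdf j y)" by (rule sums_mult2)
  moreover have "(\<lambda>k. prob (E k \<inter> ?F k)) sums prob (\<Union>k. E k \<inter> ?F k)"
    using disj by (intro finite_measure_UNION) (auto simp: disjoint_family_on_def)
  moreover have "prob (E k \<inter> ?F k) = prob (E k) * S_cdf j y" for k
    by (rule prob_past_le[OF E_past])
  ultimately have "prob (\<Union>k. E k \<inter> ?F k) = S_cdf j y" using sums_unique2 by fastforce
  moreover have "prob {\<omega> \<in> space M. S (\<rho> a \<omega> + j) \<omega> - S (\<rho> a \<omega>) \<omega> \<le> y} = prob (\<Union>k. E k \<inter> ?F k)"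
  proof (rule finite_measure_eq_AE)
    show "AE \<omega> in M. (\<omega> \<in> {\<omega> \<in> space M. S (\<rho> a \<omega> + j) \<omega> - S (\<rho> a \<omega>) \<omega> \<le> y}) = (\<omega> \<in> (\<Union>k. E k \<inter> ?F k))"
      using AE_E by eventually_elim (auto dest: E_rho)
  qed auto
  ultimately show ?thesis by simp
qed

text \<open>The increments of \<open>\<rho>\<close> are stochastically dominated by \<open>\<rho>\<close> itself: after passing \<open>a\<close> the walk already
  has an overshoot.\<close>

lemma prob_rho_increment: "prob {\<omega> \<in> space M. real (\<rho> a \<omega>) + real j < real (\<rho> (a + y) \<omega>)} \<le> S_cdf j y"
proof -
  have "prob {\<omega> \<in> space M. real (\<rho> a \<omega>) + real j < real (\<rho> (a + y) \<omega>)}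
     \<le> prob {\<omega> \<in> space M. S (\<rho> a \<omega> + j) \<omega> - S (\<rho> a \<omega>) \<omega> \<le> y}"
  proof (rule finite_measure_mono_AE)
    show "AE \<omega> in M. \<omega> \<in> {\<omega> \<in> space M. real (\<rho> a \<omega>) + real j < real (\<rho> (a + y) \<omega>)}
        \<longrightarrow> \<omega> \<in> {\<omega> \<in> space M. S (\<rho> a \<omega> + j) \<omega> - S (\<rho> a \<omega>) \<omega> \<le> y}"
      using AE_unbounded
    proof eventually_elim
      case (elim \<omega>)
      show ?case
      proof (rule impI)
        assume "\<omega> \<in> {\<omega> \<in> space M. real (\<rho> a \<omega>) + real j < real (\<rho> (a + y) \<omega>)}"
        then have w: "\<omega> \<in> space M" and "real (\<rho> a \<omega>) + real j < real (\<rho> (a + y) \<omega>)" by auto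
        then have "S (\<rho> a \<omega> + j) \<omega> \<le> a + y" using less_rho_iff[OF w, of "a + y" "\<rho> a \<omega> + j"] elim by simp
        moreover have "a < S (\<rho> a \<omega>) \<omega>" using rho_le_iff[OF w, of a "\<rho> a \<omega>"] elim by simp
        ultimately show "\<omega> \<in> {\<omega> \<in> space M. S (\<rho> a \<omega> + j) \<omega> - S (\<rho> a \<omega>) \<omega> \<le> y}" using w by simp
      qed
    qed
  qed measurable
  then show ?thesis by (simp add: prob_after_passage)
qed

text \<open>An interval is visited no more often than an interval of the same length that starts at \<open>0\<close>: restart the walk
  at its first point beyond \<open>a\<close>.\<close>

lemma sum_prob_interval: "(\<Sum>k<n. prob {\<omega> \<in> space M. a < S k \<omega> \<and> S k \<omega> \<le> a + y}) \<le> 2 * real (med y)"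
proof -
  let ?A = "\<lambda>k. {\<omega> \<in> space M. a < S k \<omega> \<and> S k \<omega> \<le> a + y}"
  let ?B = "\<lambda>j. {\<omega> \<in> space M. S (\<rho> a \<omega> + j) \<omega> - S (\<rho> a \<omega>) \<omega> \<le> y}"
  have "(\<Sum>k<n. prob (?A k)) = (\<Sum>k<n. expectation (indicator (?A k)))" by simp
  also have "\<dots> = expectation (\<lambda>\<omega>. \<Sum>k<n. indicator (?A k) \<omega>)"
    by (subst Bochner_Integration.integral_sum) (auto simp: less_top[symmetric])
  also have "\<dots> \<le> expectation (\<lambda>\<omega>. \<Sum>j<n. indicator (?B j) \<omega>)"
  proof (rule integral_mono_AE)
    show "integrable M (\<lambda>\<omega>. \<Sum>k<n. indicator (?A k) \<omega> :: real)" "integrable M (\<lambda>\<omega>. \<Sum>j<n. indicator (?B j) \<omega> :: real)"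
      by (intro Bochner_Integration.integrable_sum; simp add: less_top[symmetric])+
    show "AE \<omega> in M. (\<Sum>k<n. indicator (?A k) \<omega> :: real) \<le> (\<Sum>j<n. indicator (?B j) \<omega>)"
      using AE_unbounded AE_space
    proof eventually_elim
      case (elim \<omega>)
      let ?K = "{k\<in>{..<n}. \<omega> \<in> ?A k}" and ?J = "{j\<in>{..<n}. \<omega> \<in> ?B j}"
      have a: "a < S (\<rho> a \<omega>) \<omega>" using rho_le_iff[OF elim(2), of a "\<rho> a \<omega>"] elim(1) by simp
      have ge: "\<rho> a \<omega> \<le> k" if "k \<in> ?K" for k
        using rho_le_iff[OF elim(2), of a k] elim(1) that by simp
      have "card ?K \<le> card ?J"
      proof (rule card_inj_on_le)
        show "inj_on (\<lambda>k. k - \<rho> a \<omega>) ?K"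
          using ge by (auto simp: inj_on_def) (metis (no_types, lifting) eq_diff_iff)
        show "(\<lambda>k. k - \<rho> a \<omega>) ` ?K \<subseteq> ?J"
        proof (rule image_subsetI)
          fix k assume k: "k \<in> ?K"
          then show "k - \<rho> a \<omega> \<in> ?J" using a ge[OF k] elim(2) by auto
        qed
      qed simp
      moreover have "(\<Sum>k<n. indicator (?A k) \<omega> :: real) = card ?K" "(\<Sum>k<n. indicator (?B k) \<omega> :: real) = card ?J"
        by (simp_all add: indicator_def sum.If_cases Int_def)
      ultimately show ?case by simp
    qed
  qed
  also have "\<dots> = (\<Sum>j<n. S_cdf j y)"
    by (subst Bochner_Integration.integral_sum) (auto simp: prob_after_passage less_top[symmetric])
  finally show ?thesis using sum_S_cdf_le[of y n] by simp
qed

text \<open>Ottaviani's inequality in a general form: whenever an event \<open>E j\<close>, decided at time \<open>k j\<close>, occurs, an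
  independent later event of probability at least \<open>1 / 2\<close> suffices for \<open>C\<close>. The events are added in the
  order of their times, so that each new part \<open>E x - (\<Union>j\<in>J. E j)\<close> is still decided at time \<open>k x\<close>.\<close>

lemma maximal_inequality:
  fixes k :: "'j \<Rightarrow> nat"
  assumes "finite J" and E: "\<And>j. j \<in> J \<Longrightarrow> E j \<in> sets (past (k j))"
    and B: "\<And>j. j \<in> J \<Longrightarrow> B j \<in> sets (future (k j))" "\<And>j. j \<in> J \<Longrightarrow> 1 / 2 \<le> prob (B j)"
    and C: "C \<in> events" "\<And>j. j \<in> J \<Longrightarrow> E j \<inter> B j \<subseteq> C"
  shows "prob (\<Union>j\<in>J. E j) \<le> 2 * prob (C \<inter> (\<Union>j\<in>J. E j))"
  using assms(1,2,3,4,6)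
proof (induction J rule: finite_ranking_induct[where f=k])
  case empty
  then show ?case by simp
next
  case (insert x J)
  let ?U = "\<Union>j\<in>J. E j" and ?A = "E x - (\<Union>j\<in>J. E j)"
  have past: "E j \<in> sets (past (k x))" if "j \<in> J" for j
    using insert.hyps(2)[OF that] insert.prems(1)[of j] that by (intro steps_mono[of "{..<k j}" "{..<k x}"]) auto
  have U: "?U \<in> sets (past (k x))" using insert.hyps past by (intro sets.finite_UN) auto
  have A: "?A \<in> sets (past (k x))" using U insert.prems(1)[of x] by auto
  have ev [measurable]: "?U \<in> events" "?A \<in> events" "B x \<in> events"
    using steps_subalgebra[OF U] steps_subalgebra[OF A] steps_subalgebra[OF insert.prems(2)[of x]] by auto
  have IH: "prob ?U \<le> 2 * prob (C \<inter> ?U)"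
    by (rule insert.IH) (use insert.prems in auto)
  have "prob ?A \<le> 2 * (prob ?A * prob (B x))"
    using mult_left_mono[of "1/2" "prob (B x)" "prob ?A"] insert.prems(3)[of x] by simp
  also have "\<dots> = 2 * prob (?A \<inter> B x)" by (subst prob_past_future[OF A insert.prems(2)]) auto
  also have "\<dots> \<le> 2 * prob (C \<inter> ?A)"
    using insert.prems(4)[of x] C ev by (intro mult_left_mono finite_measure_mono) auto
  finally have Ale: "prob ?A \<le> 2 * prob (C \<inter> ?A)" .
  have "prob (\<Union>j\<in>insert x J. E j) = prob (?U \<union> ?A)" by (rule arg_cong[where f=prob]) auto
  also have "\<dots> = prob ?U + prob ?A" using ev by (intro finite_measure_Union) auto
  also have "\<dots> \<le> 2 * (prob (C \<inter> ?U) + prob (C \<inter> ?A))" using IH Ale by simp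
  also have "prob (C \<inter> ?U) + prob (C \<inter> ?A) = prob ((C \<inter> ?U) \<union> (C \<inter> ?A))"
    using ev C by (intro finite_measure_Union[symmetric]) auto
  also have "(C \<inter> ?U) \<union> (C \<inter> ?A) = C \<inter> (\<Union>j\<in>insert x J. E j)" by auto
  finally show ?case .
qed

text \<open>If the walk crosses some level \<open>j\<close> early, then with probability at least \<open>1 / 2\<close> it needs at most
  \<open>med (x - j)\<close> further steps to cross \<open>x\<close>.\<close>

lemma prob_exists_rho_le:
  assumes "finite J" and J: "\<And>j. j \<in> J \<Longrightarrow> real (med (x - j)) + r j \<le> s"
  shows "prob {\<omega> \<in> space M. \<exists>j\<in>J. real (\<rho> j \<omega>) \<le> r j} \<le> 2 * rho_cdf x s"
proof -
  let ?k = "\<lambda>j. nat \<lfloor>r j\<rfloor>" and ?J = "{j\<in>J. 0 \<le> r j}"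
  let ?E = "\<lambda>j. {\<omega> \<in> space M. j < S (?k j) \<omega>}"
  let ?C = "{\<omega> \<in> space M. 0 \<le> s \<and> x < S (nat \<lfloor>s\<rfloor>) \<omega>}"
  have "prob {\<omega> \<in> space M. \<exists>j\<in>J. real (\<rho> j \<omega>) \<le> r j} = prob (\<Union>j\<in>?J. ?E j)"
  proof (rule finite_measure_eq_AE)
    show "AE \<omega> in M. (\<omega> \<in> {\<omega> \<in> space M. \<exists>j\<in>J. real (\<rho> j \<omega>) \<le> r j}) = (\<omega> \<in> (\<Union>j\<in>?J. ?E j))"
      using AE_unbounded by eventually_elim (use real_rho_le_iff in auto)
  qed (use \<open>finite J\<close> in auto)
  also have "\<dots> \<le> 2 * prob (?C \<inter> (\<Union>j\<in>?J. ?E j))"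
  proof (rule maximal_inequality[where B="\<lambda>j. {\<omega> \<in> space M. x - j < S (?k j + med (x - j)) \<omega> - S (?k j) \<omega>}" and k = ?k])
    fix j assume j: "j \<in> ?J"
    show "?E j \<in> sets (past (?k j))" by (rule gt_S_past) simp
    show "{\<omega> \<in> space M. x - j < S (?k j + med (x - j)) \<omega> - S (?k j) \<omega>} \<in> sets (future (?k j))"
      using measurable_sets[OF S_future[of "?k j" "?k j" "?k j + med (x - j)"], of "{x - j<..}"]
      by (simp add: vimage_def Int_def conj_commute)
    show "1 / 2 \<le> prob {\<omega> \<in> space M. x - j < S (?k j + med (x - j)) \<omega> - S (?k j) \<omega>}"
      using S_cdf_med[of "x - j"] by (simp add: prob_gt_shift)
    have le: "0 \<le> s" "?k j + med (x - j) \<le> nat \<lfloor>s\<rfloor>" using J[of j] j by (auto, linarith)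
    show "?E j \<inter> {\<omega> \<in> space M. x - j < S (?k j + med (x - j)) \<omega> - S (?k j) \<omega>} \<subseteq> ?C"
    proof (rule subsetI)
      fix \<omega> assume "\<omega> \<in> ?E j \<inter> {\<omega> \<in> space M. x - j < S (?k j + med (x - j)) \<omega> - S (?k j) \<omega>}"
      then have "\<omega> \<in> space M" "x < S (?k j + med (x - j)) \<omega>" by auto
      with S_mono[OF _ le(2), of \<omega>] le(1) show "\<omega> \<in> ?C" by simp
    qed
  qed (use \<open>finite J\<close> in auto)
  also have "\<dots> \<le> 2 * prob ?C" using \<open>finite J\<close> by (intro mult_left_mono finite_measure_mono) auto
  also have "prob ?C = rho_cdf x s" by (simp add: rho_cdf_eq prob_gt)
  finally show ?thesis .
qed

text \<open>If the walk crosses some level \<open>j\<close> late, then with probability at least \<open>1 / 2\<close> it stays below \<open>x\<close>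
  for another \<open>med (x - j) - 1\<close> steps.\<close>

lemma prob_exists_rho_gt:
  assumes "finite J" and J: "\<And>j. j \<in> J \<Longrightarrow> 0 \<le> j \<and> j \<le> x \<and> s + 1 \<le> real (med (x - j)) + r j"
  shows "prob {\<omega> \<in> space M. \<exists>j\<in>J. r j < real (\<rho> j \<omega>)} \<le> 2 * (1 - rho_cdf x s)"
proof (cases "s < 0")
  case True
  then show ?thesis
    using order_trans[OF prob_le_1, of 2 "{\<omega> \<in> space M. \<exists>j\<in>J. r j < real (\<rho> j \<omega>)}"] by (simp add: rho_cdf_eq)
next
  case False
  let ?k = "\<lambda>j. nat \<lfloor>r j\<rfloor>" and ?m = "\<lambda>j. med (x - j) - 1"
  let ?E = "\<lambda>j. {\<omega> \<in> space M. S (?k j) \<omega> \<le> j}"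
  let ?C = "{\<omega> \<in> space M. S (nat \<lfloor>s\<rfloor>) \<omega> \<le> x}"
  have "prob {\<omega> \<in> space M. \<exists>j\<in>J. r j < real (\<rho> j \<omega>)} \<le> prob (\<Union>j\<in>J. ?E j)"
  proof (rule finite_measure_mono_AE)
    show "AE \<omega> in M. \<omega> \<in> {\<omega> \<in> space M. \<exists>j\<in>J. r j < real (\<rho> j \<omega>)} \<longrightarrow> \<omega> \<in> (\<Union>j\<in>J. ?E j)"
      using AE_unbounded
    proof eventually_elim
      case (elim \<omega>)
      show ?case
      proof clarsimp
        fix j assume w: "\<omega> \<in> space M" and j: "j \<in> J" "r j < real (\<rho> j \<omega>)"
        have "S (?k j) \<omega> \<le> j"
          using real_rho_le_iff[OF w, of j "r j"] elim j J[of j] by (cases "0 \<le> r j") auto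
        then show "\<exists>j\<in>J. S (?k j) \<omega> \<le> j" using j by blast
      qed
    qed
  qed (use \<open>finite J\<close> in auto)
  also have "\<dots> \<le> 2 * prob (?C \<inter> (\<Union>j\<in>J. ?E j))"
  proof (rule maximal_inequality[where B="\<lambda>j. {\<omega> \<in> space M. S (?k j + ?m j) \<omega> - S (?k j) \<omega> \<le> x - j}" and k = ?k])
    fix j assume j: "j \<in> J"
    show "?E j \<in> sets (past (?k j))" by (rule le_S_past) simp
    show "{\<omega> \<in> space M. S (?k j + ?m j) \<omega> - S (?k j) \<omega> \<le> x - j} \<in> sets (future (?k j))"
      using measurable_sets[OF S_future[of "?k j" "?k j" "?k j + ?m j"], of "{..x - j}"]
      by (simp add: vimage_def Int_def conj_commute)
    have pos: "0 < med (x - j)" using J[OF j] by (intro med_pos) auto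
    then show "1 / 2 \<le> prob {\<omega> \<in> space M. S (?k j + ?m j) \<omega> - S (?k j) \<omega> \<le> x - j}"
      using less_med[of "?m j" "x - j"] unfolding S_cdf_shift by simp
    have le: "nat \<lfloor>s\<rfloor> \<le> ?k j + ?m j" using J[OF j] pos by linarith
    show "?E j \<inter> {\<omega> \<in> space M. S (?k j + ?m j) \<omega> - S (?k j) \<omega> \<le> x - j} \<subseteq> ?C"
    proof (rule subsetI)
      fix \<omega> assume "\<omega> \<in> ?E j \<inter> {\<omega> \<in> space M. S (?k j + ?m j) \<omega> - S (?k j) \<omega> \<le> x - j}"
      then have "\<omega> \<in> space M" "S (?k j + ?m j) \<omega> \<le> x" by auto
      with S_mono[OF _ le, of \<omega>] show "\<omega> \<in> ?C" by simp
    qed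
  qed (use \<open>finite J\<close> in auto)
  also have "\<dots> \<le> 2 * prob ?C" using \<open>finite J\<close> by (intro mult_left_mono finite_measure_mono) auto
  also have "prob ?C = 1 - rho_cdf x s" using False by (simp add: rho_cdf_eq S_cdf_def)
  finally show ?thesis .
qed

end

section \<open>A concentrated sum has few summands\<close>

text \<open>Taylor expansion up to \<open>u = 2\<close>, and \<open>|sin u| \<le> 1\<close> beyond.\<close>

lemma one_minus_sinc_ge:
  fixes u :: real
  assumes "u \<noteq> 0"
  shows "2 / 15 * min 1 (u\<^sup>2) \<le> 1 - sin u / u"
proof -
  have pos: "2 / 15 * min 1 (v\<^sup>2) \<le> 1 - sin v / v" if v: "0 < v" for v :: real
  proof (cases "v \<le> 2")
    case True
    have "\<bar>sin v - (\<Sum>m<5. sin_coeff m * v ^ m)\<bar> \<le> inverse (fact 5) * \<bar>v\<bar> ^ 5"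
      by (rule Maclaurin_sin_bound)
    moreover have "(\<Sum>m<5. sin_coeff m * v ^ m) = v - v ^ 3 / 6"
    proof -
      have "{..<5::nat} = {0, 1, 2, 3, 4}" by auto
      then show ?thesis by (simp add: sin_coeff_def fact_numeral)
    qed
    moreover have "inverse (fact 5) * \<bar>v\<bar> ^ 5 = v ^ 5 / 120"
      using v by (simp add: fact_numeral)
    ultimately have "sin v \<le> v - v ^ 3 / 6 + v ^ 5 / 120"
      by linarith
    then have "sin v / v \<le> (v - v ^ 3 / 6 + v ^ 5 / 120) / v" using v by (intro divide_right_mono) auto
    also have "\<dots> = 1 - v\<^sup>2 * (1 / 6 - v\<^sup>2 / 120)" using v by (simp add: field_simps power_numeral_reduce)
    also have "\<dots> \<le> 1 - v\<^sup>2 * (2 / 15)"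
    proof -
      have "v\<^sup>2 \<le> 2\<^sup>2" using v True by (intro power_mono) auto
      then have "v\<^sup>2 * (2 / 15) \<le> v\<^sup>2 * (1 / 6 - v\<^sup>2 / 120)" by (intro mult_left_mono) auto
      then show ?thesis by simp
    qed
    finally show ?thesis using min.cobounded2[of 1 "v\<^sup>2"] by linarith
  next
    case False
    have "sin v \<le> 1" by simp
    then have "2 * sin v \<le> v" using False by linarith
    then have "sin v / v \<le> 1 / 2" using v by (simp add: divide_le_eq)
    then show ?thesis using min.cobounded1[of 1 "v\<^sup>2"] by linarith
  qed
  show ?thesis using pos[of u] pos[of "- u"] assms by (cases "0 < u") auto
qed

text \<open>Averaging \<open>1 - cos (s u)\<close> over \<open>s\<close> removes its zeros at large \<open>u\<close> and leaves a truncated square.\<close>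

lemma nn_integral_one_minus_cos:
  fixes u :: real
  shows "ennreal (2 / 15 * min 1 (u\<^sup>2)) \<le> (\<integral>\<^sup>+s. ennreal (1 - cos (s * u)) * indicator {0..1} s \<partial>lborel)"
proof (cases "u = 0")
  case False
  have "(\<integral>\<^sup>+s. ennreal (1 - cos (s * u)) * indicator {0..1} s \<partial>lborel)
     = ennreal ((1 - sin (1 * u) / u) - (0 - sin (0 * u) / u))"
    using False by (intro nn_integral_FTC_Icc) (auto intro!: derivative_eq_intros)
  then show ?thesis using one_minus_sinc_ge[OF False] by (simp add: ennreal_leI)
qed simp

context perturbed_walk
begin

text \<open>The symmetrized step. Its characteristic function is the squared modulus of that of a step.\<close>

abbreviation sym_step :: "'a \<Rightarrow> real" where "sym_step \<omega> \<equiv> \<xi> 0 \<omega> - \<xi> 1 \<omega>"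

lemma indep_xi: "indep_vars (\<lambda>_. borel) \<xi> UNIV"
proof -
  have "indep_vars (\<lambda>_. borel) (\<lambda>i \<omega>. fst (\<xi> i \<omega>, \<eta> i \<omega>)) UNIV"
    by (rule indep_vars_compose2[OF indep]) (simp add: borel_prod[symmetric])
  then show ?thesis by simp
qed

lemma indep_xi_01: "indep_var borel (\<xi> 0) borel (\<xi> 1)"
  by (rule indep_past_future[where k=1]) (auto intro: xi_steps)

lemma char_S: "char (distr M borel (S l)) t = char (distr M borel (\<xi> 0)) t ^ l"
proof -
  have "char (distr M borel (\<lambda>\<omega>. \<Sum>i\<in>{..<l}. \<xi> i \<omega>)) t = (\<Prod>i\<in>{..<l}. char (distr M borel (\<xi> i)) t)"
    by (rule char_distr_sum, rule indep_vars_subset[OF indep_xi]) simp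
  also have "\<dots> = (\<Prod>i\<in>{..<l}. char (distr M borel (\<xi> 0)) t)"
    by (intro prod.cong refl arg_cong[where f="\<lambda>\<nu>. char \<nu> t"] distr_xi)
  finally show ?thesis by (simp add: S_def[abs_def])
qed

lemma Re_char: "Re (char (distr M borel X) t) = expectation (\<lambda>\<omega>. cos (t * X \<omega>))"
  if [measurable]: "X \<in> borel_measurable M" for X :: "'a \<Rightarrow> real"
proof -
  have int: "integrable M (\<lambda>\<omega>. iexp (t * X \<omega>))"
    by (rule integrable_const_bound[of _ 1]) auto
  have "char (distr M borel X) t = (CLINT \<omega>|M. iexp (t * X \<omega>))"
    by (simp add: char_def integral_distr)
  then show ?thesis using integral_Re[OF int] by (simp add: Re_exp)
qed

lemma char_symmetrization: "expectation (\<lambda>\<omega>. cos (t * sym_step \<omega>)) = (cmod (char (distr M borel (\<xi> 0)) t))\<^sup>2"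
proof -
  have "indep_var borel (\<xi> 0) borel ((\<lambda>x. - x) \<circ> \<xi> 1)"
    using indep_var_compose[OF indep_xi_01, of "\<lambda>x. x" borel "\<lambda>x. - x" borel] by (simp add: comp_def)
  then have *: "char (distr M borel (\<lambda>\<omega>. \<xi> 0 \<omega> + - \<xi> 1 \<omega>)) t
      = char (distr M borel (\<xi> 0)) t * char (distr M borel (\<lambda>\<omega>. - \<xi> 1 \<omega>)) t"
    by (subst char_distr_add) (simp_all add: comp_def)
  have "char (distr M borel (\<lambda>\<omega>. - \<xi> 1 \<omega>)) t = (CLINT \<omega>|M. cnj (iexp (t * \<xi> 1 \<omega>)))"
    by (simp add: char_def integral_distr exp_cnj)
  also have "\<dots> = cnj (CLINT \<omega>|M. iexp (t * \<xi> 1 \<omega>))" by (rule Bochner_Integration.integral_cnj)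
  also have "\<dots> = cnj (char (distr M borel (\<xi> 1)) t)" by (simp add: char_def integral_distr)
  also have "\<dots> = cnj (char (distr M borel (\<xi> 0)) t)" by (simp only: distr_xi[of 1])
  finally have "char (distr M borel (\<lambda>\<omega>. \<xi> 0 \<omega> + - \<xi> 1 \<omega>)) t = of_real ((cmod (char (distr M borel (\<xi> 0)) t))\<^sup>2)"
    unfolding * complex_norm_square by simp
  then have "Re (char (distr M borel sym_step) t) = (cmod (char (distr M borel (\<xi> 0)) t))\<^sup>2" by simp
  then show ?thesis by (subst (asm) Re_char) auto
qed

text \<open>If \<open>S l\<close> is concentrated on an interval of length \<open>A\<close>, its characteristic function has modulus at least
  \<open>1 / 4\<close> on \<open>[- 1 / A, 1 / A]\<close>. It is the \<open>l\<close>-th power of that of a step, which therefore is within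
  \<open>O(1 / l)\<close> of modulus \<open>1\<close>.\<close>

lemma concentrated_char_bound:
  assumes A: "0 < A" and conc: "7 / 8 \<le> prob {\<omega> \<in> space M. x - A \<le> S l \<omega> \<and> S l \<omega> \<le> x}"
    and t: "\<bar>t\<bar> \<le> 1 / A"
  shows "real l * (1 - expectation (\<lambda>\<omega>. cos (t * sym_step \<omega>))) \<le> 15"
proof -
  let ?E = "{\<omega> \<in> space M. x - A \<le> S l \<omega> \<and> S l \<omega> \<le> x}"
  let ?\<phi> = "char (distr M borel (\<xi> 0)) t"
  have int: "integrable M (\<lambda>\<omega>. iexp (t * S l \<omega>))"
    by (rule integrable_const_bound[of _ 1]) auto
  have "5 / 16 \<le> 3 / 2 * prob ?E - 1" using conc by simp
  also have "\<dots> = expectation (\<lambda>\<omega>. 3 / 2 * indicator ?E \<omega> - 1)"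
    by (subst Bochner_Integration.integral_diff) (auto simp: prob_space less_top[symmetric])
  also have "\<dots> \<le> expectation (\<lambda>\<omega>. cos (t * (S l \<omega> - x)))"
  proof (rule integral_mono)
    show "integrable M (\<lambda>\<omega>. 3 / 2 * indicator ?E \<omega> - 1 :: real)"
      by (intro Bochner_Integration.integrable_diff integrable_mult_right) (auto simp: less_top[symmetric])
    show "integrable M (\<lambda>\<omega>. cos (t * (S l \<omega> - x)))"
      by (rule integrable_const_bound[of _ 1]) auto
    fix \<omega> assume "\<omega> \<in> space M"
    show "3 / 2 * indicator ?E \<omega> - 1 \<le> cos (t * (S l \<omega> - x))"
    proof (cases "\<omega> \<in> ?E")
      case True
      then have "\<bar>S l \<omega> - x\<bar> \<le> A" by auto
      then have "\<bar>t\<bar> * \<bar>S l \<omega> - x\<bar> \<le> 1 / A * A" using t A by (intro mult_mono) auto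
      then have "(t * (S l \<omega> - x))\<^sup>2 \<le> 1" using A by (simp add: abs_mult abs_square_le_1)
      moreover have "1 - (t * (S l \<omega> - x))\<^sup>2 / 2 \<le> cos (t * (S l \<omega> - x))"
      proof -
        have "\<bar>sin (v / 2)\<bar>\<^sup>2 \<le> \<bar>v / 2\<bar>\<^sup>2" for v :: real by (intro power_mono abs_sin_x_le_abs_x) auto
        then have "1 - v\<^sup>2 / 2 \<le> cos v" for v :: real
          using cos_double_sin[of "v / 2"] by (simp add: power_divide mult.commute)
        then show ?thesis .
      qed
      ultimately show ?thesis using True by simp
    qed simp
  qed
  also have "\<dots> = Re (CLINT \<omega>|M. iexp (t * (S l \<omega> - x)))"
  proof -
    have "integrable M (\<lambda>\<omega>. iexp (t * (S l \<omega> - x)))"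
      by (rule integrable_const_bound[of _ 1]) auto
    from integral_Re[OF this] show ?thesis by (simp add: Re_exp)
  qed
  also have "(CLINT \<omega>|M. iexp (t * (S l \<omega> - x))) = (CLINT \<omega>|M. iexp (t * S l \<omega>) * iexp (- (t * x)))"
    by (simp add: exp_add[symmetric] algebra_simps)
  also have "\<dots> = ?\<phi> ^ l * iexp (- (t * x))"
    using int by (simp add: char_S[symmetric]) (simp add: char_def integral_distr)
  also have "Re \<dots> \<le> cmod (?\<phi> ^ l * iexp (- (t * x)))" by (rule complex_Re_le_cmod)
  also have "\<dots> = cmod ?\<phi> ^ l" by (simp add: norm_mult norm_power)
  finally have "(1 / 4)\<^sup>2 \<le> (cmod ?\<phi> ^ l)\<^sup>2" by (intro power_mono) auto
  define u where "u = (cmod ?\<phi>)\<^sup>2"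
  have u: "1 / 16 \<le> u ^ l" using \<open>(1 / 4)\<^sup>2 \<le> (cmod ?\<phi> ^ l)\<^sup>2\<close>
    by (simp add: u_def power_mult[symmetric] mult.commute power2_eq_square power_mult_distrib)
  have u_eq: "u = expectation (\<lambda>\<omega>. cos (t * sym_step \<omega>))" by (simp only: u_def char_symmetrization)
  have u01: "0 \<le> u" "u \<le> 1"
  proof -
    interpret d: real_distribution "distr M borel (\<xi> 0)" by (rule real_distribution_distr) simp
    show "u \<le> 1" unfolding u_def using d.cmod_char_le_1[of t] by (simp add: power_le_one)
  qed (simp add: u_def)
  have "u \<le> exp (- (1 - u))" using exp_ge_add_one_self[of "- (1 - u)"] by simp
  then have "u ^ l \<le> exp (- (1 - u)) ^ l" using u01 by (intro power_mono)
  also have "\<dots> = inverse (exp (real l * (1 - u)))" by (simp add: exp_of_nat_mult[symmetric] exp_minus[symmetric] algebra_simps)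
  also have "\<dots> \<le> inverse (1 + real l * (1 - u))"
    using u01 by (intro le_imp_inverse_le exp_ge_add_one_self add_pos_nonneg) auto
  finally have "1 / 16 \<le> inverse (1 + real l * (1 - u))" using u by simp
  moreover have "0 \<le> real l * (1 - u)" using u01 by simp
  ultimately have "real l * (1 - u) \<le> 15" by (simp add: field_simps)
  then show ?thesis unfolding u_eq .
qed

text \<open>The previous bound integrated over \<open>t = s / A\<close> with \<open>s \<in> [0, 1]\<close>.\<close>

lemma concentrated_truncated_variance:
  assumes A: "0 < A" and conc: "7 / 8 \<le> prob {\<omega> \<in> space M. x - A \<le> S l \<omega> \<and> S l \<omega> \<le> x}"
  shows "real l * expectation (\<lambda>\<omega>. min 1 ((sym_step \<omega> / A)\<^sup>2)) \<le> 225 / 2"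
proof -
  have int: "integrable M (\<lambda>\<omega>. min 1 ((sym_step \<omega> / A)\<^sup>2))"
    by (rule integrable_const_bound[of _ 1]) auto
  interpret pair_sigma_finite M lborel ..
  have "ennreal (real l * (2 / 15 * expectation (\<lambda>\<omega>. min 1 ((sym_step \<omega> / A)\<^sup>2))))
     = ennreal (real l) * (\<integral>\<^sup>+\<omega>. ennreal (2 / 15 * min 1 ((sym_step \<omega> / A)\<^sup>2)) \<partial>M)"
    using int by (subst nn_integral_eq_integral) (auto simp: ennreal_mult'[symmetric])
  also have "\<dots> \<le> ennreal (real l) * (\<integral>\<^sup>+\<omega>. \<integral>\<^sup>+s. ennreal (1 - cos (s * (sym_step \<omega> / A))) * indicator {0..1} s \<partial>lborel \<partial>M)"
    by (intro mult_left_mono nn_integral_mono nn_integral_one_minus_cos) auto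
  also have "\<dots> = ennreal (real l) * (\<integral>\<^sup>+s. \<integral>\<^sup>+\<omega>. ennreal (1 - cos (s * (sym_step \<omega> / A))) * indicator {0..1} s \<partial>M \<partial>lborel)"
    by (subst Fubini') auto
  also have "\<dots> = (\<integral>\<^sup>+s. ennreal (real l) * (\<integral>\<^sup>+\<omega>. ennreal (1 - cos (s * (sym_step \<omega> / A))) * indicator {0..1} s \<partial>M) \<partial>lborel)"
    by (subst nn_integral_cmult) auto
  also have "\<dots> \<le> (\<integral>\<^sup>+s. 15 * indicator {0..1::real} s \<partial>lborel)"
  proof (rule nn_integral_mono)
    fix s :: real
    show "ennreal (real l) * (\<integral>\<^sup>+\<omega>. ennreal (1 - cos (s * (sym_step \<omega> / A))) * indicator {0..1} s \<partial>M) \<le> 15 * indicator {0..1} s"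
    proof (cases "s \<in> {0..1}")
      case True
      have int: "integrable M (\<lambda>\<omega>. cos (s * (sym_step \<omega> / A)))"
        by (rule integrable_const_bound[of _ 1]) auto
      have "(\<integral>\<^sup>+\<omega>. ennreal (1 - cos (s * (sym_step \<omega> / A))) \<partial>M) = ennreal (1 - expectation (\<lambda>\<omega>. cos (s * (sym_step \<omega> / A))))"
        using int by (subst nn_integral_eq_integral) (auto simp: prob_space)
      then have "ennreal (real l) * (\<integral>\<^sup>+\<omega>. ennreal (1 - cos (s * (sym_step \<omega> / A))) \<partial>M)
          = ennreal (real l * (1 - expectation (\<lambda>\<omega>. cos (s / A * sym_step \<omega>))))"
        by (simp add: ennreal_mult')
      also have "\<dots> \<le> ennreal 15"
        using True A by (intro ennreal_leI concentrated_char_bound[OF A conc]) (auto simp: divide_right_mono)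
      finally show ?thesis using True by simp
    qed simp
  qed
  also have "\<dots> = ennreal 15" by (subst nn_integral_cmult_indicator) auto
  finally have "real l * (2 / 15 * expectation (\<lambda>\<omega>. min 1 ((sym_step \<omega> / A)\<^sup>2))) \<le> 15"
    by (subst (asm) ennreal_le_iff) auto
  then show ?thesis by (simp add: field_simps)
qed

lemma S_pos: "\<omega> \<in> space M \<Longrightarrow> 0 < k \<Longrightarrow> 0 < S k \<omega>"
  unfolding S_def using xi_pos by (intro sum_pos) auto

text \<open>A quantile up to a factor \<open>2\<close>, found by halving a large number until its probability drops below \<open>q\<close>.\<close>

lemma S_cdf_quantile:
  assumes "0 < k" "0 < q" "q < 1"
  shows "\<exists>A>0. q \<le> S_cdf k A \<and> S_cdf k (A / 2) \<le> q"
proof -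
  have "\<forall>\<^sub>F x in at_top. q < S_cdf k x" using S_cdf_tendsto_1 assms by (intro order_tendstoD) auto
  then have "\<forall>\<^sub>F x in at_top. q < S_cdf k x \<and> 0 < x" by (intro eventually_conj eventually_gt_at_top)
  then obtain a where a: "q < S_cdf k a" "0 < a" by (auto simp: eventually_at_top_linorder)
  have "(\<lambda>n. S_cdf k (a / 2 ^ n)) \<longlonglongrightarrow> prob (\<Inter>n. {\<omega> \<in> space M. S k \<omega> \<le> a / 2 ^ n})"
    unfolding S_cdf_def
  proof (rule finite_Lim_measure_decseq)
    show "decseq (\<lambda>n. {\<omega> \<in> space M. S k \<omega> \<le> a / 2 ^ n})"
    proof (rule decseq_SucI)
      fix n
      have "a / 2 ^ Suc n \<le> a / 2 ^ n" using a by (simp add: field_simps)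
      then show "{\<omega> \<in> space M. S k \<omega> \<le> a / 2 ^ Suc n} \<subseteq> {\<omega> \<in> space M. S k \<omega> \<le> a / 2 ^ n}"
        using order_trans by blast
    qed
  qed auto
  also have "(\<Inter>n. {\<omega> \<in> space M. S k \<omega> \<le> a / 2 ^ n}) = {}"
  proof -
    have "\<exists>n. a / 2 ^ n < y" if "0 < y" for y
      using real_arch_pow[of 2 "a / y"] that a by (auto simp: field_simps)
    then show ?thesis using S_pos[OF _ \<open>0 < k\<close>] by (auto simp: not_le[symmetric])
  qed
  finally have "(\<lambda>n. S_cdf k (a / 2 ^ n)) \<longlonglongrightarrow> 0" by simp
  then have "\<forall>\<^sub>F n in sequentially. S_cdf k (a / 2 ^ n) < q" using assms by (intro order_tendstoD) auto
  then have ex: "\<exists>n. S_cdf k (a / 2 ^ n) < q" by (auto simp: eventually_sequentially)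
  define n where "n = (LEAST n. S_cdf k (a / 2 ^ n) < q)"
  have n: "S_cdf k (a / 2 ^ n) < q" unfolding n_def using ex by (rule LeastI_ex)
  have "n \<noteq> 0" using n a by (intro notI) simp
  then obtain i where i: "n = Suc i" by (cases n) auto
  have "\<not> S_cdf k (a / 2 ^ i) < q" unfolding i[unfolded n_def, symmetric]
    using not_less_Least[of i "\<lambda>n. S_cdf k (a / 2 ^ n) < q"] i by (simp add: n_def)
  with n a show ?thesis by (intro exI[of _ "a / 2 ^ i"]) (auto simp: i mult.commute)
qed

text \<open>Markov's inequality for the truncated sum: if \<open>S K\<close> exceeds \<open>A / 2\<close>, the steps, each measured in units
  of \<open>A / 2\<close> and cut off at \<open>1\<close>, have a sum of at least \<open>1\<close>.\<close>

lemma truncated_mean_ge: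
  assumes A: "0 < A" and S_cdf: "S_cdf K (A / 2) \<le> 1 - \<epsilon>"
  shows "\<epsilon> \<le> real K * expectation (\<lambda>\<omega>. min 1 (2 * \<xi> 0 \<omega> / A))"
proof -
  have int: "integrable M (\<lambda>\<omega>. min 1 (2 * \<xi> i \<omega> / A))" for i
    by (rule integrable_const_bound[of _ 1])
       (use A xi_pos[THEN less_imp_le] in \<open>auto intro!: AE_I2 simp: abs_le_iff min_le_iff_disj\<close>)
  have same: "expectation (\<lambda>\<omega>. min 1 (2 * \<xi> i \<omega> / A)) = expectation (\<lambda>\<omega>. min 1 (2 * \<xi> 0 \<omega> / A))" for i
  proof -
    have "expectation (\<lambda>\<omega>. min 1 (2 * \<xi> i \<omega> / A)) = (LINT y|distr M borel (\<xi> i). min 1 (2 * y / A))" for i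
      by (simp add: integral_distr)
    then show ?thesis by (simp only: distr_xi[of i])
  qed
  have "\<epsilon> \<le> prob {\<omega> \<in> space M. A / 2 < S K \<omega>}" using S_cdf unfolding prob_gt by simp
  also have "\<dots> = expectation (indicator {\<omega> \<in> space M. A / 2 < S K \<omega>})" by simp
  also have "\<dots> \<le> expectation (\<lambda>\<omega>. \<Sum>i<K. min 1 (2 * \<xi> i \<omega> / A))"
  proof (rule integral_mono)
    fix \<omega> assume w: "\<omega> \<in> space M"
    have nn: "0 \<le> min 1 (2 * \<xi> i \<omega> / A)" for i using A xi_pos[OF w, of i] by simp
    show "indicator {\<omega> \<in> space M. A / 2 < S K \<omega>} \<omega> \<le> (\<Sum>i<K. min 1 (2 * \<xi> i \<omega> / A))"
    proof (cases "A / 2 < S K \<omega>")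
      case True
      show ?thesis
      proof (cases "\<exists>i<K. 1 \<le> 2 * \<xi> i \<omega> / A")
        case True
        then obtain i where i: "i < K" "1 \<le> 2 * \<xi> i \<omega> / A" by auto
        have "min 1 (2 * \<xi> i \<omega> / A) \<le> (\<Sum>i<K. min 1 (2 * \<xi> i \<omega> / A))"
          using nn i by (intro member_le_sum) auto
        moreover have "min 1 (2 * \<xi> i \<omega> / A) = 1" using i by simp
        ultimately show ?thesis by (simp add: indicator_def)
      next
        case False
        then have "(\<Sum>i<K. min 1 (2 * \<xi> i \<omega> / A)) = (\<Sum>i<K. 2 / A * \<xi> i \<omega>)"
          by (intro sum.cong) (auto simp: not_le min_def)
        also have "\<dots> = 2 / A * S K \<omega>" by (simp add: S_def sum_distrib_left)
        finally have "(\<Sum>i<K. min 1 (2 * \<xi> i \<omega> / A)) = 2 / A * S K \<omega>" .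
        moreover have "1 < 2 / A * S K \<omega>" using \<open>A / 2 < S K \<omega>\<close> A by (simp add: field_simps)
        ultimately show ?thesis using w by (simp add: indicator_def del: sum.lessThan_Suc)
      qed
    qed (use nn in \<open>simp add: sum_nonneg\<close>)
  qed (use int in \<open>auto simp: less_top[symmetric]\<close>)
  also have "\<dots> = (\<Sum>i<K. expectation (\<lambda>\<omega>. min 1 (2 * \<xi> i \<omega> / A)))"
    using int by (intro Bochner_Integration.integral_sum) auto
  also have "\<dots> = (\<Sum>i<K. expectation (\<lambda>\<omega>. min 1 (2 * \<xi> 0 \<omega> / A)))"
    by (intro sum.cong refl same)
  also have "\<dots> = real K * expectation (\<lambda>\<omega>. min 1 (2 * \<xi> 0 \<omega> / A))" by simp
  finally show ?thesis .
qed

text \<open>On the scale \<open>A\<close> of a sum of \<open>K\<close> steps, the truncated variance of a single step is at least of order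
  \<open>1 / K\<^sup>2\<close>. If \<open>A = O(K)\<close>, this is just the nondegeneracy of the step. If \<open>A\<close> is much larger than \<open>K\<close>, the truncated mean
  of a step is at least of order \<open>1 / K\<close>, symmetrization hardly changes it, and the second moment
  dominates the square of the first.\<close>

lemma truncated_variance_ge:
  assumes nondeg: "\<And>c. \<not> (AE \<omega> in M. \<xi> 0 \<omega> = c)"
  obtains c where "0 < c"
    "\<And>K A. 0 < K \<Longrightarrow> 0 < A \<Longrightarrow> S_cdf K (A / 2) \<le> 23 / 24 \<Longrightarrow>
        c \<le> (real K)\<^sup>2 * expectation (\<lambda>\<omega>. min 1 ((sym_step \<omega> / A)\<^sup>2))"
proof -
  have int: "integrable M (\<lambda>\<omega>. min 1 ((sym_step \<omega> / A)\<^sup>2))" for A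
    by (rule integrable_const_bound[of _ 1]) auto
  have int': "integrable M (\<lambda>\<omega>. min 1 (\<bar>sym_step \<omega>\<bar> / A))" if "0 < A" for A
    by (rule integrable_const_bound[of _ 1]) (use that in auto)
  define v where "v = expectation (\<lambda>\<omega>. min 1 ((sym_step \<omega> / 1)\<^sup>2))"
  have "v \<noteq> 0"
  proof
    assume "v = 0"
    then have "AE \<omega> in M. min 1 ((sym_step \<omega> / 1)\<^sup>2) = 0"
      unfolding v_def using int[of 1] by (subst (asm) integral_nonneg_eq_0_iff_AE) auto
    then have D0: "AE \<omega> in M. \<xi> 0 \<omega> = \<xi> 1 \<omega>" by eventually_elim (auto simp: min_def split: if_splits)
    \<comment> \<open>equal independent variables have a distribution function with values in \<open>{0,1}\<close>\<close>
    have zero_one: "S_cdf 1 y = 0 \<or> S_cdf 1 y = 1" for y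
    proof -
      have "S_cdf 1 y = prob ({\<omega> \<in> space M. S 1 \<omega> \<le> y} \<inter> {\<omega> \<in> space M. S (1 + 1) \<omega> - S 1 \<omega> \<le> y})"
        unfolding S_cdf_def
      proof (rule finite_measure_eq_AE)
        show "AE \<omega> in M. (\<omega> \<in> {\<omega> \<in> space M. S 1 \<omega> \<le> y})
           = (\<omega> \<in> {\<omega> \<in> space M. S 1 \<omega> \<le> y} \<inter> {\<omega> \<in> space M. S (1 + 1) \<omega> - S 1 \<omega> \<le> y})"
          using D0 by eventually_elim (auto simp: S_def numeral_2_eq_2)
      qed auto
      also have "\<dots> = S_cdf 1 y * S_cdf 1 y"
        by (subst prob_past_le[OF le_S_past]) (simp_all add: S_cdf_def)
      finally show ?thesis by auto
    qed
    \<comment> \<open>so the step is constant, equal to the point where the distribution function jumps\<close>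
    let ?Y = "{y. S_cdf 1 y = 1}" and ?c = "Inf {y. S_cdf 1 y = 1}"
    have "\<forall>\<^sub>F x in at_top. 1 / 2 < S_cdf 1 x" using S_cdf_tendsto_1 by (intro order_tendstoD) auto
    then obtain y0 where y0: "S_cdf 1 y0 = 1" using zero_one by (force simp: eventually_at_top_linorder)
    have pos: "0 \<le> y" if "S_cdf 1 y = 1" for y
    proof (rule ccontr)
      assume "\<not> 0 \<le> y"
      then have "{\<omega> \<in> space M. S 1 \<omega> \<le> y} = {}" using S_nonneg[of _ 1] by force
      then have "S_cdf 1 y = 0" by (simp only: S_cdf_def measure_empty)
      then show False using that by simp
    qed
    have bdd: "bdd_below ?Y" using pos by (auto intro!: bdd_belowI[of _ 0])
    have upper: "AE \<omega> in M. \<xi> 0 \<omega> \<le> ?c + 1 / Suc n" for n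
    proof -
      have "?c < ?c + 1 / Suc n" by simp
      then obtain y where y: "S_cdf 1 y = 1" "y < ?c + 1 / Suc n"
        using y0 by (subst (asm) cInf_less_iff[OF _ bdd]) auto
      then have "AE \<omega> in M. S 1 \<omega> \<le> y" by (simp add: S_cdf_def prob_Collect_eq_1)
      then show ?thesis by eventually_elim (use y in \<open>auto simp: S_def\<close>)
    qed
    have lower: "AE \<omega> in M. ?c - 1 / Suc n < \<xi> 0 \<omega>" for n
    proof -
      have "\<not> S_cdf 1 (?c - 1 / Suc n) = 1"
      proof
        assume "S_cdf 1 (?c - 1 / Suc n) = 1"
        then have "?c \<le> ?c - 1 / Suc n" by (intro cInf_lower bdd) auto
        then show False by simp
      qed
      then have "S_cdf 1 (?c - 1 / Suc n) = 0" using zero_one by blast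
      then have "prob {\<omega> \<in> space M. ?c - 1 / Suc n < S 1 \<omega>} = 1" by (simp add: prob_gt)
      then have "AE \<omega> in M. ?c - 1 / Suc n < S 1 \<omega>" by (subst (asm) prob_Collect_eq_1) auto
      then show ?thesis by eventually_elim (auto simp: S_def)
    qed
    have "AE \<omega> in M. \<forall>n. \<xi> 0 \<omega> \<le> ?c + 1 / Suc n \<and> ?c - 1 / Suc n < \<xi> 0 \<omega>"
      using upper lower by (simp add: AE_all_countable)
    then have "AE \<omega> in M. \<xi> 0 \<omega> = ?c"
    proof eventually_elim
      case (elim \<omega>)
      show ?case
      proof (rule ccontr)
        assume "\<xi> 0 \<omega> \<noteq> ?c"
        then obtain n where "1 / Suc n < \<bar>\<xi> 0 \<omega> - ?c\<bar>"
          using nat_approx_posE[of "\<bar>\<xi> 0 \<omega> - ?c\<bar>"] by auto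
        then show False using elim[rule_format, of n] by auto
      qed
    qed
    then show False using nondeg by blast
  qed
  moreover have "0 \<le> v" unfolding v_def by (rule integral_nonneg_AE) auto
  ultimately have v: "0 < v" by simp
  have "\<forall>\<^sub>F x in at_top. 1 / 2 < S_cdf 1 x" using S_cdf_tendsto_1 by (intro order_tendstoD) auto
  then have "\<forall>\<^sub>F x in at_top. 1 / 2 < S_cdf 1 x \<and> 0 < x" by (intro eventually_conj eventually_gt_at_top)
  then obtain b where b: "1 / 2 < S_cdf 1 b" "0 < b" by (auto simp: eventually_at_top_linorder)
  \<comment> \<open>with this threshold the error \<open>2 * b / A\<close> from symmetrization is at most a quarter of the truncated mean\<close>
  define B where "B = max 1 (192 * b)"
  have B: "1 \<le> B" "192 * b \<le> B" by (auto simp: B_def)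
  define c where "c = min (v / B\<^sup>2) (1 / (4 * 96\<^sup>2))"
  have c: "0 < c" using v B by (auto simp: c_def)
  have "c \<le> (real K)\<^sup>2 * expectation (\<lambda>\<omega>. min 1 ((sym_step \<omega> / A)\<^sup>2))"
    if K: "0 < K" and A: "0 < A" and S_cdf: "S_cdf K (A / 2) \<le> 23 / 24" for K A
  proof (cases "A \<le> B * K")
    case True
    have BK: "1 \<le> B * real K" using mult_mono[of 1 B 1 "real K"] B K by simp
    have "v / (B * K)\<^sup>2 = expectation (\<lambda>\<omega>. min 1 ((sym_step \<omega> / 1)\<^sup>2) / (B * K)\<^sup>2)"
      unfolding v_def using int[of 1] by simp
    also have "\<dots> \<le> expectation (\<lambda>\<omega>. min 1 ((sym_step \<omega> / A)\<^sup>2))"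
    proof (rule integral_mono)
      fix \<omega>
      have "min 1 ((sym_step \<omega> / 1)\<^sup>2) / (B * K)\<^sup>2 \<le> 1 / (B * K)\<^sup>2" by (intro divide_right_mono) auto
      also have "\<dots> \<le> 1 / 1" using one_le_power[OF BK, of 2] K B by (intro divide_left_mono) auto
      finally have 1: "min 1 ((sym_step \<omega> / 1)\<^sup>2) / (B * K)\<^sup>2 \<le> 1" by (simp only: div_by_1)
      have "min 1 ((sym_step \<omega> / 1)\<^sup>2) / (B * K)\<^sup>2 \<le> (sym_step \<omega>)\<^sup>2 / (B * K)\<^sup>2" by (intro divide_right_mono) auto
      also have "\<dots> \<le> (sym_step \<omega>)\<^sup>2 / A\<^sup>2" using A True K B by (intro divide_left_mono power_mono mult_pos_pos) auto
      finally show "min 1 ((sym_step \<omega> / 1)\<^sup>2) / (B * K)\<^sup>2 \<le> min 1 ((sym_step \<omega> / A)\<^sup>2)"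
        using 1 by (simp add: power_divide)
    qed (use int[of 1] int[of A] in auto)
    finally have "v / B\<^sup>2 \<le> (real K)\<^sup>2 * expectation (\<lambda>\<omega>. min 1 ((sym_step \<omega> / A)\<^sup>2))"
      using K B by (simp add: power_mult_distrib divide_le_eq mult.commute mult.left_commute)
    then show ?thesis by (simp add: c_def)
  next
    case False
    let ?f = "\<lambda>x. min 1 (2 * x / A)"
    let ?I = "\<lambda>x. indicator {..b} x :: real"
    have intf: "integrable M (\<lambda>\<omega>. ?f (\<xi> 0 \<omega>))"
      by (rule integrable_const_bound[of _ 1])
         (use A xi_pos[THEN less_imp_le] in \<open>auto intro!: AE_I2 simp: abs_le_iff min_le_iff_disj\<close>)
    have intI: "integrable M (\<lambda>\<omega>. ?I (\<xi> 1 \<omega>))"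
      by (rule integrable_const_bound[of _ 1]) auto
    have ind: "indep_var borel (?f \<circ> \<xi> 0) borel (?I \<circ> \<xi> 1)"
      by (rule indep_var_compose[OF indep_xi_01]) auto
    have "expectation (\<lambda>\<omega>. ?I (\<xi> 1 \<omega>)) = prob {\<omega> \<in> space M. S (1 + 1) \<omega> - S 1 \<omega> \<le> b}"
    proof -
      have "expectation (\<lambda>\<omega>. ?I (\<xi> 1 \<omega>)) = expectation (indicator {\<omega> \<in> space M. \<xi> 1 \<omega> \<le> b})"
        by (rule Bochner_Integration.integral_cong) (auto simp: indicator_def)
      then show ?thesis by (simp add: S_def)
    qed
    also have "\<dots> = S_cdf 1 b" by (rule S_cdf_shift)
    finally have EI: "1 / 2 \<le> expectation (\<lambda>\<omega>. ?I (\<xi> 1 \<omega>))" using b by simp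
    have m: "1 / 24 \<le> real K * expectation (\<lambda>\<omega>. ?f (\<xi> 0 \<omega>))"
      by (rule truncated_mean_ge[OF A]) (use S_cdf in simp)
    have m0: "0 \<le> expectation (\<lambda>\<omega>. ?f (\<xi> 0 \<omega>))"
      by (rule integral_nonneg_AE) (use A xi_pos[THEN less_imp_le] in auto)
    have "expectation (\<lambda>\<omega>. ?f (\<xi> 0 \<omega>)) * (1 / 2) \<le> expectation (\<lambda>\<omega>. ?f (\<xi> 0 \<omega>)) * expectation (\<lambda>\<omega>. ?I (\<xi> 1 \<omega>))"
      by (intro mult_left_mono EI m0)
    also have "\<dots> = expectation (\<lambda>\<omega>. ?f (\<xi> 0 \<omega>) * ?I (\<xi> 1 \<omega>))"
      using indep_var_lebesgue_integral[OF ind] intf intI by (simp add: comp_def)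
    also have "\<dots> \<le> expectation (\<lambda>\<omega>. 2 * min 1 (\<bar>sym_step \<omega>\<bar> / A) + 2 * b / A)"
    proof (rule integral_mono)
      show "integrable M (\<lambda>\<omega>. ?f (\<xi> 0 \<omega>) * ?I (\<xi> 1 \<omega>))"
        using indep_var_integrable[OF ind] intf intI by (simp add: comp_def)
      fix \<omega> assume w: "\<omega> \<in> space M"
      have nn: "0 \<le> 2 * min 1 (\<bar>sym_step \<omega>\<bar> / A)" "0 \<le> 2 * b / A" using A b by auto
      show "?f (\<xi> 0 \<omega>) * ?I (\<xi> 1 \<omega>) \<le> 2 * min 1 (\<bar>sym_step \<omega>\<bar> / A) + 2 * b / A"
      proof (cases "\<xi> 1 \<omega> \<le> b")
        case True
        have "\<xi> 0 \<omega> \<le> \<bar>sym_step \<omega>\<bar> + b" using True by arith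
        then have "2 * \<xi> 0 \<omega> \<le> 2 * (\<bar>sym_step \<omega>\<bar> + b)" by (intro mult_left_mono) auto
        then have "2 * \<xi> 0 \<omega> / A \<le> 2 * (\<bar>sym_step \<omega>\<bar> + b) / A" using A by (intro divide_right_mono) auto
        also have "\<dots> = 2 * (\<bar>sym_step \<omega>\<bar> / A) + 2 * b / A" by (simp add: add_divide_distrib)
        finally show ?thesis using True nn by (auto simp: min_def)
      qed (use nn in simp)
    qed (use int'[OF A] in auto)
    also have "\<dots> = 2 * expectation (\<lambda>\<omega>. min 1 (\<bar>sym_step \<omega>\<bar> / A)) + 2 * b / A"
      using int'[OF A] by (simp add: prob_space)
    finally have "expectation (\<lambda>\<omega>. ?f (\<xi> 0 \<omega>)) * (1 / 2) \<le> 2 * expectation (\<lambda>\<omega>. min 1 (\<bar>sym_step \<omega>\<bar> / A)) + 2 * b / A" .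
    then have "real K * (expectation (\<lambda>\<omega>. ?f (\<xi> 0 \<omega>)) * (1 / 2)) \<le> real K * (2 * expectation (\<lambda>\<omega>. min 1 (\<bar>sym_step \<omega>\<bar> / A)) + 2 * b / A)"
      by (intro mult_left_mono) auto
    with m have "1 / 48 \<le> real K * (2 * expectation (\<lambda>\<omega>. min 1 (\<bar>sym_step \<omega>\<bar> / A))) + real K * (2 * b / A)"
      by (simp add: distrib_left)
    moreover have "real K * (2 * b / A) \<le> 1 / 96"
    proof -
      have "192 * b * real K \<le> B * real K" using B by (intro mult_right_mono) auto
      then have "192 * b * real K \<le> A" using False by simp
      then show ?thesis using A by (simp add: field_simps)
    qed
    ultimately have "1 / 96 \<le> 2 * (real K * expectation (\<lambda>\<omega>. min 1 (\<bar>sym_step \<omega>\<bar> / A)))" by simp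
    then have "(1 / (2 * 96))\<^sup>2 \<le> (real K * expectation (\<lambda>\<omega>. min 1 (\<bar>sym_step \<omega>\<bar> / A)))\<^sup>2"
      by (intro power_mono) auto
    also have "\<dots> = (real K)\<^sup>2 * (expectation (\<lambda>\<omega>. min 1 (\<bar>sym_step \<omega>\<bar> / A)))\<^sup>2" by (simp add: power_mult_distrib)
    also have "\<dots> \<le> (real K)\<^sup>2 * expectation (\<lambda>\<omega>. (min 1 (\<bar>sym_step \<omega>\<bar> / A))\<^sup>2)"
    proof (rule mult_left_mono)
      have isq: "integrable M (\<lambda>\<omega>. (min 1 (\<bar>sym_step \<omega>\<bar> / A))\<^sup>2)"
        by (rule integrable_const_bound[of _ 1]) (use A in \<open>auto simp: abs_square_le_1\<close>)
      show "(expectation (\<lambda>\<omega>. min 1 (\<bar>sym_step \<omega>\<bar> / A)))\<^sup>2 \<le> expectation (\<lambda>\<omega>. (min 1 (\<bar>sym_step \<omega>\<bar> / A))\<^sup>2)"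
        using variance_positive[of "\<lambda>\<omega>. min 1 (\<bar>sym_step \<omega>\<bar> / A)"]
        unfolding variance_eq[OF int'[OF A] isq] by linarith
    qed simp
    also have "(\<lambda>\<omega>. (min 1 (\<bar>sym_step \<omega>\<bar> / A))\<^sup>2) = (\<lambda>\<omega>. min 1 ((sym_step \<omega> / A)\<^sup>2))"
    proof
      fix \<omega>
      have "0 \<le> \<bar>sym_step \<omega>\<bar> / A" using A by simp
      moreover have "(sym_step \<omega> / A)\<^sup>2 = (\<bar>sym_step \<omega>\<bar> / A)\<^sup>2" by (simp add: power_divide)
      moreover have "(min 1 w)\<^sup>2 = min 1 (w\<^sup>2)" if "0 \<le> w" for w :: real
        using that power_le_one[of w 2] one_le_power[of w 2] by (auto simp: min_def)
      ultimately show "(min 1 (\<bar>sym_step \<omega>\<bar> / A))\<^sup>2 = min 1 ((sym_step \<omega> / A)\<^sup>2)" by simp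
    qed
    finally show ?thesis by (simp add: c_def power_mult_distrib power_divide)
  qed
  with c show thesis by (rule that)
qed

text \<open>The hypotheses say that the first passage over \<open>x\<close> happens between times \<open>l\<close> and \<open>l + K\<close> with high
  probability. Then \<open>S l\<close> is concentrated on \<open>[x - A, x]\<close>, where \<open>A\<close> is a quantile of \<open>S K\<close>, and the two
  bounds on the truncated variance at scale \<open>A\<close> can be compared.\<close>

lemma concentration_bound:
  assumes nondeg: "\<And>c. \<not> (AE \<omega> in M. \<xi> 0 \<omega> = c)"
  obtains C where "0 < C"
    "\<And>K l x. 0 < K \<Longrightarrow> 23 / 24 \<le> S_cdf l x \<Longrightarrow> S_cdf (l + K) x \<le> 1 / 24 \<Longrightarrow> real l \<le> C * (real K)\<^sup>2"
proof -
  obtain c where c: "0 < c" "\<And>K A. 0 < K \<Longrightarrow> 0 < A \<Longrightarrow> S_cdf K (A / 2) \<le> 23 / 24 \<Longrightarrow>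
        c \<le> (real K)\<^sup>2 * expectation (\<lambda>\<omega>. min 1 ((sym_step \<omega> / A)\<^sup>2))"
    by (rule truncated_variance_ge[OF nondeg]) (rule that)
  have "real l \<le> 225 / 2 / c * (real K)\<^sup>2"
    if K: "0 < K" and S_cdf: "23 / 24 \<le> S_cdf l x" "S_cdf (l + K) x \<le> 1 / 24" for K l x
  proof -
    obtain A where A: "0 < A" "23 / 24 \<le> S_cdf K A" "S_cdf K (A / 2) \<le> 23 / 24"
      using S_cdf_quantile[OF K, of "23 / 24"] by auto
    let ?A1 = "{\<omega> \<in> space M. S l \<omega> \<le> x}" and ?A2 = "{\<omega> \<in> space M. x < S (l + K) \<omega>}"
      and ?A3 = "{\<omega> \<in> space M. S (l + K) \<omega> - S l \<omega> \<le> A}"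
    have "1 - prob (?A1 \<inter> ?A2 \<inter> ?A3) = prob (space M - ?A1 \<inter> ?A2 \<inter> ?A3)"
      by (rule prob_compl[symmetric]) auto
    also have "\<dots> \<le> prob ((space M - ?A1) \<union> ((space M - ?A2) \<union> (space M - ?A3)))"
      by (intro finite_measure_mono) auto
    also have "\<dots> \<le> prob (space M - ?A1) + prob ((space M - ?A2) \<union> (space M - ?A3))" by (intro measure_Un_le) auto
    also have "\<dots> \<le> prob (space M - ?A1) + (prob (space M - ?A2) + prob (space M - ?A3))"
      by (intro add_left_mono measure_Un_le) auto
    also have "\<dots> = (1 - prob ?A1) + ((1 - prob ?A2) + (1 - prob ?A3))"
      by (intro arg_cong2[where f="(+)"] prob_compl) auto
    also have "\<dots> = (1 - S_cdf l x) + (S_cdf (l + K) x + (1 - S_cdf K A))"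
      unfolding prob_gt S_cdf_shift by (simp add: S_cdf_def)
    also have "\<dots> \<le> 1 / 8" using S_cdf A by simp
    finally have "7 / 8 \<le> prob (?A1 \<inter> ?A2 \<inter> ?A3)" by simp
    also have "\<dots> \<le> prob {\<omega> \<in> space M. x - A \<le> S l \<omega> \<and> S l \<omega> \<le> x}"
      by (intro finite_measure_mono) auto
    finally have "real l * expectation (\<lambda>\<omega>. min 1 ((sym_step \<omega> / A)\<^sup>2)) \<le> 225 / 2"
      by (rule concentrated_truncated_variance[OF A(1)])
    then have "(real K)\<^sup>2 * (real l * expectation (\<lambda>\<omega>. min 1 ((sym_step \<omega> / A)\<^sup>2))) \<le> (real K)\<^sup>2 * (225 / 2)"
      by (intro mult_left_mono) auto
    moreover have "real l * c \<le> real l * ((real K)\<^sup>2 * expectation (\<lambda>\<omega>. min 1 ((sym_step \<omega> / A)\<^sup>2)))"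
      using c(2)[OF K A(1,3)] by (intro mult_left_mono) auto
    ultimately have "real l * c \<le> (real K)\<^sup>2 * (225 / 2)" by (simp add: mult.left_commute)
    then show ?thesis using c(1) by (simp add: field_simps)
  qed
  with c(1) show thesis by (intro that[of "225 / 2 / c"]) auto
qed

end

section \<open>Scale and centering of the first passage times\<close>

text \<open>The hypothesis of the theorem in terms of the walk. Its consequences for \<open>f\<close> and \<open>g\<close> are derived below:
  \<open>f\<close> is positive, monotone up to a constant and divergent, and \<open>g\<close> is nearly additive.\<close>

locale passage_limit = perturbed_walk M \<xi> \<eta> + mu: real_distribution \<mu>
  for M :: "'a measure" and \<xi> \<eta> :: "nat \<Rightarrow> 'a \<Rightarrow> real" and \<mu> :: "real measure" +
  fixes f g :: "real \<Rightarrow> real"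
  assumes nondeg_xi: "\<And>c. \<not> (AE \<omega> in M. \<xi> 0 \<omega> = c)"
    and nondeg_mu: "\<And>c. \<mu> \<noteq> return borel c"
    and f_nonneg: "\<And>x. 0 \<le> x \<Longrightarrow> 0 \<le> f x"
    and g_bounded: "\<And>c. bounded (g ` {0..c})"
    and conv: "weak_conv_along (\<lambda>x. distr M borel (\<lambda>\<omega>. (real (\<rho> x \<omega>) - g x) / f x)) \<mu> at_top"
begin

lemma conv_prob:
  "isCont (cdf \<mu>) t \<Longrightarrow>
    ((\<lambda>x. prob {\<omega> \<in> space M. (real (\<rho> x \<omega>) - g x) / f x \<le> t}) \<longlongrightarrow> cdf \<mu> t) at_top"
proof -
  assume t: "isCont (cdf \<mu>) t"
  have eq: "(\<lambda>x. cdf (distr M borel (\<lambda>\<omega>. (real (\<rho> x \<omega>) - g x) / f x)) t)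
      = (\<lambda>x. prob {\<omega> \<in> space M. (real (\<rho> x \<omega>) - g x) / f x \<le> t})"
    by (auto simp: fun_eq_iff cdf_def measure_distr intro!: arg_cong[where f=prob])
  have "((\<lambda>x. cdf (distr M borel (\<lambda>\<omega>. (real (\<rho> x \<omega>) - g x) / f x)) t) \<longlongrightarrow> cdf \<mu> t) at_top"
    using conv t unfolding weak_conv_along_def by blast
  then show ?thesis unfolding eq .
qed

text \<open>Division by \<open>0\<close> gives \<open>0\<close>, so \<open>f x = 0\<close> would force the probability at \<open>t\<close> to be \<open>0\<close> or \<open>1\<close>.\<close>

lemma eventually_f_pos: "\<forall>\<^sub>F x in at_top. 0 < f x"
proof -
  obtain t where t: "isCont (cdf \<mu>) t" "0 < cdf \<mu> t" "cdf \<mu> t < 1"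
    using mu.ex_cdf_strictly_between[OF nondeg_mu] by blast
  let ?p = "\<lambda>x. prob {\<omega> \<in> space M. (real (\<rho> x \<omega>) - g x) / f x \<le> t}"
  have "\<forall>\<^sub>F x in at_top. 0 < ?p x" "\<forall>\<^sub>F x in at_top. ?p x < 1"
    using order_tendstoD[OF conv_prob[OF t(1)]] t by auto
  then show ?thesis using eventually_ge_at_top[of 0]
  proof eventually_elim
    case (elim x)
    have "f x \<noteq> 0"
    proof
      assume "f x = 0"
      then have "?p x = (if 0 \<le> t then 1 else 0)" by (simp add: prob_space)
      with elim show False by (simp split: if_splits)
    qed
    then show ?case using f_nonneg[of x] elim by simp
  qed
qed

lemma rho_cdf_tendsto:
  assumes "isCont (cdf \<mu>) t"
  shows "((\<lambda>x. rho_cdf x (g x + t * f x)) \<longlongrightarrow> cdf \<mu> t) at_top"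
proof (rule Lim_transform_eventually[OF conv_prob[OF assms]])
  show "\<forall>\<^sub>F x in at_top. prob {\<omega> \<in> space M. (real (\<rho> x \<omega>) - g x) / f x \<le> t} = rho_cdf x (g x + t * f x)"
    using eventually_f_pos
  proof eventually_elim
    case (elim x)
    then have "(real (\<rho> x \<omega>) - g x) / f x \<le> t \<longleftrightarrow> real (\<rho> x \<omega>) \<le> g x + t * f x" for \<omega>
      by (auto simp: divide_le_eq algebra_simps)
    then show ?case by (simp add: rho_cdf_def)
  qed
qed

lemma rho_cdf_tight:
  assumes "0 < e"
  obtains T where "1 \<le> T" "\<forall>\<^sub>F x in at_top. rho_cdf x (g x - T * f x) \<le> e \<and> 1 - rho_cdf x (g x + T * f x) \<le> e"
proof -
  have "\<forall>\<^sub>F t in at_bot. cdf \<mu> t < e" using mu.cdf_lim_at_bot assms by (intro order_tendstoD) auto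
  then obtain a where a: "\<And>t. t \<le> a \<Longrightarrow> cdf \<mu> t < e" by (auto simp: eventually_at_bot_linorder)
  have "\<forall>\<^sub>F t in at_top. 1 - e < cdf \<mu> t" using mu.cdf_lim_at_top_prob assms by (intro order_tendstoD) auto
  then obtain b where b: "\<And>t. b \<le> t \<Longrightarrow> 1 - e < cdf \<mu> t" by (auto simp: eventually_at_top_linorder)
  obtain t1 where t1: "t1 < a" "isCont (cdf \<mu>) t1" using mu.ex_isCont_cdf[of "a - 1" a] by auto
  obtain t2 where t2: "b < t2" "isCont (cdf \<mu>) t2" using mu.ex_isCont_cdf[of b "b + 1"] by auto
  define T where "T = max 1 (max (- t1) t2)"
  have "\<forall>\<^sub>F x in at_top. rho_cdf x (g x + t1 * f x) < e" "\<forall>\<^sub>F x in at_top. 1 - e < rho_cdf x (g x + t2 * f x)"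
    using order_tendstoD[OF rho_cdf_tendsto] t1 t2 a[of t1] b[of t2] by auto
  then have "\<forall>\<^sub>F x in at_top. rho_cdf x (g x - T * f x) \<le> e \<and> 1 - rho_cdf x (g x + T * f x) \<le> e"
    using eventually_f_pos
  proof eventually_elim
    case (elim x)
    have "- T \<le> t1" "t2 \<le> T" by (auto simp: T_def)
    then have "- T * f x \<le> t1 * f x" "t2 * f x \<le> T * f x"
      using elim(3) by (intro mult_right_mono; simp)+
    then have "rho_cdf x (g x - T * f x) \<le> rho_cdf x (g x + t1 * f x)" "rho_cdf x (g x + t2 * f x) \<le> rho_cdf x (g x + T * f x)"
      by (auto intro!: rho_cdf_mono)
    then show ?case using elim by linarith
  qed
  then show thesis by (intro that[of T]) (auto simp: T_def)
qed

lemma rho_cdf_less_imp: "rho_cdf x r < rho_cdf x s \<Longrightarrow> r < s"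
  using rho_cdf_mono[of s r x x] by (meson leI not_le order_refl)

text \<open>For large \<open>z \<le> x\<close> there are \<open>a < b\<close> at distance \<open>(t2 - t1) f z\<close> such that \<open>\<rho> z \<le> a\<close> and \<open>\<rho> z > b\<close>
  both have probabilities bounded away from \<open>0\<close>. Extending the walk by an independent stretch across
  \<open>x - z\<close>, whose duration is compared with its median \<open>m\<close>, shows the same for \<open>\<rho> x\<close> with \<open>a + m\<close> and
  \<open>b + m - 2\<close>. Hence the window of radius \<open>T f x\<close> about \<open>g x\<close> cannot be much shorter than \<open>b - a\<close>.\<close>

lemma scale_quasi_mono_aux:
  obtains C x0 where "0 < C" "\<And>z x. x0 \<le> z \<Longrightarrow> z \<le> x \<Longrightarrow> f z \<le> C * (f x + 1)"
proof -
  obtain t1 where t1: "isCont (cdf \<mu>) t1" "0 < cdf \<mu> t1" "cdf \<mu> t1 < 1"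
    using mu.ex_cdf_strictly_between[OF nondeg_mu] by blast
  obtain d where d: "0 < d" "\<forall>s<t1 + d. cdf \<mu> s < 1" using mu.cdf_right_less[OF t1(3)] by blast
  obtain t2 where t2: "t1 < t2" "t2 < t1 + d" "isCont (cdf \<mu>) t2" using mu.ex_isCont_cdf[of t1 "t1 + d"] d by auto
  define e where "e = min (cdf \<mu> t1) (1 - cdf \<mu> t2) / 2"
  have e: "0 < e" "e < cdf \<mu> t1" "cdf \<mu> t2 < 1 - e" using t1 t2 d by (auto simp: e_def min_def field_simps)
  obtain T where T: "1 \<le> T" "\<forall>\<^sub>F x in at_top. rho_cdf x (g x - T * f x) \<le> e / 4 \<and> 1 - rho_cdf x (g x + T * f x) \<le> e / 4"
    using rho_cdf_tight[of "e / 4"] e by auto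
  have "\<forall>\<^sub>F x in at_top. e < rho_cdf x (g x + t1 * f x)" "\<forall>\<^sub>F x in at_top. rho_cdf x (g x + t2 * f x) < 1 - e"
    using order_tendstoD[OF rho_cdf_tendsto] t1 t2 e by auto
  with T(2) have "\<forall>\<^sub>F x in at_top. (rho_cdf x (g x - T * f x) \<le> e / 4 \<and> 1 - rho_cdf x (g x + T * f x) \<le> e / 4) \<and>
       e < rho_cdf x (g x + t1 * f x) \<and> rho_cdf x (g x + t2 * f x) < 1 - e \<and> 0 < f x \<and> 0 \<le> x"
    using eventually_f_pos eventually_ge_at_top[of 0] by eventually_elim auto
  then obtain x0 where x0: "\<And>x. x0 \<le> x \<Longrightarrow> (rho_cdf x (g x - T * f x) \<le> e / 4 \<and> 1 - rho_cdf x (g x + T * f x) \<le> e / 4) \<and>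
       e < rho_cdf x (g x + t1 * f x) \<and> rho_cdf x (g x + t2 * f x) < 1 - e \<and> 0 < f x \<and> 0 \<le> x"
    unfolding eventually_at_top_linorder by blast
  have main: "(t2 - t1) * f z \<le> 2 * T * f x + 2" if z: "x0 \<le> z" "z \<le> x" for z x
  proof -
    let ?a = "g z + t1 * f z" and ?b = "g z + t2 * f z" and ?m = "real (med (x - z))"
    have xz: "z + (x - z) = x" "0 \<le> x - z" "0 \<le> z" "x0 \<le> x" using z x0[of z] by auto
    have "e / 4 < e * (1 / 2)" using e by simp
    also have "\<dots> \<le> rho_cdf z ?a * rho_cdf (x - z) ?m"
      using x0[OF z(1)] rho_cdf_med[of "x - z"] e by (intro mult_mono) auto
    also have "\<dots> \<le> rho_cdf x (?a + ?m)" using rho_cdf_add_ge[of z ?a "x - z" ?m] xz by simp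
    finally have "rho_cdf x (g x - T * f x) < rho_cdf x (?a + ?m)" using x0[OF xz(4)] by simp
    then have 1: "g x - T * f x < ?a + ?m" by (rule rho_cdf_less_imp)
    have "e / 4 < e * (1 / 2)" using e by simp
    also have "\<dots> \<le> (1 - rho_cdf z ?b) * (1 - rho_cdf (x - z) (?m - 1))"
      using x0[OF z(1)] rho_cdf_med_minus[OF xz(2)] e by (intro mult_mono) auto
    also have "\<dots> \<le> 1 - rho_cdf x (?b + (?m - 1) - 1)" using rho_cdf_add_le[of z "x - z" ?b "?m - 1"] xz by simp
    finally have "rho_cdf x (?b + (?m - 1) - 1) < rho_cdf x (g x + T * f x)" using x0[OF xz(4)] by simp
    then have "?b + (?m - 1) - 1 < g x + T * f x" by (rule rho_cdf_less_imp)
    with 1 show ?thesis by (simp add: algebra_simps)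
  qed
  define C where "C = 2 * (T + 1) / (t2 - t1)"
  show thesis
  proof (rule that[of C x0])
    show "0 < C" using T(1) t2 by (simp add: C_def)
    fix z x assume z: "x0 \<le> z" "z \<le> x"
    have "0 < f x" using x0[of x] z by auto
    then have "T * f x + 1 \<le> (T + 1) * (f x + 1)" using T(1) by (simp add: algebra_simps)
    then have "(t2 - t1) * f z \<le> 2 * ((T + 1) * (f x + 1))" using main[OF z] by linarith
    then show "f z \<le> C * (f x + 1)" using t2 by (simp add: C_def field_simps)
  qed
qed

text \<open>Up to the scale, the centering is additive and its increments are medians. Both inequalities follow
  by composing a stretch across \<open>z\<close> with one across \<open>x - z\<close>.\<close>

lemma med_approx:
  obtains T x0 where "1 \<le> T" "0 \<le> x0"
    "\<And>z x. x0 \<le> z \<Longrightarrow> z \<le> x \<Longrightarrow> \<bar>real (med (x - z)) - (g x - g z)\<bar> \<le> T * (f x + f z) + 2"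
    "\<And>x. x0 \<le> x \<Longrightarrow> \<bar>real (med x) - g x\<bar> \<le> T * f x + 1"
    "\<And>x. x0 \<le> x \<Longrightarrow> rho_cdf x (g x - T * f x) \<le> 1 / 24 \<and> 1 - rho_cdf x (g x + T * f x) \<le> 1 / 24"
    "\<And>x. x0 \<le> x \<Longrightarrow> 0 < f x"
proof -
  obtain T where T: "1 \<le> T" "\<forall>\<^sub>F x in at_top. rho_cdf x (g x - T * f x) \<le> 1 / 24 \<and> 1 - rho_cdf x (g x + T * f x) \<le> 1 / 24"
    using rho_cdf_tight[of "1 / 24"] by auto
  have "\<forall>\<^sub>F x in at_top. (rho_cdf x (g x - T * f x) \<le> 1 / 24 \<and> 1 - rho_cdf x (g x + T * f x) \<le> 1 / 24) \<and> 0 < f x \<and> 0 \<le> x"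
    using eventually_conj[OF T(2) eventually_conj[OF eventually_f_pos eventually_ge_at_top[of 0]]] .
  then obtain x1 where "\<And>x. x1 \<le> x \<Longrightarrow> (rho_cdf x (g x - T * f x) \<le> 1 / 24 \<and> 1 - rho_cdf x (g x + T * f x) \<le> 1 / 24) \<and> 0 < f x \<and> 0 \<le> x"
    unfolding eventually_at_top_linorder by blast
  then obtain x0 where x00: "0 \<le> x0" and x0: "\<And>x. x0 \<le> x \<Longrightarrow> rho_cdf x (g x - T * f x) \<le> 1 / 24"
      "\<And>x. x0 \<le> x \<Longrightarrow> 1 - rho_cdf x (g x + T * f x) \<le> 1 / 24" "\<And>x. x0 \<le> x \<Longrightarrow> 0 < f x"
    by (metis max.bounded_iff max.cobounded1)
  show thesis
  proof (rule that[OF T(1) x00])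
    fix z x assume z: "x0 \<le> z" "z \<le> x"
    let ?m = "real (med (x - z))" and ?a = "g z + T * f z" and ?b = "g z - T * f z"
    have xz: "z + (x - z) = x" "0 \<le> x - z" "0 \<le> z" "x0 \<le> x" using z x00 by auto
    have "1 / 24 < 23 / 24 * (1 / 2 :: real)" by simp
    also have "\<dots> \<le> rho_cdf z ?a * rho_cdf (x - z) ?m"
      using x0(2)[OF z(1)] rho_cdf_med[of "x - z"] by (intro mult_mono) auto
    also have "\<dots> \<le> rho_cdf x (?a + ?m)" using rho_cdf_add_ge[of z ?a "x - z" ?m] xz by simp
    finally have "rho_cdf x (g x - T * f x) < rho_cdf x (?a + ?m)" using x0(1)[OF xz(4)] by simp
    then have 1: "g x - T * f x < ?a + ?m" by (rule rho_cdf_less_imp)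
    have "1 / 24 < 23 / 24 * (1 / 2 :: real)" by simp
    also have "\<dots> \<le> (1 - rho_cdf z ?b) * (1 - rho_cdf (x - z) (?m - 1))"
      using x0(1)[OF z(1)] rho_cdf_med_minus[OF xz(2)] by (intro mult_mono) auto
    also have "\<dots> \<le> 1 - rho_cdf x (?b + (?m - 1) - 1)" using rho_cdf_add_le[of z "x - z" ?b "?m - 1"] xz by simp
    finally have "rho_cdf x (?b + (?m - 1) - 1) < rho_cdf x (g x + T * f x)" using x0(2)[OF xz(4)] by simp
    then have "?b + (?m - 1) - 1 < g x + T * f x" by (rule rho_cdf_less_imp)
    with 1 show "\<bar>?m - (g x - g z)\<bar> \<le> T * (f x + f z) + 2" by (simp add: algebra_simps abs_le_iff)
  next
    fix x assume x: "x0 \<le> x"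
    have "rho_cdf x (g x - T * f x) < rho_cdf x (real (med x))" using x0(1)[OF x] rho_cdf_med[of x] by simp
    then have 1: "g x - T * f x < real (med x)" by (rule rho_cdf_less_imp)
    have "rho_cdf x (real (med x) - 1) < rho_cdf x (g x + T * f x)" using x0(2)[OF x] rho_cdf_med_minus[of x] x x00 by simp
    then have "real (med x) - 1 < g x + T * f x" by (rule rho_cdf_less_imp)
    with 1 show "\<bar>real (med x) - g x\<bar> \<le> T * f x + 1" by (simp add: abs_le_iff)
  qed (use x0 in auto)
qed

text \<open>The scale is at least of the order of the square root of the median, as for a renewal process with finite
  variance; this holds for heavy-tailed steps too.\<close>

lemma med_le_square:
  obtains C where "0 < C" "\<forall>\<^sub>F x in at_top. real (med x) \<le> C * (f x + 1)\<^sup>2"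
proof -
  obtain T x0 where T: "1 \<le> T" "0 \<le> x0" and
    m: "\<And>x. x0 \<le> x \<Longrightarrow> \<bar>real (med x) - g x\<bar> \<le> T * f x + 1" and
    rho_cdf: "\<And>x. x0 \<le> x \<Longrightarrow> rho_cdf x (g x - T * f x) \<le> 1 / 24 \<and> 1 - rho_cdf x (g x + T * f x) \<le> 1 / 24" and
    f: "\<And>x. x0 \<le> x \<Longrightarrow> 0 < f x"
    by (rule med_approx) (rule that)
  obtain C where C: "0 < C" and
    conc: "\<And>K l x. 0 < K \<Longrightarrow> 23 / 24 \<le> S_cdf l x \<Longrightarrow> S_cdf (l + K) x \<le> 1 / 24 \<Longrightarrow> real l \<le> C * (real K)\<^sup>2"
    by (rule concentration_bound[OF nondeg_xi]) (rule that)
  have "real (med x) \<le> (9 * C * T\<^sup>2 + 3 * T) * (f x + 1)\<^sup>2" if x: "x0 \<le> x" for x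
  proof -
    \<comment> \<open>the window \<open>g x \<plusminus> T f x\<close> of \<open>\<rho> x\<close>, rounded to integers; its lower end may be negative\<close>
    define l where "l = nat \<lfloor>g x - T * f x\<rfloor>"
    define K where "K = nat \<lceil>2 * T * f x\<rceil> + 2"
    have Tf: "0 \<le> T * f x" using T f[OF x] by simp
    have up0: "0 \<le> g x + T * f x" using rho_cdf[OF x] by (auto simp: rho_cdf_eq split: if_splits)
    have "23 / 24 \<le> S_cdf l x"
    proof (cases "g x - T * f x < 0")
      case True
      then have "l = 0" by (simp add: l_def)
      then show ?thesis using S_cdf_0[of x] x T by simp
    next
      case False
      then show ?thesis using rho_cdf[OF x] by (simp add: rho_cdf_eq l_def)
    qed
    moreover have "S_cdf (l + K) x \<le> 1 / 24"
    proof -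
      have "nat \<lfloor>g x + T * f x\<rfloor> \<le> l + K" unfolding l_def K_def using Tf by linarith
      then have "S_cdf (l + K) x \<le> S_cdf (nat \<lfloor>g x + T * f x\<rfloor>) x" by (intro S_cdf_mono) auto
      also have "\<dots> \<le> 1 / 24" using rho_cdf[OF x] up0 by (simp add: rho_cdf_eq)
      finally show ?thesis .
    qed
    ultimately have l: "real l \<le> C * (real K)\<^sup>2" by (intro conc) (auto simp: K_def)
    have "real K \<le> 2 * T * f x + 3" unfolding K_def using Tf by linarith
    also have "\<dots> \<le> 3 * T * (f x + 1)" using T Tf unfolding distrib_left mult.assoc by linarith
    finally have "(real K)\<^sup>2 \<le> (3 * T * (f x + 1))\<^sup>2" by (intro power_mono) auto
    then have "C * (real K)\<^sup>2 \<le> 9 * C * T\<^sup>2 * (f x + 1)\<^sup>2" using C by (simp add: power_mult_distrib mult.assoc)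
    moreover have "real (med x) \<le> real l + 3 * T * (f x + 1)"
    proof -
      have "real (med x) \<le> g x + T * f x + 1" using m[OF x] by (simp add: abs_le_iff)
      also have "\<dots> \<le> real l + 2 * T * f x + 2" unfolding l_def by linarith
      also have "\<dots> \<le> real l + 3 * T * (f x + 1)" using T Tf unfolding distrib_left mult.assoc by linarith
      finally show ?thesis .
    qed
    moreover have "3 * T * (f x + 1) \<le> 3 * T * (f x + 1)\<^sup>2"
      using T f[OF x] by (intro mult_left_mono) (auto simp: power2_eq_square)
    ultimately show ?thesis using l by (simp add: distrib_right)
  qed
  then have "\<forall>\<^sub>F x in at_top. real (med x) \<le> (9 * C * T\<^sup>2 + 3 * T) * (f x + 1)\<^sup>2"
    unfolding eventually_at_top_linorder by blast
  then show thesis using C T by (intro that[of "9 * C * T\<^sup>2 + 3 * T"]) (auto intro!: add_pos_pos mult_pos_pos)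
qed

lemma filterlim_f: "filterlim f at_top at_top"
  unfolding filterlim_at_top
proof
  fix Z
  obtain C where C: "0 < C" "\<forall>\<^sub>F x in at_top. real (med x) \<le> C * (f x + 1)\<^sup>2" by (rule med_le_square)
  obtain N :: nat where N: "C * (\<bar>Z\<bar> + 1)\<^sup>2 < real N" using reals_Archimedean2 by blast
  have "\<forall>\<^sub>F x in at_top. N \<le> med x" using filterlim_med by (simp add: filterlim_at_top)
  with C(2) eventually_f_pos show "\<forall>\<^sub>F x in at_top. Z \<le> f x"
  proof eventually_elim
    case (elim x)
    show ?case
    proof (rule ccontr)
      assume "\<not> Z \<le> f x"
      then have "C * (f x + 1)\<^sup>2 \<le> C * (\<bar>Z\<bar> + 1)\<^sup>2"
        using elim C by (intro mult_left_mono power_mono) auto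
      with N elim show False by linarith
    qed
  qed
qed

lemma scale_quasi_mono:
  obtains C x0 where "1 \<le> C" "0 \<le> x0" "\<And>z x. x0 \<le> z \<Longrightarrow> z \<le> x \<Longrightarrow> f z \<le> C * f x" "\<And>x. x0 \<le> x \<Longrightarrow> 1 \<le> f x"
proof -
  obtain C x0 where C: "0 < C" "\<And>z x. x0 \<le> z \<Longrightarrow> z \<le> x \<Longrightarrow> f z \<le> C * (f x + 1)"
    by (rule scale_quasi_mono_aux) (rule that)
  have "\<forall>\<^sub>F x in at_top. 1 \<le> f x" using filterlim_f by (simp add: filterlim_at_top)
  then obtain x1 where x1: "\<And>x. x1 \<le> x \<Longrightarrow> 1 \<le> f x" by (auto simp: eventually_at_top_linorder)
  show thesis
  proof (rule that[of "2 * C + 1" "max 0 (max x0 x1)"])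
    fix z x assume z: "max 0 (max x0 x1) \<le> z" "z \<le> x"
    have "1 \<le> f x" using x1 z by auto
    then have "C * (f x + 1) \<le> C * (2 * f x)" using C by (intro mult_left_mono) auto
    then show "f z \<le> (2 * C + 1) * f x" using C(2)[of z x] z \<open>1 \<le> f x\<close> by (simp add: algebra_simps)
  qed (use C x1 in auto)
qed

lemma centering_increment:
  obtains C x0 where "1 \<le> C" "0 \<le> x0"
    "\<And>z x. x0 \<le> z \<Longrightarrow> z \<le> x \<Longrightarrow> \<bar>real (med (x - z)) - (g x - g z)\<bar> \<le> C * f x"
    "\<And>z x. x0 \<le> z \<Longrightarrow> z \<le> x \<Longrightarrow> f z \<le> C * f x" "\<And>x. x0 \<le> x \<Longrightarrow> 1 \<le> f x"
proof -
  obtain T x0 where T: "1 \<le> T" "0 \<le> x0" and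
    m: "\<And>z x. x0 \<le> z \<Longrightarrow> z \<le> x \<Longrightarrow> \<bar>real (med (x - z)) - (g x - g z)\<bar> \<le> T * (f x + f z) + 2"
    by (rule med_approx) (rule that)
  obtain C x1 where C: "1 \<le> C" "0 \<le> x1" "\<And>z x. x1 \<le> z \<Longrightarrow> z \<le> x \<Longrightarrow> f z \<le> C * f x" "\<And>x. x1 \<le> x \<Longrightarrow> 1 \<le> f x"
    by (rule scale_quasi_mono) (rule that)
  show thesis
  proof (rule that[of "T * (1 + C) + 2" "max x0 x1"])
    have TC: "0 \<le> T * (1 + C)" "1 + C \<le> T * (1 + C)" using T C mult_right_mono[of 1 T "1 + C"] by auto
    show "1 \<le> T * (1 + C) + 2" using TC by simp
    fix z x assume z: "max x0 x1 \<le> z" "z \<le> x"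
    have f: "1 \<le> f x" "f z \<le> C * f x" using C z by auto
    have "T * (f x + f z) \<le> T * (f x + C * f x)" using T f by (intro mult_left_mono) auto
    then have "T * (f x + f z) + 2 \<le> (T * (1 + C) + 2) * f x" using f by (simp add: algebra_simps)
    then show "\<bar>real (med (x - z)) - (g x - g z)\<bar> \<le> (T * (1 + C) + 2) * f x" using m[of z x] z by simp
    have "C * f x \<le> (T * (1 + C) + 2) * f x" using TC f by (intro mult_right_mono) auto
    then show "f z \<le> (T * (1 + C) + 2) * f x" using f by linarith
  qed (use T C in auto)
qed

section \<open>Uniform tightness and local variation of the centering\<close>

text \<open>The maximal inequalities, applied at the integers below \<open>x\<close> and at \<open>x\<close>. Their conditions hold because
  \<open>med (x - j)\<close> and \<open>g x - g j\<close> differ by \<open>O(f x)\<close>. Between the grid points \<open>\<rho>\<close> is monotone and \<open>g\<close> changes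
  by \<open>O(f x)\<close>.\<close>

lemma uniform_tightness:
  assumes e: "0 < e"
  obtains L where "1 \<le> L"
    "\<forall>\<^sub>F x in at_top. \<exists>G\<in>events. 1 - e \<le> prob G \<and> (\<forall>\<omega>\<in>G. \<forall>z\<in>{0..x}. \<bar>real (\<rho> z \<omega>) - g z\<bar> \<le> L * f x)"
proof -
  obtain C x0 where C: "1 \<le> C" "0 \<le> x0" and
    m: "\<And>z x. x0 \<le> z \<Longrightarrow> z \<le> x \<Longrightarrow> \<bar>real (med (x - z)) - (g x - g z)\<bar> \<le> C * f x" and
    f: "\<And>z x. x0 \<le> z \<Longrightarrow> z \<le> x \<Longrightarrow> f z \<le> C * f x" "\<And>x. x0 \<le> x \<Longrightarrow> 1 \<le> f x"
    by (rule centering_increment) (rule that)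
  obtain T where T: "1 \<le> T" "\<forall>\<^sub>F x in at_top. rho_cdf x (g x - T * f x) \<le> e / 6 \<and> 1 - rho_cdf x (g x + T * f x) \<le> e / 6"
    using rho_cdf_tight[of "e / 6"] e by auto
  define L1 where "L1 = C + T + 1"
  define L where "L = L1 + C * C + 1"
  \<comment> \<open>times below \<open>x0 + 1\<close> contribute a tight amount, which the divergent scale absorbs\<close>
  obtain N where N: "S_cdf N (x0 + 1) \<le> e / 3"
  proof -
    have "\<forall>\<^sub>F k in sequentially. S_cdf k (x0 + 1) < e / 3"
      using S_cdf_tendsto_0 e by (intro order_tendstoD) auto
    then show thesis using that by (auto simp: eventually_sequentially intro: less_imp_le)
  qed
  obtain B where B: "\<forall>z\<in>{0..x0 + 1}. \<bar>g z\<bar> \<le> B"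
    using g_bounded[of "x0 + 1"] by (auto simp: bounded_iff)
  have fB: "\<forall>\<^sub>F x in at_top. max (real (med 1)) (real N + B) \<le> f x"
    using filterlim_f unfolding filterlim_at_top by blast
  have "\<forall>\<^sub>F x in at_top. \<exists>G\<in>events. 1 - e \<le> prob G \<and> (\<forall>\<omega>\<in>G. \<forall>z\<in>{0..x}. \<bar>real (\<rho> z \<omega>) - g z\<bar> \<le> L * f x)"
    using T(2) fB eventually_ge_at_top[of "x0 + 1"]
  proof eventually_elim
    case (elim x)
    have fx: "1 \<le> f x" using f(2)[of x] elim by simp
    define J where "J = {j. (\<exists>n::nat. j = real n) \<and> x0 \<le> j \<and> j \<le> x} \<union> {x}"
    have "finite {j. (\<exists>n::nat. j = real n) \<and> x0 \<le> j \<and> j \<le> x}"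
      by (rule finite_subset[of _ "real ` {..nat \<lceil>x\<rceil>}"]) (auto simp: image_iff, linarith)
    then have finJ: "finite J" by (simp add: J_def)
    have J: "x0 \<le> j" "j \<le> x" "0 \<le> j" if "j \<in> J" for j using that elim C by (auto simp: J_def)
    let ?A = "{\<omega> \<in> space M. \<exists>j\<in>J. real (\<rho> j \<omega>) \<le> g j - L1 * f x}"
    let ?B = "{\<omega> \<in> space M. \<exists>j\<in>J. g j + L1 * f x < real (\<rho> j \<omega>)}"
    let ?D = "{\<omega> \<in> space M. real N < real (\<rho> (x0 + 1) \<omega>)}"
    let ?U = "{\<omega> \<in> space M. \<forall>n::nat. \<exists>k. real n < S k \<omega>}"
    have ev [measurable]: "?A \<in> events" "?B \<in> events" "?D \<in> events" "?U \<in> events" using finJ by auto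
    have A: "prob ?A \<le> 2 * rho_cdf x (g x - T * f x)"
    proof (rule prob_exists_rho_le[OF finJ])
      fix j assume "j \<in> J"
      then have "real (med (x - j)) \<le> g x - g j + C * f x" using m[of j x] J[of j] by (simp add: abs_le_iff)
      then show "real (med (x - j)) + (g j - L1 * f x) \<le> g x - T * f x"
        using fx by (simp add: L1_def algebra_simps)
    qed
    have B1: "prob ?B \<le> 2 * (1 - rho_cdf x (g x + T * f x))"
    proof (rule prob_exists_rho_gt[OF finJ])
      fix j assume j: "j \<in> J"
      then have "g x - g j - C * f x \<le> real (med (x - j))" using m[of j x] J[of j] by (simp add: abs_le_iff)
      then have "g x + T * f x + 1 \<le> real (med (x - j)) + (g j + L1 * f x)"
        using fx by (simp add: L1_def algebra_simps)
      then show "0 \<le> j \<and> j \<le> x \<and> g x + T * f x + 1 \<le> real (med (x - j)) + (g j + L1 * f x)"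
        using J[OF j] by simp
    qed
    have D: "prob ?D \<le> e / 3" using N unfolding prob_rho_gt by (simp add: rho_cdf_eq)
    have U: "prob (space M - ?U) = 0"
    proof -
      have "prob ?U = 1"
        using AE_unbounded by (subst prob_Collect_eq_1) (auto elim: eventually_mono)
      then show ?thesis using prob_compl[OF ev(4)] by simp
    qed
    \<comment> \<open>outside of three events that each have probability at most \<open>e / 3\<close>, and of a null set\<close>
    define G where "G = space M - (?A \<union> (?B \<union> (?D \<union> (space M - ?U))))"
    have union: "prob (a \<union> (b \<union> (c \<union> d))) \<le> prob a + (prob b + (prob c + prob d))"
      if "a \<in> events" "b \<in> events" "c \<in> events" "d \<in> events" for a b c d
      using measure_Un_le[of a M "b \<union> (c \<union> d)"] measure_Un_le[of b M "c \<union> d"] measure_Un_le[of c M d]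
        sets.Un[OF that(2) sets.Un[OF that(3,4)]] sets.Un[OF that(3,4)] that by linarith
    have compl: "space M - ?U \<in> events" using ev(4) by (rule sets.compl_sets)
    have bad: "?A \<union> (?B \<union> (?D \<union> (space M - ?U))) \<in> events"
      by (intro sets.Un ev(1-3) compl)
    have "prob (?A \<union> (?B \<union> (?D \<union> (space M - ?U)))) \<le> prob ?A + (prob ?B + (prob ?D + prob (space M - ?U)))"
      by (rule union[OF ev(1-3) compl])
    also have "\<dots> \<le> e"
    proof -
      have "a + (b + (c + d)) \<le> e" if "a \<le> e / 3" "b \<le> e / 3" "c \<le> e / 3" "d = 0" for a b c d
        using that by linarith
      moreover have "prob ?A \<le> e / 3" by (rule order_trans[OF A]) (use elim(1) in linarith)
      moreover have "prob ?B \<le> e / 3" 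
        by (rule order_trans[OF B1], rule order_trans[OF mult_left_mono[OF elim(1)[THEN conjunct2]]]) simp_all
      ultimately show ?thesis using D U by blast
    qed
    finally have "1 - e \<le> prob G" unfolding G_def prob_compl[OF bad] by linarith
    moreover have "G \<in> events" unfolding G_def using bad by (rule sets.compl_sets)
    moreover have "\<bar>real (\<rho> z \<omega>) - g z\<bar> \<le> L * f x" if w: "\<omega> \<in> G" and z: "0 \<le> z" "z \<le> x" for \<omega> z
    proof -
      have sp: "\<omega> \<in> space M" using w by (simp add: G_def)
      have unb: "\<exists>k. y < S k \<omega>" for y
      proof -
        obtain n :: nat where "y < real n" using reals_Archimedean2 by blast
        moreover have "\<exists>k. real n < S k \<omega>" using w by (auto simp: G_def)
        ultimately show ?thesis by (meson less_trans)
      qed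
      have onJ: "g j - L1 * f x < real (\<rho> j \<omega>)" "real (\<rho> j \<omega>) \<le> g j + L1 * f x" if "j \<in> J" for j
        using w that by (auto simp: G_def)
      have L: "1 \<le> L" using C T by (auto simp: L_def L1_def)
      show ?thesis
      proof (cases "z < x0 + 1")
        case True
        have "\<rho> z \<omega> \<le> \<rho> (x0 + 1) \<omega>" using True by (intro rho_mono sp unb) auto
        moreover have "\<rho> (x0 + 1) \<omega> \<le> N" using w by (auto simp: G_def)
        moreover have "\<bar>g z\<bar> \<le> B" using B True z by simp
        ultimately have "\<bar>real (\<rho> z \<omega>) - g z\<bar> \<le> real N + B" by (simp add: abs_le_iff)
        also have "\<dots> \<le> f x" using elim by simp
        also have "\<dots> \<le> L * f x" using L fx by simp
        finally show ?thesis .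
      next
        case False
        define a where "a = real (nat \<lfloor>z\<rfloor>)"
        define b where "b = min x (real (nat \<lceil>z\<rceil>))"
        have z1: "x0 + 1 \<le> z" using False by simp
        have ab: "x0 \<le> a" "a \<le> z" "z \<le> b" "b \<le> x" "z - a \<le> 1" "b - z \<le> 1"
          using z1 z C unfolding a_def b_def by (linarith | (simp add: min_def, linarith))+
        have "\<exists>n::nat. a = real n" "b = x \<or> (\<exists>n::nat. b = real n)"
          unfolding a_def b_def min_def by (blast, metis)
        moreover have "a \<le> x" "x0 \<le> b" using ab z z1 by linarith+
        ultimately have inJ: "a \<in> J" "b \<in> J" using ab by (auto simp: J_def)
        have ga: "\<bar>g z - g a\<bar> \<le> real (med 1) + C * f z"
        proof -
          have "\<bar>real (med (z - a)) - (g z - g a)\<bar> \<le> C * f z" using ab by (intro m) auto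
          moreover have "real (med (z - a)) \<le> real (med 1)" using ab by (simp add: med_mono)
          ultimately show ?thesis by (simp add: abs_le_iff)
        qed
        have gb: "\<bar>g b - g z\<bar> \<le> real (med 1) + C * f b"
        proof -
          have "\<bar>real (med (b - z)) - (g b - g z)\<bar> \<le> C * f b" using ab z1 by (intro m) auto
          moreover have "real (med (b - z)) \<le> real (med 1)" using ab by (simp add: med_mono)
          ultimately show ?thesis by (simp add: abs_le_iff)
        qed
        have "C * f z \<le> C * (C * f x)" "C * f b \<le> C * (C * f x)"
          using f(1)[of z x] f(1)[of b x] ab z z1 C by (auto intro!: mult_left_mono)
        moreover have "real (med 1) \<le> f x" using elim by simp
        ultimately have g: "\<bar>g z - g a\<bar> \<le> (C * C + 1) * f x" "\<bar>g b - g z\<bar> \<le> (C * C + 1) * f x"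
          using ga gb by (auto simp: algebra_simps)
        have "real (\<rho> a \<omega>) \<le> real (\<rho> z \<omega>)" "real (\<rho> z \<omega>) \<le> real (\<rho> b \<omega>)"
          using ab by (simp_all add: rho_mono sp unb)
        then have "\<bar>real (\<rho> z \<omega>) - g z\<bar> \<le> L1 * f x + (C * C + 1) * f x"
          using onJ(1)[OF inJ(1)] onJ(2)[OF inJ(2)] g by linarith
        then show ?thesis by (simp add: L_def algebra_simps)
      qed
    qed
    ultimately show ?case by (intro bexI[of _ G]) auto
  qed
  then show thesis using C T by (intro that[of L]) (auto simp: L_def L1_def)
qed

text \<open>Since \<open>\<rho> x - \<rho> (x - y)\<close> is nonnegative and tight, quantiles of \<open>\<rho> x\<close> and of \<open>\<rho> (x - y)\<close> at slightly different
  levels are ordered up to a constant.\<close>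

lemma centering_local_aux:
  assumes t: "isCont (cdf \<mu>) t" "isCont (cdf \<mu>) s" "cdf \<mu> s < cdf \<mu> t" and A: "0 \<le> A"
  shows "\<exists>j::nat. \<forall>\<^sub>F x in at_top. \<forall>y\<in>{0..A}.
     g x + s * f x \<le> g (x - y) + t * f (x - y) + j \<and> g (x - y) + s * f (x - y) \<le> g x + t * f x"
proof -
  define e where "e = (cdf \<mu> t - cdf \<mu> s) / 4"
  have e: "0 < e" using t by (simp add: e_def)
  have "\<forall>\<^sub>F k in sequentially. S_cdf k A < e" using S_cdf_tendsto_0 e by (intro order_tendstoD) auto
  then obtain j where j: "S_cdf j A < e" by (auto simp: eventually_sequentially)
  have "\<forall>\<^sub>F x in at_top. cdf \<mu> t - e < rho_cdf x (g x + t * f x)" "\<forall>\<^sub>F x in at_top. rho_cdf x (g x + s * f x) < cdf \<mu> s + e"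
    using order_tendstoD[OF rho_cdf_tendsto] t e by auto
  then have "\<forall>\<^sub>F x in at_top. cdf \<mu> t - e < rho_cdf x (g x + t * f x) \<and> rho_cdf x (g x + s * f x) < cdf \<mu> s + e"
    by eventually_elim auto
  then obtain x0 where x0: "\<And>x. x0 \<le> x \<Longrightarrow> cdf \<mu> t - e < rho_cdf x (g x + t * f x) \<and> rho_cdf x (g x + s * f x) < cdf \<mu> s + e"
    unfolding eventually_at_top_linorder by blast
  have "g x + s * f x \<le> g (x - y) + t * f (x - y) + j \<and> g (x - y) + s * f (x - y) \<le> g x + t * f x"
    if x: "x0 + A \<le> x" and y: "y \<in> {0..A}" for x y
  proof -
    let ?r = "g (x - y) + t * f (x - y)"
    have xy: "x0 \<le> x - y" "x0 \<le> x" using x y A by auto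
    have "rho_cdf (x - y) ?r \<le> prob ({\<omega> \<in> space M. real (\<rho> x \<omega>) \<le> ?r + j} \<union> {\<omega> \<in> space M. real (\<rho> (x - y) \<omega>) + j < real (\<rho> (x - y + y) \<omega>)})"
      unfolding rho_cdf_def by (intro finite_measure_mono) auto
    also have "\<dots> \<le> rho_cdf x (?r + j) + prob {\<omega> \<in> space M. real (\<rho> (x - y) \<omega>) + j < real (\<rho> (x - y + y) \<omega>)}"
      unfolding rho_cdf_def by (intro measure_Un_le) auto
    also have "\<dots> \<le> rho_cdf x (?r + j) + S_cdf j y" by (intro add_left_mono prob_rho_increment)
    also have "\<dots> \<le> rho_cdf x (?r + j) + e" using j S_cdf_mono[of j j y A] y by simp
    finally have "cdf \<mu> t - 2 * e < rho_cdf x (?r + j)" using x0[OF xy(1)] by simp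
    then have "rho_cdf x (g x + s * f x) < rho_cdf x (?r + j)" using x0[OF xy(2)] e by (simp add: e_def field_simps)
    then have 1: "g x + s * f x < ?r + j" by (rule rho_cdf_less_imp)
    have "rho_cdf x (g x + t * f x) \<le> rho_cdf (x - y) (g x + t * f x)" using y by (intro rho_cdf_mono) auto
    then have "rho_cdf (x - y) (g (x - y) + s * f (x - y)) < rho_cdf (x - y) (g x + t * f x)"
      using x0[OF xy(1)] x0[OF xy(2)] e by (simp add: e_def field_simps)
    then have "g (x - y) + s * f (x - y) < g x + t * f x" by (rule rho_cdf_less_imp)
    with 1 show ?thesis by simp
  qed
  then show ?thesis unfolding eventually_at_top_linorder by blast
qed

text \<open>Convergence of types: \<open>\<rho> x\<close> and \<open>\<rho> (x - y)\<close> differ by a tight amount, so their normalizations agree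
  asymptotically. Comparing quantiles near two points of increase \<open>\<tau>1 < \<tau>2\<close> of the limit
  gives two approximate linear equations for \<open>f (x - y) - f x\<close> and \<open>g x - g (x - y)\<close>.\<close>

lemma centering_local:
  assumes A: "0 \<le> A" and \<delta>: "0 < \<delta>"
  shows "\<forall>\<^sub>F x in at_top. \<forall>y\<in>{0..A}. \<bar>g x - g (x - y)\<bar> \<le> \<delta> * f x"
proof -
  obtain C x0 where C: "1 \<le> C" "0 \<le> x0" and
    f: "\<And>z x. x0 \<le> z \<Longrightarrow> z \<le> x \<Longrightarrow> f z \<le> C * f x" "\<And>x. x0 \<le> x \<Longrightarrow> 1 \<le> f x"
    by (rule centering_increment) (rule that)
  obtain t0 where t0: "0 < cdf \<mu> t0" "cdf \<mu> t0 < 1"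
    using mu.ex_cdf_strictly_between[OF nondeg_mu] by blast
  obtain \<tau>1 where \<tau>1: "\<And>d. 0 < d \<Longrightarrow> cdf \<mu> (\<tau>1 - d) < cdf \<mu> t0 \<and> cdf \<mu> t0 \<le> cdf \<mu> (\<tau>1 + d)"
    using mu.ex_increase_point[OF t0] by blast
  \<comment> \<open>a level above \<open>cdf \<mu> t0\<close>, so that the second point of increase differs from the first\<close>
  define p where "p = (cdf \<mu> t0 + 1) / 2"
  have p: "0 < p" "p < 1" "cdf \<mu> t0 < p" using t0 by (auto simp: p_def)
  obtain \<tau>2 where \<tau>2: "\<And>d. 0 < d \<Longrightarrow> cdf \<mu> (\<tau>2 - d) < p \<and> p \<le> cdf \<mu> (\<tau>2 + d)"
    using mu.ex_increase_point[OF p(1,2)] by blast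
  have less: "\<tau>1 < \<tau>2"
  proof -
    obtain d where d: "0 < d" "\<forall>s<t0 + d. cdf \<mu> s < p" using mu.cdf_right_less[OF p(3)] by blast
    have "\<tau>1 \<le> t0" using \<tau>1[of "\<tau>1 - t0"] by force
    moreover have "t0 + d \<le> \<tau>2"
    proof (rule ccontr)
      assume "\<not> t0 + d \<le> \<tau>2"
      then have "\<tau>2 + (t0 + d - \<tau>2) / 2 < t0 + d" by (simp add: field_simps)
      then show False using d(2) \<tau>2[of "(t0 + d - \<tau>2) / 2"] \<open>\<not> t0 + d \<le> \<tau>2\<close> by force
    qed
    ultimately show ?thesis using d by simp
  qed
  define Q where "Q = (\<bar>\<tau>1\<bar> / (\<tau>2 - \<tau>1) * (2 * (1 + C) + 1) + (1 + C) + 1)"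
  have Q: "1 \<le> Q" using less C unfolding Q_def by (auto intro!: add_nonneg_nonneg mult_nonneg_nonneg)
  define d where "d = \<delta> / Q"
  have d: "0 < d" using \<delta> Q by (simp add: d_def)
  have pts: "\<exists>s t. \<tau> - d < s \<and> t < \<tau> + d \<and> isCont (cdf \<mu>) s \<and> isCont (cdf \<mu>) t \<and> cdf \<mu> s < cdf \<mu> t"
    if "\<And>d. 0 < d \<Longrightarrow> cdf \<mu> (\<tau> - d) < q \<and> q \<le> cdf \<mu> (\<tau> + d)" for \<tau> q
  proof -
    obtain s where s: "\<tau> - d < s" "s < \<tau> - d / 2" "isCont (cdf \<mu>) s" using mu.ex_isCont_cdf[of "\<tau> - d" "\<tau> - d / 2"] d by auto
    obtain t where t: "\<tau> + d / 2 < t" "t < \<tau> + d" "isCont (cdf \<mu>) t" using mu.ex_isCont_cdf[of "\<tau> + d / 2" "\<tau> + d"] d by auto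
    have "cdf \<mu> s \<le> cdf \<mu> (\<tau> - d / 2)" using s by (intro mu.cdf_nondecreasing) auto
    also have "\<dots> < q" using that[of "d / 2"] d by simp
    also have "\<dots> \<le> cdf \<mu> (\<tau> + d / 2)" using that[of "d / 2"] d by simp
    also have "\<dots> \<le> cdf \<mu> t" using t by (intro mu.cdf_nondecreasing) auto
    finally show ?thesis using s t by blast
  qed
  obtain s1 t1 where st1: "\<tau>1 - d < s1" "t1 < \<tau>1 + d" "isCont (cdf \<mu>) s1" "isCont (cdf \<mu>) t1" "cdf \<mu> s1 < cdf \<mu> t1"
    using pts[OF \<tau>1] by blast
  obtain s2 t2 where st2: "\<tau>2 - d < s2" "t2 < \<tau>2 + d" "isCont (cdf \<mu>) s2" "isCont (cdf \<mu>) t2" "cdf \<mu> s2 < cdf \<mu> t2"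
    using pts[OF \<tau>2] by blast
  obtain j1 :: nat where j1: "\<forall>\<^sub>F x in at_top. \<forall>y\<in>{0..A}.
     g x + s1 * f x \<le> g (x - y) + t1 * f (x - y) + j1 \<and> g (x - y) + s1 * f (x - y) \<le> g x + t1 * f x"
    using centering_local_aux[OF st1(4,3,5) A] by blast
  obtain j2 :: nat where j2: "\<forall>\<^sub>F x in at_top. \<forall>y\<in>{0..A}.
     g x + s2 * f x \<le> g (x - y) + t2 * f (x - y) + j2 \<and> g (x - y) + s2 * f (x - y) \<le> g x + t2 * f x"
    using centering_local_aux[OF st2(4,3,5) A] by blast
  have "\<forall>\<^sub>F x in at_top. real (max j1 j2) / d \<le> f x" using filterlim_f unfolding filterlim_at_top by blast
  with j1 j2 show ?thesis using eventually_ge_at_top[of "x0 + A"]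
  proof eventually_elim
    case (elim x)
    show ?case
    proof
      fix y assume y: "y \<in> {0..A}"
      define X Y \<Delta> E where "X = f x" and "Y = f (x - y)" and "\<Delta> = g x - g (x - y)" and "E = d * (X + Y)"
      have xy: "x0 \<le> x - y" "x - y \<le> x" using elim(4) y by auto
      have X: "1 \<le> X" "1 \<le> Y" "Y \<le> C * X" using f(1)[OF xy] f(2)[OF xy(1)] f(2)[of x] xy by (auto simp: X_def Y_def)
      have j: "real j1 \<le> d * X" "real j2 \<le> d * X" using elim(3) d by (auto simp: X_def field_simps)
      have E: "0 \<le> E" "E \<le> d * (1 + C) * X" using X d by (auto simp: E_def algebra_simps)
      have up: "\<Delta> \<le> \<tau> * (Y - X) + E + d * X" and lo: "\<tau> * (Y - X) - E \<le> \<Delta>"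
        if "\<tau> - d < s" "t < \<tau> + d" "g x + s * f x \<le> g (x - y) + t * f (x - y) + j"
          "g (x - y) + s * f (x - y) \<le> g x + t * f x" "j \<le> d * X" for \<tau> s t j
      proof -
        have 1: "(\<tau> - d) * X \<le> s * X" "t * Y \<le> (\<tau> + d) * Y" "(\<tau> - d) * Y \<le> s * Y" "t * X \<le> (\<tau> + d) * X"
          using that X by (auto intro!: mult_right_mono)
        show "\<Delta> \<le> \<tau> * (Y - X) + E + d * X" using 1 that unfolding \<Delta>_def X_def[symmetric] Y_def[symmetric] E_def
          by (simp add: algebra_simps)
        show "\<tau> * (Y - X) - E \<le> \<Delta>" using 1 that unfolding \<Delta>_def X_def[symmetric] Y_def[symmetric] E_def
          by (simp add: algebra_simps)
      qed
      have u1: "\<Delta> \<le> \<tau>1 * (Y - X) + E + d * X" and l1: "\<tau>1 * (Y - X) - E \<le> \<Delta>"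
        using up[OF st1(1,2), of "real j1"] lo[OF st1(1,2), of "real j1"] elim(1) y j by auto
      have u2: "\<Delta> \<le> \<tau>2 * (Y - X) + E + d * X" and l2: "\<tau>2 * (Y - X) - E \<le> \<Delta>"
        using up[OF st2(1,2), of "real j2"] lo[OF st2(1,2), of "real j2"] elim(2) y j by auto
      have "(\<tau>2 - \<tau>1) * (Y - X) \<le> 2 * E + d * X" "- ((\<tau>2 - \<tau>1) * (Y - X)) \<le> 2 * E + d * X"
        using u1 l1 u2 l2 by (auto simp: algebra_simps)
      moreover have "- ((\<tau>2 - \<tau>1) * (Y - X)) = (\<tau>2 - \<tau>1) * (X - Y)" by (simp add: algebra_simps)
      ultimately have "(\<tau>2 - \<tau>1) * \<bar>Y - X\<bar> \<le> 2 * E + d * X" by (cases "X \<le> Y") auto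
      also have "\<dots> \<le> (2 * (1 + C) + 1) * (d * X)" using E by (simp add: algebra_simps)
      finally have YX: "\<bar>Y - X\<bar> \<le> (2 * (1 + C) + 1) * (d * X) / (\<tau>2 - \<tau>1)" using less by (simp add: field_simps)
      have "\<bar>\<tau>1 * (Y - X)\<bar> \<le> \<bar>\<tau>1\<bar> * ((2 * (1 + C) + 1) * (d * X) / (\<tau>2 - \<tau>1))"
        unfolding abs_mult by (intro mult_left_mono YX) auto
      moreover have "\<bar>\<Delta>\<bar> \<le> \<bar>\<tau>1 * (Y - X)\<bar> + E + d * X"
      proof -
        have "0 \<le> d * X" using d X by simp
        with u1 l1 show ?thesis by linarith
      qed
      ultimately have "\<bar>\<Delta>\<bar> \<le> \<bar>\<tau>1\<bar> * ((2 * (1 + C) + 1) * (d * X) / (\<tau>2 - \<tau>1)) + d * (1 + C) * X + d * X"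
        using E by linarith
      also have "\<dots> = Q * (d * X)" unfolding Q_def by (simp add: algebra_simps add_divide_distrib)
      also have "\<dots> = \<delta> * X" using Q by (simp add: d_def)
      finally show "\<bar>g x - g (x - y)\<bar> \<le> \<delta> * f x" by (simp add: \<Delta>_def X_def)
    qed
  qed
qed

end

section \<open>The number of points of the perturbed walk\<close>

text \<open>Fubini for an independent pair. Independence is expressed by the joint law, so that the components may have
  different types.\<close>

lemma (in prob_space) expectation_indep_pair:
  fixes h :: "'b \<times> 'c \<Rightarrow> real"
  assumes [measurable]: "X \<in> measurable M N" "Y \<in> measurable M N'"
    and joint: "distr M (N \<Otimes>\<^sub>M N') (\<lambda>\<omega>. (X \<omega>, Y \<omega>)) = distr M N X \<Otimes>\<^sub>M distr M N' Y"
    and h [measurable]: "h \<in> borel_measurable (N \<Otimes>\<^sub>M N')"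
    and bound: "\<And>p. p \<in> space (N \<Otimes>\<^sub>M N') \<Longrightarrow> \<bar>h p\<bar> \<le> B"
  shows "expectation (\<lambda>\<omega>. h (X \<omega>, Y \<omega>)) = expectation (\<lambda>\<omega>. \<integral>y. h (X \<omega>, y) \<partial>distr M N' Y)"
proof -
  interpret X: prob_space "distr M N X" by (rule prob_space_distr) simp
  interpret Y: prob_space "distr M N' Y" by (rule prob_space_distr) simp
  interpret P: pair_prob_space "distr M N X" "distr M N' Y" ..
  have int: "integrable (distr M N X \<Otimes>\<^sub>M distr M N' Y) h"
    using bound by (intro P.integrable_const_bound[of _ B]) (auto simp: space_pair_measure)
  have "expectation (\<lambda>\<omega>. h (X \<omega>, Y \<omega>)) = integral\<^sup>L (distr M (N \<Otimes>\<^sub>M N') (\<lambda>\<omega>. (X \<omega>, Y \<omega>))) h"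
    by (subst integral_distr) auto
  also have "distr M (N \<Otimes>\<^sub>M N') (\<lambda>\<omega>. (X \<omega>, Y \<omega>)) = distr M N X \<Otimes>\<^sub>M distr M N' Y"
    by (rule joint)
  also have "integral\<^sup>L (distr M N X \<Otimes>\<^sub>M distr M N' Y) h = (\<integral>x. (\<integral>y. h (x, y) \<partial>distr M N' Y) \<partial>distr M N X)"
    using P.integral_fst'[OF int] by simp
  also have "\<dots> = expectation (\<lambda>\<omega>. \<integral>y. h (X \<omega>, y) \<partial>distr M N' Y)"
    by (subst integral_distr) auto
  finally show ?thesis .
qed

context perturbed_walk
begin

lemma measurable_steps: "X \<in> measurable (steps I) K \<Longrightarrow> X \<in> measurable M K"
  unfolding measurable_def by (auto intro: steps_subalgebra)

text \<open>The sample point itself, once with the past and once with the future sigma-algebra, is an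
  independent pair. The joint law of \<open>X\<close> and \<open>Y\<close> is an image of that of this pair.\<close>

lemma joint_past_future:
  assumes X: "X \<in> measurable (past k) K" and Y: "Y \<in> measurable (future k) K'"
  shows "distr M (K \<Otimes>\<^sub>M K') (\<lambda>\<omega>. (X \<omega>, Y \<omega>)) = distr M K X \<Otimes>\<^sub>M distr M K' Y"
proof -
  note [measurable] = X Y measurable_steps[OF X] measurable_steps[OF Y]
  have id: "(\<lambda>\<omega>. \<omega>) \<in> measurable M (past k)" "(\<lambda>\<omega>. \<omega>) \<in> measurable M (future k)"
    using measurable_steps[of "\<lambda>\<omega>. \<omega>" "{..<k}" "past k"] measurable_steps[of "\<lambda>\<omega>. \<omega>" "{k..}" "future k"]
    by simp_all
  let ?P = "distr M (past k) (\<lambda>\<omega>. \<omega>)" and ?F = "distr M (future k) (\<lambda>\<omega>. \<omega>)"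
  have ind: "indep_var (past k) (\<lambda>\<omega>. \<omega>) (future k) (\<lambda>\<omega>. \<omega>)" by (rule indep_past_future[where k=k]) auto
  then have PF: "?P \<Otimes>\<^sub>M ?F = distr M (past k \<Otimes>\<^sub>M future k) (\<lambda>\<omega>. (\<omega>, \<omega>))"
    unfolding indep_var_distribution_eq by simp
  have X': "X \<in> measurable ?P K" and Y': "Y \<in> measurable ?F K'" using X Y by simp_all
  have eq: "distr ?P K X = distr M K X" "distr ?F K' Y = distr M K' Y"
    using X Y id by (simp_all add: distr_distr comp_def)
  interpret Y: prob_space "distr M K' Y" by (rule prob_space_distr) simp
  have "distr ?P K X \<Otimes>\<^sub>M distr ?F K' Y = distr (?P \<Otimes>\<^sub>M ?F) (K \<Otimes>\<^sub>M K') (\<lambda>(a, b). (X a, Y b))"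
    by (rule pair_measure_distr[OF X' Y']) (unfold eq, rule Y.sigma_finite_measure_axioms)
  also have "\<dots> = distr M (K \<Otimes>\<^sub>M K') (\<lambda>\<omega>. (X \<omega>, Y \<omega>))"
    unfolding PF using id by (subst distr_distr) (auto simp: comp_def)
  finally show ?thesis unfolding eq by simp
qed

lemmas expectation_past_future = expectation_indep_pair[OF measurable_steps measurable_steps joint_past_future]

definition \<nu> :: "real measure" where
  "\<nu> = distr M borel (\<eta> 0)"

definition N :: "real \<Rightarrow> 'a \<Rightarrow> nat" where
  "N x \<omega> = card {k. S k \<omega> + \<eta> k \<omega> \<le> x}"

text \<open>The indicator of \<open>s + y \<le> x\<close>, centered with respect to \<open>y\<close> of law \<open>\<nu>\<close>.\<close>

definition \<phi> :: "real \<Rightarrow> real \<Rightarrow> real \<Rightarrow> real" where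
  "\<phi> x s y = (if s \<le> x then indicator {..x - s} y - cdf \<nu> (x - s) else 0)"

text \<open>The martingale that separates the points \<open>S k + \<eta> k\<close> from their conditional means given the walk before
  step \<open>k\<close>.\<close>

definition Z :: "real \<Rightarrow> nat \<Rightarrow> 'a \<Rightarrow> real" where
  "Z x n \<omega> = (\<Sum>k<n. \<phi> x (S k \<omega>) (\<eta> k \<omega>))"

abbreviation tail :: "real \<Rightarrow> real" where
  "tail u \<equiv> 1 - cdf \<nu> u"

sublocale nu: real_distribution \<nu>
  unfolding \<nu>_def by (rule real_distribution_distr) simp

lemma N_measurable [measurable]: "N x \<in> measurable M (count_space UNIV)"
  unfolding N_def[abs_def] by measurable

lemma cdf_nu_measurable [measurable]: "cdf \<nu> \<in> borel_measurable borel"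
  by (rule borel_measurable_mono) (auto simp: mono_def nu.cdf_nondecreasing)

lemma phi_measurable [measurable]: "(\<lambda>(s, y). \<phi> x s y) \<in> borel_measurable (borel \<Otimes>\<^sub>M borel)"
proof -
  have "(\<lambda>(s, y). \<phi> x s y) = (\<lambda>(s, y). if s \<le> x then (if y \<le> x - s then 1 else 0) - cdf \<nu> (x - s) else 0)"
    by (auto simp: \<phi>_def fun_eq_iff)
  also have "\<dots> \<in> borel_measurable (borel \<Otimes>\<^sub>M borel)" by measurable
  finally show ?thesis .
qed

lemma phi_bound: "\<bar>\<phi> x s y\<bar> \<le> 1"
  using nu.cdf_nonneg[of "x - s"] nu.cdf_bounded_prob[of "x - s"] by (auto simp: \<phi>_def indicator_def)

lemma phi_mean: "(\<integral>y. \<phi> x s y \<partial>\<nu>) = 0"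
proof (cases "s \<le> x")
  case True
  have "(\<integral>y. \<phi> x s y \<partial>\<nu>) = (\<integral>y. indicator {..x - s} y - cdf \<nu> (x - s) \<partial>\<nu>)" using True by (simp add: \<phi>_def)
  also have "\<dots> = 0"
    by (subst Bochner_Integration.integral_diff) (auto simp: cdf_def less_top[symmetric] nu.prob_space[unfolded nu.space_eq_univ])
  finally show ?thesis .
qed (simp add: \<phi>_def)

lemma phi_variance: "(\<integral>y. (\<phi> x s y)\<^sup>2 \<partial>\<nu>) \<le> (if s \<le> x then tail (x - s) else 0)"
proof (cases "s \<le> x")
  case True
  let ?F = "cdf \<nu> (x - s)"
  have F: "0 \<le> ?F" "?F \<le> 1" using nu.cdf_nonneg nu.cdf_bounded_prob by auto
  have "(\<integral>y. (\<phi> x s y)\<^sup>2 \<partial>\<nu>) = (\<integral>y. (1 - 2 * ?F) * indicator {..x - s} y + ?F\<^sup>2 \<partial>\<nu>)"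
    using True by (intro Bochner_Integration.integral_cong) (auto simp: \<phi>_def indicator_def power2_eq_square algebra_simps)
  also have "\<dots> = (1 - 2 * ?F) * ?F + ?F\<^sup>2"
    by (subst Bochner_Integration.integral_add) (auto simp: cdf_def less_top[symmetric] nu.prob_space[unfolded nu.space_eq_univ])
  also have "\<dots> = ?F * (1 - ?F)" by (simp add: power2_eq_square algebra_simps)
  also have "\<dots> \<le> 1 * (1 - ?F)" using F by (intro mult_right_mono) auto
  finally show ?thesis using True by simp
qed (simp add: \<phi>_def)

lemma zeta_measurable [measurable]: "(\<lambda>\<omega>. \<phi> x (S k \<omega>) (\<eta> k \<omega>)) \<in> borel_measurable M"
proof -
  have "(\<lambda>\<omega>. (S k \<omega>, \<eta> k \<omega>)) \<in> measurable M (borel \<Otimes>\<^sub>M borel)" by measurable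
  from measurable_compose[OF this phi_measurable] show ?thesis by simp
qed

lemma Z_measurable [measurable]: "Z x n \<in> borel_measurable M"
  unfolding Z_def[abs_def] by measurable

lemma Z_past: "Z x n \<in> borel_measurable (past n)"
proof -
  have "(\<lambda>\<omega>. \<phi> x (S k \<omega>) (\<eta> k \<omega>)) \<in> borel_measurable (past n)" if "k < n" for k
  proof -
    have "(\<lambda>\<omega>. (S k \<omega>, \<eta> k \<omega>)) \<in> measurable (past n) (borel \<Otimes>\<^sub>M borel)"
      using that by (intro measurable_Pair S_past eta_steps) auto
    from measurable_compose[OF this phi_measurable] show ?thesis by simp
  qed
  then show ?thesis unfolding Z_def[abs_def] by (intro borel_measurable_sum) auto
qed

lemma Z_bound: "\<bar>Z x n \<omega>\<bar> \<le> real n"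
  unfolding Z_def using sum_norm_bound[of "{..<n}" "\<lambda>k. \<phi> x (S k \<omega>) (\<eta> k \<omega>)" 1] phi_bound by simp

lemma distr_eta_nu: "distr M borel (\<eta> k) = \<nu>"
  unfolding \<nu>_def by (rule distr_eta)

text \<open>The conditional variance given \<open>S n = s\<close> is at most \<open>tail (x - s)\<close>. This is at most \<open>tail A\<close>, unless \<open>s\<close> is within \<open>A\<close> of
  \<open>x\<close>.\<close>

lemma expectation_zeta_square:
  "expectation (\<lambda>\<omega>. (\<phi> x (S n \<omega>) (\<eta> n \<omega>))\<^sup>2)
     \<le> tail A * S_cdf n x + prob {\<omega> \<in> space M. x - A < S n \<omega> \<and> S n \<omega> \<le> x - A + A}"
proof -
  have meas: "S n \<in> borel_measurable (past n)" "\<eta> n \<in> borel_measurable (future n)"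
    by (auto intro: S_past eta_steps)
  have "expectation (\<lambda>\<omega>. (\<lambda>(s, y). (\<phi> x s y)\<^sup>2) (S n \<omega>, \<eta> n \<omega>))
     = expectation (\<lambda>\<omega>. \<integral>y. (\<lambda>(s, y). (\<phi> x s y)\<^sup>2) (S n \<omega>, y) \<partial>distr M borel (\<eta> n))"
  proof (rule expectation_past_future[OF meas meas, where B=1])
    show "(\<lambda>(s, y). (\<phi> x s y)\<^sup>2) \<in> borel_measurable (borel \<Otimes>\<^sub>M borel)"
      using borel_measurable_power[OF phi_measurable, of x 2] by (simp add: case_prod_beta')
  qed (use phi_bound in \<open>auto simp: abs_square_le_1\<close>)
  then have "expectation (\<lambda>\<omega>. (\<phi> x (S n \<omega>) (\<eta> n \<omega>))\<^sup>2) = expectation (\<lambda>\<omega>. \<integral>y. (\<phi> x (S n \<omega>) y)\<^sup>2 \<partial>\<nu>)"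
    by (simp add: distr_eta_nu)
  also have "\<dots> \<le> expectation (\<lambda>\<omega>. tail A * indicator {\<omega> \<in> space M. S n \<omega> \<le> x} \<omega>
       + indicator {\<omega> \<in> space M. x - A < S n \<omega> \<and> S n \<omega> \<le> x - A + A} \<omega>)"
  proof (rule integral_mono_AE')
    show "integrable M (\<lambda>\<omega>. tail A * indicator {\<omega> \<in> space M. S n \<omega> \<le> x} \<omega>
       + indicator {\<omega> \<in> space M. x - A < S n \<omega> \<and> S n \<omega> \<le> x - A + A} \<omega>)"
      by (intro Bochner_Integration.integrable_add integrable_mult_right) (auto simp: less_top[symmetric])
    have "(\<integral>y. (\<phi> x (S n \<omega>) y)\<^sup>2 \<partial>\<nu>) \<le> tail A * indicator {\<omega> \<in> space M. S n \<omega> \<le> x} \<omega>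
       + indicator {\<omega> \<in> space M. x - A < S n \<omega> \<and> S n \<omega> \<le> x - A + A} \<omega>" if w: "\<omega> \<in> space M" for \<omega>
    proof (cases "S n \<omega> \<le> x")
      case True
      have t: "0 \<le> tail u" "tail u \<le> 1" for u using nu.cdf_nonneg[of u] nu.cdf_bounded_prob[of u] by auto
      have "(\<integral>y. (\<phi> x (S n \<omega>) y)\<^sup>2 \<partial>\<nu>) \<le> tail (x - S n \<omega>)" using phi_variance[of x "S n \<omega>"] True by simp
      also have "\<dots> \<le> tail A + indicator {\<omega> \<in> space M. x - A < S n \<omega> \<and> S n \<omega> \<le> x - A + A} \<omega>"
      proof (cases "x - A < S n \<omega>")
        case False
        then have "tail (x - S n \<omega>) \<le> tail A" using nu.cdf_nondecreasing[of A "x - S n \<omega>"] by simp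
        then show ?thesis by (simp add: indicator_def)
      next
        case less: True
        then show ?thesis using True w t(1)[of A] t(2)[of "x - S n \<omega>"] by (simp add: indicator_def)
      qed
      finally show ?thesis using True w by simp
    next
      case False
      then show ?thesis using phi_variance[of x "S n \<omega>"] by simp
    qed
    then show "AE \<omega> in M. (\<integral>y. (\<phi> x (S n \<omega>) y)\<^sup>2 \<partial>\<nu>) \<le> tail A * indicator {\<omega> \<in> space M. S n \<omega> \<le> x} \<omega>
       + indicator {\<omega> \<in> space M. x - A < S n \<omega> \<and> S n \<omega> \<le> x - A + A} \<omega>" by (rule AE_I2)
    show "AE \<omega> in M. 0 \<le> tail A * indicator {\<omega> \<in> space M. S n \<omega> \<le> x} \<omega>
       + indicator {\<omega> \<in> space M. x - A < S n \<omega> \<and> S n \<omega> \<le> x - A + A} \<omega>"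
      using nu.cdf_bounded_prob[of A] by (intro AE_I2 add_nonneg_nonneg mult_nonneg_nonneg) auto
  qed
  also have "\<dots> = tail A * S_cdf n x + prob {\<omega> \<in> space M. x - A < S n \<omega> \<and> S n \<omega> \<le> x - A + A}"
    unfolding S_cdf_def
    by (subst Bochner_Integration.integral_add) (auto simp: less_top[symmetric])
  finally show ?thesis .
qed

text \<open>Summing over the steps, the terms with \<open>tail A\<close> are as many as the renewal function up to \<open>x\<close> counts, and
  the others are bounded by the visits to an interval of length \<open>A\<close>. The bound is uniform in \<open>n\<close>.\<close>

lemma expectation_Z_square: "expectation (\<lambda>\<omega>. (Z x n \<omega>)\<^sup>2) \<le> 2 * tail A * real (med x) + 2 * real (med A)"
proof -
  have int: "integrable M (\<lambda>\<omega>. (Z x n \<omega>)\<^sup>2)" for n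
    by (rule integrable_const_bound[of _ "(real n)\<^sup>2"]) (use Z_bound in \<open>auto simp: abs_le_square_iff[symmetric]\<close>)
  have intz: "integrable M (\<lambda>\<omega>. (\<phi> x (S n \<omega>) (\<eta> n \<omega>))\<^sup>2)" for n
    by (rule integrable_const_bound[of _ 1]) (use phi_bound in \<open>auto simp: abs_square_le_1\<close>)
  have intc: "integrable M (\<lambda>\<omega>. Z x n \<omega> * \<phi> x (S n \<omega>) (\<eta> n \<omega>))" for n
    by (rule integrable_const_bound[of _ "real n"])
       (use mult_mono[OF Z_bound phi_bound] in \<open>auto simp: abs_mult\<close>)
  \<comment> \<open>The difference at step \<open>n\<close> has conditional mean \<open>0\<close>. Clipping \<open>Z\<close> at \<open>n\<close>, which it never exceeds,
    makes the integrand bounded on the whole product space.\<close>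
  have orth: "expectation (\<lambda>\<omega>. Z x n \<omega> * \<phi> x (S n \<omega>) (\<eta> n \<omega>)) = 0" for n
  proof -
    let ?h = "\<lambda>((z, s), y). max (- real n) (min (real n) z) * \<phi> x s y"
    have meas: "(\<lambda>\<omega>. (Z x n \<omega>, S n \<omega>)) \<in> measurable (past n) (borel \<Otimes>\<^sub>M borel)" "\<eta> n \<in> borel_measurable (future n)"
      by (auto intro!: measurable_Pair S_past eta_steps Z_past)
    have "expectation (\<lambda>\<omega>. ?h ((Z x n \<omega>, S n \<omega>), \<eta> n \<omega>))
       = expectation (\<lambda>\<omega>. \<integral>y. ?h ((Z x n \<omega>, S n \<omega>), y) \<partial>distr M borel (\<eta> n))"
    proof (rule expectation_past_future[OF meas meas, where B="real n"])
      have "(\<lambda>p. (snd (fst p), snd p)) \<in> measurable ((borel \<Otimes>\<^sub>M borel) \<Otimes>\<^sub>M borel) (borel \<Otimes>\<^sub>M (borel :: real measure))"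
        for p :: "(real \<times> real) \<times> real" by measurable
      from measurable_compose[OF this phi_measurable]
      have [measurable]: "(\<lambda>p. \<phi> x (snd (fst p)) (snd p)) \<in> borel_measurable (((borel :: real measure) \<Otimes>\<^sub>M borel) \<Otimes>\<^sub>M borel)"
        by simp
      show "?h \<in> borel_measurable ((borel \<Otimes>\<^sub>M borel) \<Otimes>\<^sub>M borel)"
        unfolding case_prod_beta' by measurable
      have "\<bar>max (- real n) (min (real n) z) * \<phi> x s y\<bar> \<le> real n * 1" for z s y
        unfolding abs_mult by (intro mult_mono phi_bound) auto
      then show "\<bar>?h p\<bar> \<le> real n" for p by (cases p) auto
    qed
    moreover have "max (- real n) (min (real n) (Z x n \<omega>)) = Z x n \<omega>" for \<omega>
      using Z_bound[of x n \<omega>] by (auto simp: max_def min_def)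
    ultimately show ?thesis by (simp add: distr_eta_nu phi_mean)
  qed
  have "expectation (\<lambda>\<omega>. (Z x n \<omega>)\<^sup>2) = (\<Sum>k<n. expectation (\<lambda>\<omega>. (\<phi> x (S k \<omega>) (\<eta> k \<omega>))\<^sup>2))"
  proof (induction n)
    case 0
    then show ?case by (simp add: Z_def)
  next
    case (Suc n)
    have "(Z x (Suc n) \<omega>)\<^sup>2 = (Z x n \<omega>)\<^sup>2 + 2 * (Z x n \<omega> * \<phi> x (S n \<omega>) (\<eta> n \<omega>)) + (\<phi> x (S n \<omega>) (\<eta> n \<omega>))\<^sup>2" for \<omega>
      by (simp add: Z_def power2_eq_square algebra_simps)
    then have "expectation (\<lambda>\<omega>. (Z x (Suc n) \<omega>)\<^sup>2) = expectation (\<lambda>\<omega>. (Z x n \<omega>)\<^sup>2)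
        + 2 * expectation (\<lambda>\<omega>. Z x n \<omega> * \<phi> x (S n \<omega>) (\<eta> n \<omega>)) + expectation (\<lambda>\<omega>. (\<phi> x (S n \<omega>) (\<eta> n \<omega>))\<^sup>2)"
      using int intz intc by simp
    then show ?case using Suc orth by simp
  qed
  also have "\<dots> \<le> (\<Sum>k<n. tail A * S_cdf k x + prob {\<omega> \<in> space M. x - A < S k \<omega> \<and> S k \<omega> \<le> x - A + A})"
    by (intro sum_mono expectation_zeta_square)
  also have "\<dots> = tail A * (\<Sum>k<n. S_cdf k x) + (\<Sum>k<n. prob {\<omega> \<in> space M. x - A < S k \<omega> \<and> S k \<omega> \<le> x - A + A})"
    by (simp add: sum.distrib sum_distrib_left)
  also have "\<dots> \<le> tail A * (2 * real (med x)) + 2 * real (med A)"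
  proof (intro add_mono mult_left_mono)
    show "(\<Sum>k<n. S_cdf k x) \<le> 2 * real (med x)" by (rule sum_S_cdf_le)
    show "(\<Sum>k<n. prob {\<omega> \<in> space M. x - A < S k \<omega> \<and> S k \<omega> \<le> x - A + A}) \<le> 2 * real (med A)"
      by (rule sum_prob_interval)
    show "0 \<le> tail A" using nu.cdf_bounded_prob[of A] by simp
  qed
  finally show ?thesis by (simp add: algebra_simps)
qed

lemma prob_Z_le:
  assumes "0 < c"
  shows "prob {\<omega> \<in> space M. c < \<bar>Z x n \<omega>\<bar>} \<le> (2 * tail A * real (med x) + 2 * real (med A)) / c\<^sup>2"
proof -
  have int: "integrable M (\<lambda>\<omega>. (Z x n \<omega>)\<^sup>2)"
    by (rule integrable_const_bound[of _ "(real n)\<^sup>2"]) (use Z_bound in \<open>auto simp: abs_le_square_iff[symmetric]\<close>)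
  have "prob {\<omega> \<in> space M. c < \<bar>Z x n \<omega>\<bar>} \<le> prob {\<omega> \<in> space M. c\<^sup>2 \<le> (Z x n \<omega>)\<^sup>2}"
  proof (rule finite_measure_mono)
    have "c\<^sup>2 \<le> z\<^sup>2" if "c < \<bar>z\<bar>" for z using power_mono[of c "\<bar>z\<bar>" 2] assms that by simp
    then show "{\<omega> \<in> space M. c < \<bar>Z x n \<omega>\<bar>} \<subseteq> {\<omega> \<in> space M. c\<^sup>2 \<le> (Z x n \<omega>)\<^sup>2}" by blast
  qed measurable
  also have "\<dots> \<le> expectation (\<lambda>\<omega>. (Z x n \<omega>)\<^sup>2) / c\<^sup>2"
    using assms by (intro integral_Markov_inequality_measure[OF int, where A="{}"]) auto
  also have "\<dots> \<le> (2 * tail A * real (med x) + 2 * real (med A)) / c\<^sup>2"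
    by (intro divide_right_mono expectation_Z_square) auto
  finally show ?thesis .
qed

lemma nu_nonneg: "AE y in \<nu>. 0 \<le> y"
  unfolding \<nu>_def by (subst AE_distr_iff) (auto intro!: AE_I2 eta_nonneg)

lemma rho_eq_sum:
  assumes w: "\<omega> \<in> space M" and unb: "\<And>y. \<exists>k. y < S k \<omega>" and n: "\<rho> x \<omega> \<le> n" and z: "z \<le> x"
  shows "real (\<rho> z \<omega>) = (\<Sum>k<n. indicator {..z} (S k \<omega>))"
proof -
  have "\<rho> z \<omega> \<le> n" using rho_mono[OF w unb z] n by simp
  have "(\<Sum>k<n. indicator {..z} (S k \<omega>) :: real) = card {k\<in>{..<n}. S k \<omega> \<le> z}"
    by (simp add: indicator_def sum.If_cases Int_def)
  also have "{k\<in>{..<n}. S k \<omega> \<le> z} = {..<\<rho> z \<omega>}"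
    using \<open>\<rho> z \<omega> \<le> n\<close> by (auto simp flip: less_rho_iff[OF w unb])
  finally show ?thesis by simp
qed

text \<open>The conditional means add up to the smoothed first passage time, because \<open>\<rho> z\<close> counts the \<open>k\<close> with
  \<open>S k \<le> z\<close>. All sums are finite as soon as \<open>n\<close> exceeds \<open>\<rho> x\<close>.\<close>

lemma N_decomposition:
  assumes w: "\<omega> \<in> space M" and unb: "\<And>y. \<exists>k. y < S k \<omega>" and n: "\<rho> x \<omega> \<le> n"
  shows "set_integrable \<nu> {0..x} (\<lambda>y. real (\<rho> (x - y) \<omega>))"
    and "real (N x \<omega>) = Z x n \<omega> + (LINT y:{0..x}|\<nu>. real (\<rho> (x - y) \<omega>))"
proof -
  have eq: "indicator {0..x} y * real (\<rho> (x - y) \<omega>) = (\<Sum>k<n. indicator {0..x - S k \<omega>} y)" for y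
  proof (cases "y \<in> {0..x}")
    case True
    then have "real (\<rho> (x - y) \<omega>) = (\<Sum>k<n. indicator {..x - y} (S k \<omega>))" by (intro rho_eq_sum[OF w unb n]) auto
    also have "\<dots> = (\<Sum>k<n. indicator {0..x - S k \<omega>} y)"
      using True by (intro sum.cong) (auto simp: indicator_def)
    finally show ?thesis using True by simp
  next
    case False
    then have "indicator {0..x - S k \<omega>} y = (0::real)" for k using S_nonneg[OF w, of k] by (auto simp: indicator_def)
    then show ?thesis using False by simp
  qed
  have intk: "integrable \<nu> (\<lambda>y. \<Sum>k<n. indicator {0..x - S k \<omega>} y :: real)"
    by (intro Bochner_Integration.integrable_sum) (auto simp: less_top[symmetric])
  show "set_integrable \<nu> {0..x} (\<lambda>y. real (\<rho> (x - y) \<omega>))"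
    unfolding set_integrable_def real_scaleR_def eq by (rule intk)
  have "(LINT y:{0..x}|\<nu>. real (\<rho> (x - y) \<omega>)) = (\<integral>y. (\<Sum>k<n. indicator {0..x - S k \<omega>} y) \<partial>\<nu>)"
    unfolding set_lebesgue_integral_def real_scaleR_def eq ..
  also have "\<dots> = (\<Sum>k<n. measure \<nu> {0..x - S k \<omega>})"
    by (subst Bochner_Integration.integral_sum) (auto simp: less_top[symmetric])
  also have "\<dots> = (\<Sum>k<n. if S k \<omega> \<le> x then cdf \<nu> (x - S k \<omega>) else 0)"
  proof (rule sum.cong)
    fix k
    have "measure \<nu> {0..x - S k \<omega>} = measure \<nu> {..x - S k \<omega>}"
      by (rule nu.finite_measure_eq_AE) (use nu_nonneg in \<open>auto elim!: eventually_mono\<close>)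
    then show "measure \<nu> {0..x - S k \<omega>} = (if S k \<omega> \<le> x then cdf \<nu> (x - S k \<omega>) else 0)"
      by (auto simp: cdf_def)
  qed simp
  finally have int: "(LINT y:{0..x}|\<nu>. real (\<rho> (x - y) \<omega>)) = (\<Sum>k<n. if S k \<omega> \<le> x then cdf \<nu> (x - S k \<omega>) else 0)" .
  have less: "k < n" if "S k \<omega> + \<eta> k \<omega> \<le> x" for k
    using that eta_nonneg[OF w, of k] less_rho_iff[OF w unb, of k x] n by auto
  have "real (N x \<omega>) = real (card {k\<in>{..<n}. S k \<omega> + \<eta> k \<omega> \<le> x})"
    unfolding N_def using less by (intro arg_cong[where f="\<lambda>A. real (card A)"]) auto
  also have "\<dots> = (\<Sum>k<n. if S k \<omega> + \<eta> k \<omega> \<le> x then 1 else 0)"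
    by (simp add: sum.If_cases Int_def)
  also have "\<dots> = (\<Sum>k<n. \<phi> x (S k \<omega>) (\<eta> k \<omega>) + (if S k \<omega> \<le> x then cdf \<nu> (x - S k \<omega>) else 0))"
  proof (rule sum.cong)
    fix k
    show "(if S k \<omega> + \<eta> k \<omega> \<le> x then 1 else 0)
        = \<phi> x (S k \<omega>) (\<eta> k \<omega>) + (if S k \<omega> \<le> x then cdf \<nu> (x - S k \<omega>) else 0)"
      using eta_nonneg[OF w, of k] by (simp add: \<phi>_def indicator_def algebra_simps)
  qed simp
  also have "\<dots> = Z x n \<omega> + (LINT y:{0..x}|\<nu>. real (\<rho> (x - y) \<omega>))" by (simp add: sum.distrib Z_def int)
  finally show "real (N x \<omega>) = Z x n \<omega> + (LINT y:{0..x}|\<nu>. real (\<rho> (x - y) \<omega>))" .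
qed

end

context passage_limit
begin

text \<open>The deterministic part of the comparison. Writing \<open>D z = \<rho> z - g z\<close>, the difference equals
  \<open>tail x * D x - (LINT y:{0..x}|\<nu>. D (x - y) - D x)\<close> minus the martingale. The integrand is at most \<open>h\<close> up to \<open>A\<close>
  and at most \<open>2 * H\<close> beyond.\<close>

lemma N_minus_centering_bound:
  assumes w: "\<omega> \<in> space M" and unb: "\<And>y. \<exists>k. y < S k \<omega>" and n: "\<rho> x \<omega> \<le> n"
    and int: "set_integrable \<nu> {0..x} (\<lambda>y. g (x - y))"
    and A: "0 \<le> A" "A \<le> x" and H: "0 \<le> H" and h: "0 \<le> h"
    and D: "\<And>z. 0 \<le> z \<Longrightarrow> z \<le> x \<Longrightarrow> \<bar>real (\<rho> z \<omega>) - g z\<bar> \<le> H"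
    and loc: "\<And>y. 0 \<le> y \<Longrightarrow> y \<le> A \<Longrightarrow> \<bar>(real (\<rho> (x - y) \<omega>) - g (x - y)) - (real (\<rho> x \<omega>) - g x)\<bar> \<le> h"
  shows "\<bar>(real (\<rho> x \<omega>) - g x) - (real (N x \<omega>) - (LINT y:{0..x}|\<nu>. g (x - y)))\<bar>
    \<le> \<bar>Z x n \<omega>\<bar> + h + 3 * H * tail A"
proof -
  let ?D = "\<lambda>z. real (\<rho> z \<omega>) - g z"
  note dec = N_decomposition[OF w unb n]
  have intD: "set_integrable \<nu> {0..x} (\<lambda>y. ?D (x - y))"
    by (rule set_integral_diff(1)[OF dec(1) int])
  have intc: "set_integrable \<nu> {0..x} (\<lambda>y. ?D x)"
    unfolding set_integrable_def by (simp add: less_top[symmetric])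
  have meas: "measure \<nu> {0..x} = cdf \<nu> x"
    unfolding cdf_def by (rule nu.finite_measure_eq_AE) (use nu_nonneg in \<open>auto elim!: eventually_mono\<close>)
  have "(LINT y:{0..x}|\<nu>. ?D (x - y) - ?D x) = (LINT y:{0..x}|\<nu>. ?D (x - y)) - (LINT y:{0..x}|\<nu>. ?D x)"
    by (rule set_integral_diff(2)[OF intD intc])
  also have "(LINT y:{0..x}|\<nu>. ?D x) = cdf \<nu> x * ?D x"
    by (simp add: set_lebesgue_integral_def meas)
  also have "(LINT y:{0..x}|\<nu>. ?D (x - y)) = (LINT y:{0..x}|\<nu>. real (\<rho> (x - y) \<omega>)) - (LINT y:{0..x}|\<nu>. g (x - y))"
    by (rule set_integral_diff(2)[OF dec(1) int])
  finally have eq: "?D x - (real (N x \<omega>) - (LINT y:{0..x}|\<nu>. g (x - y)))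
      = tail x * ?D x - (LINT y:{0..x}|\<nu>. ?D (x - y) - ?D x) - Z x n \<omega>"
    unfolding dec(2) by (simp add: algebra_simps)
  have intDc: "integrable \<nu> (\<lambda>y. indicator {0..x} y *\<^sub>R (?D (x - y) - ?D x))"
    using set_integral_diff(1)[OF intD intc] unfolding set_integrable_def .
  have "\<bar>LINT y:{0..x}|\<nu>. ?D (x - y) - ?D x\<bar> \<le> (\<integral>y. \<bar>indicator {0..x} y *\<^sub>R (?D (x - y) - ?D x)\<bar> \<partial>\<nu>)"
    unfolding set_lebesgue_integral_def by (rule integral_abs_bound)
  also have "\<dots> \<le> (\<integral>y. h + 2 * H * indicator {A<..} y \<partial>\<nu>)"
  proof (rule integral_mono)
    show "integrable \<nu> (\<lambda>y. \<bar>indicator {0..x} y *\<^sub>R (?D (x - y) - ?D x)\<bar>)"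
      using intDc by (rule integrable_abs)
    show "integrable \<nu> (\<lambda>y. h + 2 * H * indicator {A<..} y)"
      by (intro Bochner_Integration.integrable_add integrable_mult_right) (auto simp: less_top[symmetric])
    fix y
    show "\<bar>indicator {0..x} y *\<^sub>R (?D (x - y) - ?D x)\<bar> \<le> h + 2 * H * indicator {A<..} y"
    proof (cases "y \<in> {0..x}")
      case False
      then show ?thesis using H h by simp
    next
      case True
      show ?thesis
      proof (cases "y \<le> A")
        case le: True
        then show ?thesis using loc[of y] True by simp
      next
        case gt: False
        have "\<bar>?D (x - y)\<bar> \<le> H" "\<bar>?D x\<bar> \<le> H" using D[of "x - y"] D[of x] True by auto
        then have "\<bar>?D (x - y) - ?D x\<bar> \<le> 2 * H" by linarith
        then show ?thesis using gt True h by simp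
      qed
    qed
  qed
  also have "\<dots> = h + 2 * H * tail A"
  proof -
    have "measure \<nu> {A<..} = tail A"
    proof -
      have "{A<..} = space \<nu> - {..A}" by auto
      then show ?thesis by (simp only: nu.prob_compl cdf_def) (simp add: nu.prob_compl[of "{..A}", simplified])
    qed
    then show ?thesis
      by (subst Bochner_Integration.integral_add) (auto simp: less_top[symmetric] nu.prob_space[unfolded nu.space_eq_univ])
  qed
  finally have 1: "\<bar>LINT y:{0..x}|\<nu>. ?D (x - y) - ?D x\<bar> \<le> h + 2 * H * tail A" .
  have "0 \<le> tail x" "tail x \<le> tail A"
    using nu.cdf_bounded_prob[of x] nu.cdf_nondecreasing[OF A(2)] by auto
  then have "\<bar>tail x * ?D x\<bar> \<le> tail A * H"
    unfolding abs_mult using D[of x] A by (intro mult_mono) auto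
  with 1 show ?thesis unfolding eq by (simp add: mult.commute[of "tail A"])
qed

text \<open>The three errors of the previous bound: the martingale by its variance and \<open>med x = O((f x)\<^sup>2)\<close>, \<open>h\<close> by
  the tight increments of \<open>\<rho>\<close> and the local variation of \<open>g\<close>, and \<open>H\<close> by uniform tightness.\<close>

lemma N_close:
  assumes \<delta>: "0 < \<delta>" and \<epsilon>: "0 < \<epsilon>"
  shows "\<forall>\<^sub>F x in at_top. set_integrable \<nu> {0..x} (\<lambda>y. g (x - y)) \<longrightarrow>
    prob {\<omega> \<in> space M. \<delta> < \<bar>(real (\<rho> x \<omega>) - g x) / f x - (real (N x \<omega>) - (LINT y:{0..x}|\<nu>. g (x - y))) / f x\<bar>} \<le> \<epsilon>"
proof -
  obtain L where L: "1 \<le> L" and tight: "\<forall>\<^sub>F x in at_top. \<exists>G\<in>events. 1 - \<epsilon> / 4 \<le> prob G \<and>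
      (\<forall>\<omega>\<in>G. \<forall>z\<in>{0..x}. \<bar>real (\<rho> z \<omega>) - g z\<bar> \<le> L * f x)"
    using uniform_tightness[of "\<epsilon> / 4"] \<epsilon> by auto
  obtain C where C: "0 < C" and medC: "\<forall>\<^sub>F x in at_top. real (med x) \<le> C * (f x + 1)\<^sup>2" by (rule med_le_square)
  \<comment> \<open>the first bound makes \<open>3 * L * tail A \<le> \<delta> / 4\<close>, the second one handles the variance with \<open>med x \<le> 4 * C * (f x)\<^sup>2\<close>\<close>
  define q where "q = min (\<delta> / (12 * L)) (\<epsilon> * \<delta>\<^sup>2 / (1024 * C))"
  have q: "0 < q" "q \<le> \<delta> / (12 * L)" "q \<le> \<epsilon> * \<delta>\<^sup>2 / (1024 * C)" using \<delta> \<epsilon> L C by (auto simp: q_def)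
  have "\<forall>\<^sub>F u in at_top. 1 - q < cdf \<nu> u" using nu.cdf_lim_at_top_prob q by (intro order_tendstoD) auto
  then have "\<forall>\<^sub>F u in at_top. 1 - q < cdf \<nu> u \<and> 0 \<le> u" by (intro eventually_conj eventually_ge_at_top)
  then obtain A where A: "1 - q < cdf \<nu> A" "0 \<le> A" by (auto simp: eventually_at_top_linorder)
  have tail: "0 \<le> tail A" "tail A \<le> q" using A nu.cdf_bounded_prob[of A] by auto
  have "\<forall>\<^sub>F k in sequentially. S_cdf k A < \<epsilon> / 4" using S_cdf_tendsto_0 \<epsilon> by (intro order_tendstoD) auto
  then obtain j where j: "S_cdf j A \<le> \<epsilon> / 4" by (auto simp: eventually_sequentially intro: less_imp_le)
  have loc: "\<forall>\<^sub>F x in at_top. \<forall>y\<in>{0..A}. \<bar>g x - g (x - y)\<bar> \<le> \<delta> / 8 * f x"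
    by (rule centering_local) (use A \<delta> in auto)
  define B where "B = max 1 (max (8 * real j / \<delta>) (256 * real (med A) / (\<delta>\<^sup>2 * \<epsilon>)))"
  have "\<forall>\<^sub>F x in at_top. B \<le> f x" using filterlim_f unfolding filterlim_at_top by blast
  with tight medC loc show ?thesis using eventually_ge_at_top[of A]
  proof (eventually_elim, intro impI)
    fix x
    assume elim: "\<exists>G\<in>events. 1 - \<epsilon> / 4 \<le> prob G \<and> (\<forall>\<omega>\<in>G. \<forall>z\<in>{0..x}. \<bar>real (\<rho> z \<omega>) - g z\<bar> \<le> L * f x)"
      "real (med x) \<le> C * (f x + 1)\<^sup>2" "\<forall>y\<in>{0..A}. \<bar>g x - g (x - y)\<bar> \<le> \<delta> / 8 * f x"
      "B \<le> f x" "A \<le> x" "set_integrable \<nu> {0..x} (\<lambda>y. g (x - y))"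
    obtain G where G: "G \<in> events" "1 - \<epsilon> / 4 \<le> prob G"
      "\<And>\<omega> z. \<omega> \<in> G \<Longrightarrow> z \<in> {0..x} \<Longrightarrow> \<bar>real (\<rho> z \<omega>) - g z\<bar> \<le> L * f x" using elim(1) by blast
    have f: "1 \<le> f x" "8 * real j / \<delta> \<le> f x" "256 * real (med A) / (\<delta>\<^sup>2 * \<epsilon>) \<le> f x"
      using elim(4) by (auto simp: B_def)
    have "\<forall>\<^sub>F k in sequentially. S_cdf k x < \<epsilon> / 4" using S_cdf_tendsto_0 \<epsilon> by (intro order_tendstoD) auto
    then obtain n where n: "S_cdf n x \<le> \<epsilon> / 4" by (auto simp: eventually_sequentially intro: less_imp_le)
    define c where "c = \<delta> / 4 * f x"
    have c: "0 < c" using \<delta> f by (simp add: c_def)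
    let ?X = "{\<omega> \<in> space M. \<delta> < \<bar>(real (\<rho> x \<omega>) - g x) / f x - (real (N x \<omega>) - (LINT y:{0..x}|\<nu>. g (x - y))) / f x\<bar>}"
    let ?E1 = "{\<omega> \<in> space M. real (\<rho> (x - A) \<omega>) + real j < real (\<rho> (x - A + A) \<omega>)}"
    let ?E2 = "{\<omega> \<in> space M. c < \<bar>Z x n \<omega>\<bar>}"
    let ?E3 = "{\<omega> \<in> space M. real n < real (\<rho> x \<omega>)}"
    have ev: "?E1 \<in> events" "?E2 \<in> events" "?E3 \<in> events" "space M - G \<in> events" using G by auto
    have "prob ?X \<le> prob ((space M - G) \<union> (?E1 \<union> (?E2 \<union> ?E3)))"
    proof (rule finite_measure_mono_AE)
      show "AE \<omega> in M. \<omega> \<in> ?X \<longrightarrow> \<omega> \<in> (space M - G) \<union> (?E1 \<union> (?E2 \<union> ?E3))"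
        using AE_unbounded
      proof eventually_elim
        case unb: (elim \<omega>)
        show ?case
        proof (rule ccontr)
          assume neg: "\<not> ?case"
          then have w: "\<omega> \<in> space M" "\<omega> \<in> G" "\<rho> x \<omega> \<le> n" "\<bar>Z x n \<omega>\<bar> \<le> c"
            and inc: "real (\<rho> x \<omega>) \<le> real (\<rho> (x - A) \<omega>) + real j" by auto
          have bound: "\<bar>(real (\<rho> x \<omega>) - g x) - (real (N x \<omega>) - (LINT y:{0..x}|\<nu>. g (x - y)))\<bar>
             \<le> \<bar>Z x n \<omega>\<bar> + (real j + \<delta> / 8 * f x) + 3 * (L * f x) * tail A"
          proof (rule N_minus_centering_bound[OF w(1) _ w(3) elim(6) A(2) elim(5)])
            show "\<exists>k. y < S k \<omega>" for y using unb by blast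
            show "0 \<le> L * f x" "0 \<le> real j + \<delta> / 8 * f x" using L f \<delta> by auto
            show "\<bar>real (\<rho> z \<omega>) - g z\<bar> \<le> L * f x" if "0 \<le> z" "z \<le> x" for z using G(3)[OF w(2)] that by simp
            fix y assume y: "0 \<le> y" "y \<le> A"
            have "real (\<rho> (x - A) \<omega>) \<le> real (\<rho> (x - y) \<omega>)" "real (\<rho> (x - y) \<omega>) \<le> real (\<rho> x \<omega>)"
              using y unb by (auto intro!: rho_mono w)
            moreover have "\<bar>g x - g (x - y)\<bar> \<le> \<delta> / 8 * f x" using elim(3) y by simp
            ultimately show "\<bar>(real (\<rho> (x - y) \<omega>) - g (x - y)) - (real (\<rho> x \<omega>) - g x)\<bar> \<le> real j + \<delta> / 8 * f x"
              using inc by linarith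
          qed
          have "real j \<le> \<delta> / 8 * f x" using f(2) \<delta> by (simp add: field_simps)
          moreover have "3 * (L * f x) * tail A \<le> \<delta> / 4 * f x"
          proof -
            have "3 * (L * f x) * tail A \<le> 3 * (L * f x) * (\<delta> / (12 * L))"
              using tail q L f by (intro mult_left_mono) auto
            also have "\<dots> = \<delta> / 4 * f x" using L by simp
            finally show ?thesis .
          qed
          ultimately have "\<bar>(real (\<rho> x \<omega>) - g x) - (real (N x \<omega>) - (LINT y:{0..x}|\<nu>. g (x - y)))\<bar>
              \<le> c + (\<delta> / 8 * f x + \<delta> / 8 * f x) + \<delta> / 4 * f x"
            using bound w(4) by linarith
          also have "\<dots> \<le> \<delta> * f x" using f \<delta> by (simp add: c_def)
          finally have "\<bar>(real (\<rho> x \<omega>) - g x) - (real (N x \<omega>) - (LINT y:{0..x}|\<nu>. g (x - y)))\<bar> \<le> \<delta> * f x" .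
          then have "\<bar>(real (\<rho> x \<omega>) - g x) / f x - (real (N x \<omega>) - (LINT y:{0..x}|\<nu>. g (x - y))) / f x\<bar> \<le> \<delta>"
            using f unfolding diff_divide_distrib[symmetric] by (simp add: divide_le_eq)
          then show False using neg by auto
        qed
      qed
    qed (use ev in auto)
    also have "\<dots> \<le> prob (space M - G) + (prob ?E1 + (prob ?E2 + prob ?E3))"
      using measure_Un_le[of "space M - G" M "?E1 \<union> (?E2 \<union> ?E3)"] measure_Un_le[of ?E1 M "?E2 \<union> ?E3"] measure_Un_le[of ?E2 M ?E3]
        ev sets.Un[OF ev(1) sets.Un[OF ev(2,3)]] sets.Un[OF ev(2,3)] by linarith
    also have "\<dots> \<le> \<epsilon>"
    proof -
      have 1: "prob (space M - G) \<le> \<epsilon> / 4" using G by (simp add: prob_compl)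
      have 2: "prob ?E1 \<le> \<epsilon> / 4" by (rule order_trans[OF prob_rho_increment j])
      have 3: "prob ?E3 \<le> \<epsilon> / 4" using n unfolding prob_rho_gt by (simp add: rho_cdf_eq)
      have "prob ?E2 \<le> (2 * tail A * real (med x) + 2 * real (med A)) / c\<^sup>2" by (rule prob_Z_le[OF c])
      also have "\<dots> \<le> \<epsilon> / 4"
      proof -
        have "real (med x) \<le> C * (f x + 1)\<^sup>2" by (rule elim(2))
        also have "\<dots> \<le> C * (2 * f x)\<^sup>2" using C f by (intro mult_left_mono power_mono) auto
        finally have m: "real (med x) \<le> 4 * C * (f x)\<^sup>2" by (simp add: power_mult_distrib)
        have "2 * tail A * real (med x) \<le> 2 * (\<epsilon> * \<delta>\<^sup>2 / (1024 * C)) * (4 * C * (f x)\<^sup>2)"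
          using tail q m C \<epsilon> by (intro mult_mono) auto
        also have "\<dots> = \<epsilon> / 8 * c\<^sup>2" using C by (simp add: c_def power_mult_distrib power_divide)
        finally have a: "2 * tail A * real (med x) \<le> \<epsilon> / 8 * c\<^sup>2" .
        have "256 * real (med A) \<le> f x * (\<delta>\<^sup>2 * \<epsilon>)" using f(3) \<delta> \<epsilon> by (simp add: divide_le_eq)
        also have "\<dots> \<le> (f x)\<^sup>2 * (\<delta>\<^sup>2 * \<epsilon>)" using f \<epsilon> by (intro mult_right_mono) (auto simp: power2_eq_square)
        finally have b: "2 * real (med A) \<le> \<epsilon> / 8 * c\<^sup>2" by (simp add: c_def power_mult_distrib power_divide mult_ac)
        have "2 * tail A * real (med x) + 2 * real (med A) \<le> \<epsilon> / 4 * c\<^sup>2" using a b by simp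
        then show ?thesis using c by (simp add: divide_le_eq)
      qed
      finally show ?thesis using 1 2 3 by linarith
    qed
    finally show "prob ?X \<le> \<epsilon>" .
  qed
qed

end

section \<open>The number of occupied boxes\<close>

text \<open>Cutting the line into unit intervals at distance \<open>j\<close> from \<open>0\<close>. Only finitely many are kept, at the
  cost of an error \<open>(1 / 2) ^ J\<close>, so that interchanging sums stays elementary.\<close>

lemma exp_minus_abs_le:
  fixes u :: real
  shows "exp (- \<bar>u\<bar>) \<le> (\<Sum>j<J. (1 / 2) ^ j * (indicator {real j<..real j + 1} u + indicator {- real j - 1<..- real j} u)) + (1 / 2) ^ J"
proof -
  have half: "exp (- real j) \<le> (1 / 2) ^ j" for j
  proof -
    have "exp (- real j) = exp (- 1) ^ j" by (simp add: exp_of_nat_mult[symmetric])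
    also have "\<dots> \<le> (1 / 2) ^ j"
    proof (rule power_mono)
      have "2 \<le> exp (1::real)" using exp_ge_add_one_self[of "1::real"] by simp
      then show "exp (- 1) \<le> 1 / (2::real)" by (simp add: exp_minus field_simps)
    qed simp
    finally show ?thesis .
  qed
  have "\<exists>j::nat. real j \<le> \<bar>u\<bar> \<and> 1 \<le> (indicator {real j<..real j + 1} u + indicator {- real j - 1<..- real j} u :: real)"
  proof (cases "0 < u")
    case True
    define j where "j = nat (\<lceil>u\<rceil> - 1)"
    have "real j < u" "u \<le> real j + 1" using True unfolding j_def by linarith+
    then show ?thesis by (intro exI[of _ j]) (auto simp: indicator_def)
  next
    case False
    define j where "j = nat \<lfloor>- u\<rfloor>"
    have "real j \<le> - u" "- u < real j + 1" using False unfolding j_def by linarith+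
    then show ?thesis by (intro exI[of _ j]) (auto simp: indicator_def)
  qed
  then obtain j :: nat where j: "real j \<le> \<bar>u\<bar>"
    "1 \<le> (indicator {real j<..real j + 1} u + indicator {- real j - 1<..- real j} u :: real)" by blast
  let ?t = "\<lambda>j. (1 / 2) ^ j * (indicator {real j<..real j + 1} u + indicator {- real j - 1<..- real j} u :: real)"
  have nn: "0 \<le> ?t j" for j by simp
  have "exp (- \<bar>u\<bar>) \<le> exp (- real j)" using j by simp
  also have "\<dots> \<le> (1 / 2) ^ j" by (rule half)
  also have "\<dots> \<le> (\<Sum>j<J. ?t j) + (1 / 2) ^ J"
  proof (cases "j < J")
    case True
    have "(1 / 2) ^ j \<le> ?t j" using mult_left_mono[OF j(2), of "(1/2)^j"] by simp
    also have "\<dots> \<le> (\<Sum>j<J. ?t j)" using True nn by (intro member_le_sum) auto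
    also have "\<dots> \<le> (\<Sum>j<J. ?t j) + (1 / 2) ^ J" unfolding le_add_same_cancel1 by simp
    finally show ?thesis .
  next
    case False
    then have "(1 / 2) ^ j \<le> (1 / 2 :: real) ^ J" by (intro power_decreasing) auto
    moreover have "0 \<le> (\<Sum>j<J. ?t j)" by (intro sum_nonneg nn)
    ultimately show ?thesis by linarith
  qed
  finally show ?thesis .
qed

context perturbed_walk
begin

lemma sum_expectation_exp_S: "(\<Sum>k<m. expectation (\<lambda>\<omega>. exp (- \<bar>S k \<omega> - z\<bar>))) \<le> 8 * real (med 1) + 1"
proof -
  obtain J where J: "real m * (1 / 2) ^ J \<le> 1"
  proof -
    obtain J where "(1 / 2 :: real) ^ J < 1 / (real m + 1)" using real_arch_pow_inv[of "1 / (real m + 1)" "1 / 2"] by auto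
    then have "real m * (1 / 2) ^ J \<le> (real m + 1) * (1 / (real m + 1))" by (intro mult_mono) auto
    then show thesis using that by simp
  qed
  let ?I = "\<lambda>j k. prob {\<omega> \<in> space M. z + real j < S k \<omega> \<and> S k \<omega> \<le> z + real j + 1}
      + prob {\<omega> \<in> space M. z - real j - 1 < S k \<omega> \<and> S k \<omega> \<le> z - real j - 1 + 1}"
  have one: "expectation (\<lambda>\<omega>. exp (- \<bar>S k \<omega> - z\<bar>)) \<le> (\<Sum>j<J. (1 / 2) ^ j * ?I j k) + (1 / 2) ^ J" for k
  proof -
    let ?A = "\<lambda>j. {\<omega> \<in> space M. z + real j < S k \<omega> \<and> S k \<omega> \<le> z + real j + 1}"
    let ?B = "\<lambda>j. {\<omega> \<in> space M. z - real j - 1 < S k \<omega> \<and> S k \<omega> \<le> z - real j - 1 + 1}"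
    have int: "integrable M (\<lambda>\<omega>. (1 / 2) ^ j * (indicator (?A j) \<omega> + indicator (?B j) \<omega>) :: real)" for j
      by (intro integrable_mult_right Bochner_Integration.integrable_add) (auto simp: less_top[symmetric])
    have "expectation (\<lambda>\<omega>. exp (- \<bar>S k \<omega> - z\<bar>))
       \<le> expectation (\<lambda>\<omega>. (\<Sum>j<J. (1 / 2) ^ j * (indicator (?A j) \<omega> + indicator (?B j) \<omega>)) + (1 / 2) ^ J)"
    proof (rule integral_mono)
      show "integrable M (\<lambda>\<omega>. exp (- \<bar>S k \<omega> - z\<bar>))" by (rule integrable_const_bound[of _ 1]) auto
      show "integrable M (\<lambda>\<omega>. (\<Sum>j<J. (1 / 2) ^ j * (indicator (?A j) \<omega> + indicator (?B j) \<omega>)) + (1 / 2) ^ J :: real)"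
        by (intro Bochner_Integration.integrable_add Bochner_Integration.integrable_sum int) simp
      fix \<omega> assume w: "\<omega> \<in> space M"
      have "indicator {real j<..real j + 1} (S k \<omega> - z) = (indicator (?A j) \<omega> :: real)"
        "indicator {- real j - 1<..- real j} (S k \<omega> - z) = (indicator (?B j) \<omega> :: real)" for j
        using w by (auto simp: indicator_def)
      with exp_minus_abs_le[of "S k \<omega> - z" J]
      show "exp (- \<bar>S k \<omega> - z\<bar>) \<le> (\<Sum>j<J. (1 / 2) ^ j * (indicator (?A j) \<omega> + indicator (?B j) \<omega>)) + (1 / 2) ^ J"
        by simp
    qed
    also have "\<dots> = (\<Sum>j<J. expectation (\<lambda>\<omega>. (1 / 2) ^ j * (indicator (?A j) \<omega> + indicator (?B j) \<omega>))) + (1 / 2) ^ J"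
      using int by (simp add: prob_space)
    also have "\<dots> = (\<Sum>j<J. (1 / 2) ^ j * ?I j k) + (1 / 2) ^ J"
      by (simp add: Bochner_Integration.integral_add less_top[symmetric])
    finally show ?thesis .
  qed
  have "(\<Sum>k<m. expectation (\<lambda>\<omega>. exp (- \<bar>S k \<omega> - z\<bar>))) \<le> (\<Sum>k<m. (\<Sum>j<J. (1 / 2) ^ j * ?I j k) + (1 / 2) ^ J)"
    by (intro sum_mono one)
  also have "\<dots> = (\<Sum>j<J. (1 / 2) ^ j * (\<Sum>k<m. ?I j k)) + real m * (1 / 2) ^ J"
    unfolding sum.distrib[of _ "\<lambda>_. (1 / 2) ^ J"] by (subst sum.swap) (simp add: sum_distrib_left)
  also have "\<dots> \<le> (\<Sum>j<J. (1 / 2) ^ j * (4 * real (med 1))) + 1"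
  proof (intro add_mono sum_mono mult_left_mono J)
    fix j
    show "(\<Sum>k<m. ?I j k) \<le> 4 * real (med 1)"
      using sum_prob_interval[where n=m and a="z + real j" and y=1] sum_prob_interval[where n=m and a="z - real j - 1" and y=1]
      unfolding sum.distrib by linarith
  qed simp
  also have "\<dots> = (\<Sum>j<J. (1 / 2) ^ j) * (4 * real (med 1)) + 1" by (simp add: sum_distrib_right)
  also have "\<dots> \<le> 2 * (4 * real (med 1)) + 1"
  proof -
    have "(\<Sum>j<J. (1 / 2 :: real) ^ j) \<le> 2" by (subst geometric_sum) auto
    then show ?thesis by (intro add_right_mono mult_right_mono) auto
  qed
  finally show ?thesis by simp
qed

text \<open>The bound for the unperturbed walk is uniform in \<open>z\<close>, hence it survives averaging over \<open>z = x - \<eta> k\<close>.\<close>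

lemma sum_expectation_exp_T:
  "(\<Sum>k<m. expectation (\<lambda>\<omega>. exp (- \<bar>S k \<omega> + \<eta> k \<omega> - x\<bar>))) \<le> 8 * real (med 1) + 1"
proof -
  interpret MM: pair_prob_space M \<nu> ..
  have one: "expectation (\<lambda>\<omega>. exp (- \<bar>S k \<omega> + \<eta> k \<omega> - x\<bar>))
      = (\<integral>y. expectation (\<lambda>\<omega>. exp (- \<bar>S k \<omega> - (x - y)\<bar>)) \<partial>\<nu>)" for k
  proof -
    have meas: "S k \<in> borel_measurable (past k)" "\<eta> k \<in> borel_measurable (future k)"
      by (auto intro: S_past eta_steps)
    have [measurable_cong]: "sets \<nu> = sets borel" by simp
    have "expectation (\<lambda>\<omega>. (\<lambda>(s, y). exp (- \<bar>s + y - x\<bar>)) (S k \<omega>, \<eta> k \<omega>))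
       = expectation (\<lambda>\<omega>. \<integral>y. (\<lambda>(s, y). exp (- \<bar>s + y - x\<bar>)) (S k \<omega>, y) \<partial>distr M borel (\<eta> k))"
      by (rule expectation_past_future[OF meas meas, where B=1]) auto
    also have "\<dots> = expectation (\<lambda>\<omega>. \<integral>y. exp (- \<bar>S k \<omega> + y - x\<bar>) \<partial>\<nu>)" by (simp add: distr_eta_nu)
    also have "\<dots> = (\<integral>y. expectation (\<lambda>\<omega>. exp (- \<bar>S k \<omega> + y - x\<bar>)) \<partial>\<nu>)"
    proof (rule MM.Fubini_integral[symmetric])
      show "integrable (M \<Otimes>\<^sub>M \<nu>) (\<lambda>(\<omega>, y). exp (- \<bar>S k \<omega> + y - x\<bar>))"
        by (rule MM.integrable_const_bound[of _ 1]) (auto simp: case_prod_beta')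
    qed
    finally show ?thesis by (simp add: algebra_simps)
  qed
  have int: "integrable \<nu> (\<lambda>y. expectation (\<lambda>\<omega>. exp (- \<bar>S k \<omega> - (x - y)\<bar>)))" for k
  proof (rule nu.integrable_const_bound[of _ 1])
    have [measurable_cong]: "sets \<nu> = sets borel" by simp
    show "(\<lambda>y. expectation (\<lambda>\<omega>. exp (- \<bar>S k \<omega> - (x - y)\<bar>))) \<in> borel_measurable \<nu>" by measurable
    have "0 \<le> expectation (\<lambda>\<omega>. exp (- \<bar>S k \<omega> - (x - y)\<bar>))" "expectation (\<lambda>\<omega>. exp (- \<bar>S k \<omega> - (x - y)\<bar>)) \<le> 1" for y
    proof -
      have "integrable M (\<lambda>\<omega>. exp (- \<bar>S k \<omega> - (x - y)\<bar>))" by (rule integrable_const_bound[of _ 1]) auto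
      then show "expectation (\<lambda>\<omega>. exp (- \<bar>S k \<omega> - (x - y)\<bar>)) \<le> 1" by (rule integral_le_const) auto
    qed auto
    then show "AE y in \<nu>. norm (expectation (\<lambda>\<omega>. exp (- \<bar>S k \<omega> - (x - y)\<bar>))) \<le> 1" by auto
  qed
  have "(\<Sum>k<m. expectation (\<lambda>\<omega>. exp (- \<bar>S k \<omega> + \<eta> k \<omega> - x\<bar>)))
     = (\<integral>y. (\<Sum>k<m. expectation (\<lambda>\<omega>. exp (- \<bar>S k \<omega> - (x - y)\<bar>))) \<partial>\<nu>)"
    unfolding one using int by (intro Bochner_Integration.integral_sum[symmetric]) auto
  also have "\<dots> \<le> 8 * real (med 1) + 1"
    using int by (intro nu.integral_le_const Bochner_Integration.integrable_sum AE_I2 sum_expectation_exp_S) auto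
  finally show ?thesis .
qed

end

lemma (in prob_space) indep_vars_reindex_inj:
  assumes "inj_on h I" and ind: "indep_vars M' X (h ` I)"
  shows "indep_vars (\<lambda>i. M' (h i)) (\<lambda>i. X (h i)) I"
  unfolding indep_vars_def2
proof
  show "\<forall>i\<in>I. random_variable (M' (h i)) (X (h i))"
    using ind unfolding indep_vars_def2 by blast
  have sets: "indep_sets (\<lambda>i. {X i -` A \<inter> space M |A. A \<in> sets (M' i)}) (h ` I)"
    using ind unfolding indep_vars_def2 by blast
  show "indep_sets (\<lambda>i. {X (h i) -` A \<inter> space M |A. A \<in> sets (M' (h i))}) I"
  proof (rule indep_setsI)
    show "{X (h i) -` A \<inter> space M |A. A \<in> sets (M' (h i))} \<subseteq> events" if "i \<in> I" for i
      using sets that unfolding indep_sets_def by blast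
    fix A J assume J: "J \<noteq> {}" "J \<subseteq> I" "finite J"
      and A: "\<forall>j\<in>J. A j \<in> {X (h j) -` B \<inter> space M |B. B \<in> sets (M' (h j))}"
    have inj: "inj_on h J" using assms(1) J(2) by (rule inj_on_subset)
    let ?A = "\<lambda>i. A (the_inv_into J h i)"
    have inv: "the_inv_into J h (h j) = j" if "j \<in> J" for j using inj that by (rule the_inv_into_f_f)
    have "prob (\<Inter>i\<in>h ` J. ?A i) = (\<Prod>i\<in>h ` J. prob (?A i))"
    proof (rule indep_setsD[OF sets])
      show "h ` J \<subseteq> h ` I" using J by blast
      show "\<forall>i\<in>h ` J. ?A i \<in> {X i -` B \<inter> space M |B. B \<in> sets (M' i)}"
        using A inv by auto
    qed (use J in auto)
    moreover have "(\<Inter>i\<in>h ` J. ?A i) = (\<Inter>j\<in>J. A j)" using inv by auto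
    moreover have "(\<Prod>i\<in>h ` J. prob (?A i)) = (\<Prod>j\<in>J. prob (A j))"
      using inv by (simp add: prod.reindex[OF inj])
    ultimately show "prob (\<Inter>j\<in>J. A j) = (\<Prod>j\<in>J. prob (A j))" by simp
  qed
qed

locale bernoulli_sieve = prob_space M for M :: "'a measure" +
  fixes W U :: "nat \<Rightarrow> 'a \<Rightarrow> real"
  assumes W_range: "\<And>k \<omega>. 1 \<le> k \<Longrightarrow> \<omega> \<in> space M \<Longrightarrow> W k \<omega> \<in> {0<..<1}"
    and W_ident: "\<And>k. 1 \<le> k \<Longrightarrow> distr M borel (W k) = distr M borel (W 1)"
    and W_indep: "indep_vars (\<lambda>_. borel) W {1..}"
    and U_uniform: "\<And>i. 1 \<le> i \<Longrightarrow> distr M borel (U i) = uniform_measure lborel {0..1}"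
    and U_indep: "indep_vars (\<lambda>_. borel) U {1..}"
    and WU_indep: "indep_var (PiM {1..} (\<lambda>_. borel)) (\<lambda>\<omega>. \<lambda>k\<in>{1..}. W k \<omega>)
           (PiM {1..} (\<lambda>_. borel)) (\<lambda>\<omega>. \<lambda>i\<in>{1..}. U i \<omega>)"
begin

definition \<xi> :: "nat \<Rightarrow> 'a \<Rightarrow> real" where
  "\<xi> i \<omega> = - ln (W (Suc i) \<omega>)"

definition \<eta> :: "nat \<Rightarrow> 'a \<Rightarrow> real" where
  "\<eta> i \<omega> = - ln (1 - W (Suc i) \<omega>)"

lemma W_measurable: "1 \<le> k \<Longrightarrow> W k \<in> borel_measurable M"
  and U_measurable: "1 \<le> k \<Longrightarrow> U k \<in> borel_measurable M"
  using W_indep U_indep unfolding indep_vars_def by auto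

lemma W_Suc_measurable [measurable]: "W (Suc k) \<in> borel_measurable M"
  by (rule W_measurable) simp

sublocale perturbed_walk M \<xi> \<eta>
proof
  have h: "(\<lambda>w. (- ln w, - ln (1 - w))) \<in> borel_measurable (borel :: real measure)"
    unfolding borel_prod[symmetric] by measurable
  have "indep_vars (\<lambda>i. borel) (\<lambda>i. W (Suc i)) UNIV"
    by (rule indep_vars_reindex_inj[where h=Suc and M'="\<lambda>_. borel"])
       (use indep_vars_subset[OF W_indep, of "range Suc"] in auto)
  from indep_vars_compose2[OF this, of "\<lambda>_. \<lambda>w. (- ln w, - ln (1 - w))" "\<lambda>_. borel"] h
  show "indep_vars (\<lambda>_. borel) (\<lambda>i \<omega>. (\<xi> i \<omega>, \<eta> i \<omega>)) UNIV"
    by (simp add: \<xi>_def \<eta>_def)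
  have law: "distr M borel (\<lambda>\<omega>. (\<xi> i \<omega>, \<eta> i \<omega>)) = distr (distr M borel (W 1)) borel (\<lambda>w. (- ln w, - ln (1 - w)))" for i
  proof -
    have "distr M borel (\<lambda>\<omega>. (\<xi> i \<omega>, \<eta> i \<omega>)) = distr (distr M borel (W (Suc i))) borel (\<lambda>w. (- ln w, - ln (1 - w)))"
      using h by (simp add: distr_distr comp_def \<xi>_def \<eta>_def)
    also have "distr M borel (W (Suc i)) = distr M borel (W 1)" by (rule W_ident) simp
    finally show ?thesis .
  qed
  show "distr M borel (\<lambda>\<omega>. (\<xi> i \<omega>, \<eta> i \<omega>)) = distr M borel (\<lambda>\<omega>. (\<xi> 0 \<omega>, \<eta> 0 \<omega>))" for i
    unfolding law ..
  show "0 < \<xi> i \<omega>" "0 \<le> \<eta> i \<omega>" if "\<omega> \<in> space M" for i \<omega>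
    using W_range[of "Suc i" \<omega>] that by (auto simp: \<xi>_def \<eta>_def)
qed

lemma exp_xi: "\<omega> \<in> space M \<Longrightarrow> exp (- \<xi> k \<omega>) = W (Suc k) \<omega>"
  and exp_eta: "\<omega> \<in> space M \<Longrightarrow> exp (- \<eta> k \<omega>) = 1 - W (Suc k) \<omega>"
  using W_range[of "Suc k" \<omega>] by (auto simp: \<xi>_def \<eta>_def)

lemma exp_S_Suc:
  assumes "\<omega> \<in> space M"
  shows "exp (- S (Suc k) \<omega>) = exp (- S k \<omega>) * W (Suc k) \<omega>"
proof -
  have "- S (Suc k) \<omega> = - S k \<omega> + - \<xi> k \<omega>" by (simp add: S_def)
  then show ?thesis by (simp only: exp_add exp_xi[OF assms])
qed

lemma exp_T:
  assumes "\<omega> \<in> space M"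
  shows "exp (- (S k \<omega> + \<eta> k \<omega>)) = exp (- S k \<omega>) * (1 - W (Suc k) \<omega>)"
proof -
  have "- (S k \<omega> + \<eta> k \<omega>) = - S k \<omega> + - \<eta> k \<omega>" by simp
  then show ?thesis by (simp only: exp_add exp_eta[OF assms])
qed

lemma prod_W: "\<omega> \<in> space M \<Longrightarrow> (\<Prod>i=Suc 0..k. W i \<omega>) = exp (- S k \<omega>)"
proof (induction k)
  case (Suc k)
  then show ?case using exp_S_Suc[of \<omega> k] by simp
qed simp

lemma sieve_Q_eq: "\<omega> \<in> space M \<Longrightarrow> sieve_Q W k \<omega> = exp (- S k \<omega>)"
  by (simp add: sieve_Q_def prod_W)

lemma exp_S_diff:
  assumes "\<omega> \<in> space M"
  shows "exp (- S k \<omega>) - exp (- S (Suc k) \<omega>) = exp (- (S k \<omega> + \<eta> k \<omega>))"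
  unfolding exp_T[OF assms] exp_S_Suc[OF assms] by (simp only: right_diff_distrib mult_1_right)

lemma sieve_P_eq:
  assumes "\<omega> \<in> space M"
  shows "sieve_P W (Suc k) \<omega> = exp (- (S k \<omega> + \<eta> k \<omega>))"
  unfolding exp_T[OF assms] prod_W[OF assms, symmetric] by (simp add: sieve_P_def)

lemma Inf_Collect_nat: "Inf {k :: nat. P k} = (LEAST k. P k)"
  by (simp add: Inf_nat_def)

lemma card_Suc_shift: "card {k. 1 \<le> k \<and> P k} = card {k. P (Suc k)}"
proof -
  have "{k. 1 \<le> k \<and> P k} = Suc ` {k. P (Suc k)}"
    by (auto simp: image_iff) (metis Suc_le_D)
  then show ?thesis by (simp add: card_image)
qed

lemma N_star_eq: "\<omega> \<in> space M \<Longrightarrow> N_star W x \<omega> = N x \<omega>"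
  unfolding N_star_def card_Suc_shift[of "\<lambda>k. exp (- x) \<le> sieve_P W k \<omega>"] N_def
  by (intro arg_cong[where f=card] Collect_cong) (auto simp: sieve_P_eq)

lemma occupied_boxes_eq: "\<omega> \<in> space M \<Longrightarrow>
  occupied_boxes W U n \<omega> = card {k. \<exists>i\<in>{1..n}. U i \<omega> \<in> {exp (- S (Suc k) \<omega>)<..<exp (- S k \<omega>)}}"
  unfolding occupied_boxes_def
  by (subst card_Suc_shift[of "\<lambda>k. \<exists>i\<in>{1..n}. U i \<omega> \<in> {sieve_Q W k \<omega><..<sieve_Q W (k - 1) \<omega>}"]) (simp add: sieve_Q_eq)

lemma N_star_measurable: "(\<lambda>\<omega>. real (N_star W x \<omega>)) \<in> borel_measurable M"
proof -
  have "(\<lambda>\<omega>. real (N x \<omega>)) \<in> borel_measurable M" by measurable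
  then show ?thesis by (rule measurable_cong[THEN iffD1, rotated]) (simp add: N_star_eq)
qed

lemma hit_measurable: "{\<omega> \<in> space M. \<exists>i\<in>{1..n}. U i \<omega> \<in> {exp (- S (Suc k) \<omega>)<..<exp (- S k \<omega>)}} \<in> events"
proof -
  have "{\<omega> \<in> space M. \<exists>i\<in>{1..n}. U i \<omega> \<in> {exp (- S (Suc k) \<omega>)<..<exp (- S k \<omega>)}}
    = (\<Union>i\<in>{1..n}. {\<omega> \<in> space M. exp (- S (Suc k) \<omega>) < U i \<omega>} \<inter> {\<omega> \<in> space M. U i \<omega> < exp (- S k \<omega>)})"
    by auto
  also have "\<dots> \<in> events"
    using U_measurable by (intro sets.finite_UN sets.Int borel_measurable_less) auto
  finally show ?thesis .
qed

lemma occupied_boxes_measurable: "(\<lambda>\<omega>. real (occupied_boxes W U n \<omega>)) \<in> borel_measurable M"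
proof -
  have "(\<lambda>\<omega>. card {k. \<exists>i\<in>{1..n}. U i \<omega> \<in> {exp (- S (Suc k) \<omega>)<..<exp (- S k \<omega>)}}) \<in> measurable M (count_space UNIV)"
    by (rule measurable_card) (use hit_measurable in simp)
  then have "(\<lambda>\<omega>. real (card {k. \<exists>i\<in>{1..n}. U i \<omega> \<in> {exp (- S (Suc k) \<omega>)<..<exp (- S k \<omega>)}})) \<in> borel_measurable M"
    by (rule measurable_compose) simp
  then show ?thesis by (rule measurable_cong[THEN iffD1, rotated]) (simp add: occupied_boxes_eq)
qed

text \<open>Holds also where the walk stays bounded, since the infimum is then the same default value everywhere.\<close>

lemma rho_star_measurable: "(\<lambda>\<omega>. real (rho_star W x \<omega>)) \<in> borel_measurable M"
proof -
  let ?P = "\<lambda>k \<omega>. 1 \<le> k \<and> exp (- S k \<omega>) < exp (- x)"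
  have "(\<lambda>\<omega>. LEAST k. ?P k \<omega>) \<in> measurable M (count_space UNIV)"
    by measurable
  then have "(\<lambda>\<omega>. real (LEAST k. ?P k \<omega>)) \<in> borel_measurable M"
    by (rule measurable_compose) simp
  then show ?thesis
    by (rule measurable_cong[THEN iffD1, rotated])
       (simp only: rho_star_def Inf_Collect_nat One_nat_def prod_W)
qed

lemma AE_rho_star: "0 \<le> x \<Longrightarrow> AE \<omega> in M. rho_star W x \<omega> = \<rho> x \<omega>"
  using AE_unbounded AE_space
proof eventually_elim
  case (elim \<omega>)
  have "{k. 1 \<le> k \<and> (\<Prod>i=1..k. W i \<omega>) < exp (- x)} = {k. x < S k \<omega>}"
    using elim by (auto simp: prod_W Suc_le_eq intro!: gr0I)
  moreover have "\<exists>k. x < S k \<omega>" using elim by blast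
  ultimately show ?case unfolding rho_star_def \<rho>_def by (simp add: Inf_Collect_nat)
qed

lemma prob_U_interval:
  assumes "1 \<le> i" "0 \<le> a" "a \<le> b" "b \<le> 1"
  shows "prob {\<omega> \<in> space M. U i \<omega> \<in> {a<..<b}} = b - a"
proof -
  have "prob {\<omega> \<in> space M. U i \<omega> \<in> {a<..<b}} = measure (distr M borel (U i)) {a<..<b}"
    using U_measurable[OF assms(1)] by (simp add: measure_distr vimage_def Int_def conj_commute)
  also have "\<dots> = measure lborel ({0..1} \<inter> {a<..<b})"
    unfolding U_uniform[OF assms(1)] by (subst measure_uniform_measure) simp_all
  also have "{0..1} \<inter> {a<..<b} = {a<..<b}" using assms by auto
  finally show ?thesis using assms by simp
qed

lemma prob_hit_le:
  assumes "0 \<le> a" "a \<le> b" "b \<le> 1"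
  shows "prob {\<omega> \<in> space M. \<exists>i\<in>{1..n}. U i \<omega> \<in> {a<..<b}} \<le> real n * (b - a)"
proof -
  have "{\<omega> \<in> space M. \<exists>i\<in>{1..n}. U i \<omega> \<in> {a<..<b}} = (\<Union>i\<in>{1..n}. {\<omega> \<in> space M. U i \<omega> \<in> {a<..<b}})" by auto
  also have "prob \<dots> \<le> (\<Sum>i\<in>{1..n}. prob {\<omega> \<in> space M. U i \<omega> \<in> {a<..<b}})"
    using U_measurable by (intro finite_measure_subadditive_finite) auto
  also have "\<dots> = (\<Sum>i\<in>{1..n}. b - a)" using assms by (intro sum.cong prob_U_interval) auto
  finally show ?thesis by simp
qed

lemma prob_miss:
  assumes "0 \<le> a" "a \<le> b" "b \<le> 1" "1 \<le> n"
  shows "prob {\<omega> \<in> space M. \<not> (\<exists>i\<in>{1..n}. U i \<omega> \<in> {a<..<b})} = (1 - (b - a)) ^ n"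
proof -
  have "{\<omega> \<in> space M. \<not> (\<exists>i\<in>{1..n}. U i \<omega> \<in> {a<..<b})} = (\<Inter>i\<in>{1..n}. U i -` (- {a<..<b}) \<inter> space M)"
    using assms by auto
  also have "prob \<dots> = (\<Prod>i\<in>{1..n}. prob (U i -` (- {a<..<b}) \<inter> space M))"
    using assms by (intro indep_varsD[OF U_indep]) auto
  also have "\<dots> = (\<Prod>i\<in>{1..n}. 1 - (b - a))"
  proof (rule prod.cong)
    fix i assume i: "i \<in> {1..n}"
    then have ev: "{\<omega> \<in> space M. U i \<omega> \<in> {a<..<b}} \<in> events" using U_measurable[of i] by simp
    have "U i -` (- {a<..<b}) \<inter> space M = space M - {\<omega> \<in> space M. U i \<omega> \<in> {a<..<b}}" by auto
    then show "prob (U i -` (- {a<..<b}) \<inter> space M) = 1 - (b - a)"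
      using prob_compl[OF ev] prob_U_interval[of i a b] i assms by simp
  qed simp
  finally show ?thesis by simp
qed

text \<open>For a box of size \<open>p = b - a\<close>: it is hit with probability at most \<open>n p\<close> and missed with probability
  \<open>(1 - p) ^ n \<le> exp (- n p) \<le> 1 / (n p)\<close>. In both cases the right-hand side is \<open>exp (- |log (n p)|)\<close>.\<close>

lemma prob_mismatch_fixed:
  assumes ab: "0 \<le> a" "a < b" "b \<le> 1" and n: "1 \<le> n"
  shows "prob {\<omega> \<in> space M. (\<exists>i\<in>{1..n}. U i \<omega> \<in> {a<..<b}) \<longleftrightarrow> b - a < 1 / real n} \<le> exp (- \<bar>- ln (b - a) - ln (real n)\<bar>)"
proof (cases "b - a < 1 / real n")
  case True
  then have np: "real n * (b - a) < 1" "0 < real n * (b - a)" using n ab by (auto simp: field_simps)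
  have "- ln (b - a) - ln (real n) = - ln (real n * (b - a))" using ab n by (simp add: ln_mult)
  moreover have "ln (real n * (b - a)) < 0" using np by simp
  ultimately have "exp (- \<bar>- ln (b - a) - ln (real n)\<bar>) = real n * (b - a)" using np by simp
  then show ?thesis using True prob_hit_le[of a b n] ab by simp
next
  case False
  then have np: "1 \<le> real n * (b - a)" using n ab by (simp add: field_simps)
  have "- ln (b - a) - ln (real n) = - ln (real n * (b - a))" using ab n by (simp add: ln_mult)
  moreover have "0 \<le> ln (real n * (b - a))" using np by simp
  ultimately have e: "exp (- \<bar>- ln (b - a) - ln (real n)\<bar>) = inverse (real n * (b - a))"
    using np by (simp add: exp_minus)
  have "1 - (b - a) \<le> exp (- (b - a))" using exp_ge_add_one_self[of "- (b - a)"] by linarith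
  then have "(1 - (b - a)) ^ n \<le> exp (- (b - a)) ^ n" using ab by (intro power_mono) auto
  also have "\<dots> = inverse (exp (real n * (b - a)))"
    by (simp add: exp_of_nat_mult[symmetric] exp_minus[symmetric] algebra_simps)
  also have "\<dots> \<le> inverse (real n * (b - a))"
  proof (rule le_imp_inverse_le)
    show "real n * (b - a) \<le> exp (real n * (b - a))" using exp_ge_add_one_self[of "real n * (b - a)"] by linarith
  qed (use np in simp)
  finally show ?thesis using False prob_miss[of a b n] ab n e by simp
qed

text \<open>Conditioning on the boxes, which are independent of the balls.\<close>

lemma prob_mismatch:
  assumes n: "1 \<le> n"
  shows "prob {\<omega> \<in> space M. (\<exists>i\<in>{1..n}. U i \<omega> \<in> {exp (- S (Suc k) \<omega>)<..<exp (- S k \<omega>)}) \<longleftrightarrow> ln (real n) < S k \<omega> + \<eta> k \<omega>}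
     \<le> expectation (\<lambda>\<omega>. exp (- \<bar>S k \<omega> + \<eta> k \<omega> - ln (real n)\<bar>))"
proof -
  let ?P = "PiM {1::nat..} (\<lambda>_. borel :: real measure)"
  let ?w = "\<lambda>\<omega>. \<lambda>k\<in>{1..}. W k \<omega>" and ?u = "\<lambda>\<omega>. \<lambda>i\<in>{1..}. U i \<omega>"
  define q :: "nat \<Rightarrow> (nat \<Rightarrow> real) \<Rightarrow> real" where "q k v = (\<Prod>i=1..k. v i)" for k v
  \<comment> \<open>the coordinates of \<open>fst p\<close> are the factors \<open>W\<close>, those of \<open>snd p\<close> the balls\<close>
  define E where "E = {p \<in> space (?P \<Otimes>\<^sub>M ?P). (\<exists>i\<in>{1..n}. snd p i \<in> {q (Suc k) (fst p)<..<q k (fst p)})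
      \<longleftrightarrow> q k (fst p) - q (Suc k) (fst p) < 1 / real n}"
  have q_meas [measurable]: "(\<lambda>p. q k (fst p)) \<in> borel_measurable (?P \<Otimes>\<^sub>M ?P)" for k
    unfolding q_def
    by (intro borel_measurable_prod measurable_compose[OF measurable_fst] measurable_component_singleton) auto
  have u_meas: "(\<lambda>p. snd p i) \<in> borel_measurable (?P \<Otimes>\<^sub>M ?P)" if "i \<in> {1..n}" for i
    using that by (intro measurable_compose[OF measurable_snd] measurable_component_singleton) auto
  have E_sets: "E \<in> sets (?P \<Otimes>\<^sub>M ?P)"
  proof -
    let ?H = "{p \<in> space (?P \<Otimes>\<^sub>M ?P). \<exists>i\<in>{1..n}. snd p i \<in> {q (Suc k) (fst p)<..<q k (fst p)}}"
    have "?H = (\<Union>i\<in>{1..n}. {p \<in> space (?P \<Otimes>\<^sub>M ?P). q (Suc k) (fst p) < snd p i} \<inter> {p \<in> space (?P \<Otimes>\<^sub>M ?P). snd p i < q k (fst p)})"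
      by auto
    also have "\<dots> \<in> sets (?P \<Otimes>\<^sub>M ?P)"
      by (intro sets.finite_UN sets.Int borel_measurable_less u_meas q_meas) auto
    finally have [measurable]: "Measurable.pred (?P \<Otimes>\<^sub>M ?P) (\<lambda>p. \<exists>i\<in>{1..n}. snd p i \<in> {q (Suc k) (fst p)<..<q k (fst p)})"
      by (simp add: pred_def)
    show ?thesis unfolding E_def by measurable
  qed
  have wm: "?w \<in> measurable M ?P" and um: "?u \<in> measurable M ?P"
    using indep_var_rv1[OF WU_indep] indep_var_rv2[OF WU_indep] .
  have joint: "distr M (?P \<Otimes>\<^sub>M ?P) (\<lambda>\<omega>. (?w \<omega>, ?u \<omega>)) = distr M ?P ?w \<Otimes>\<^sub>M distr M ?P ?u"
    using WU_indep unfolding indep_var_distribution_eq by simp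
  have pair: "(?w \<omega>, ?u \<omega>') \<in> space (?P \<Otimes>\<^sub>M ?P)" for \<omega> \<omega>'
    by (simp add: space_pair_measure space_PiM)
  have qw: "q k (?w \<omega>) = exp (- S k \<omega>)" if "\<omega> \<in> space M" for k \<omega>
  proof -
    have "q k (?w \<omega>) = (\<Prod>i=Suc 0..k. W i \<omega>)" unfolding q_def by (intro prod.cong) auto
    then show ?thesis using that by (simp add: prod_W)
  qed
  note diff = exp_S_diff[of _ k]
  have thr: "exp (- (S k \<omega> + \<eta> k \<omega>)) < 1 / real n \<longleftrightarrow> ln (real n) < S k \<omega> + \<eta> k \<omega>" for \<omega>
  proof -
    have "1 / real n = exp (- ln (real n))" using n by (simp add: exp_minus inverse_eq_divide)
    then show ?thesis by (simp only: exp_less_cancel_iff neg_less_iff_less)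
  qed
  have mem: "(?w \<omega>, ?u \<omega>') \<in> E \<longleftrightarrow> ((\<exists>i\<in>{1..n}. U i \<omega>' \<in> {exp (- S (Suc k) \<omega>)<..<exp (- S k \<omega>)})
      \<longleftrightarrow> exp (- S k \<omega>) - exp (- S (Suc k) \<omega>) < 1 / real n)" if "\<omega> \<in> space M" for \<omega> \<omega>'
  proof -
    have "(\<exists>i\<in>{1..n}. ?u \<omega>' i \<in> I) \<longleftrightarrow> (\<exists>i\<in>{1..n}. U i \<omega>' \<in> I)" for I
      by (intro bex_cong) auto
    then show ?thesis
      using pair[of \<omega> \<omega>'] unfolding E_def mem_Collect_eq fst_conv snd_conv qw[OF that] by blast
  qed
  have "prob {\<omega> \<in> space M. (\<exists>i\<in>{1..n}. U i \<omega> \<in> {exp (- S (Suc k) \<omega>)<..<exp (- S k \<omega>)}) \<longleftrightarrow> ln (real n) < S k \<omega> + \<eta> k \<omega>}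
     = expectation (indicator {\<omega> \<in> space M. (?w \<omega>, ?u \<omega>) \<in> E})"
  proof -
    have "{\<omega> \<in> space M. (?w \<omega>, ?u \<omega>) \<in> E} = {\<omega> \<in> space M. (\<exists>i\<in>{1..n}. U i \<omega> \<in> {exp (- S (Suc k) \<omega>)<..<exp (- S k \<omega>)}) \<longleftrightarrow> ln (real n) < S k \<omega> + \<eta> k \<omega>}"
      using mem diff thr by auto
    moreover have "expectation (indicator {\<omega> \<in> space M. (?w \<omega>, ?u \<omega>) \<in> E}) = prob {\<omega> \<in> space M. (?w \<omega>, ?u \<omega>) \<in> E}"
      unfolding Bochner_Integration.integral_indicator by (intro arg_cong[where f=prob]) auto
    ultimately show ?thesis by (simp only:)
  qed
  also have "\<dots> = expectation (\<lambda>\<omega>. indicator E (?w \<omega>, ?u \<omega>))"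
    by (intro Bochner_Integration.integral_cong) (auto simp: indicator_def)
  also have "\<dots> = expectation (\<lambda>\<omega>. \<integral>v. indicator E (?w \<omega>, v) \<partial>distr M ?P ?u)"
    by (rule expectation_indep_pair[OF wm um joint, where B=1]) (use E_sets in auto)
  also have "\<dots> \<le> expectation (\<lambda>\<omega>. exp (- \<bar>S k \<omega> + \<eta> k \<omega> - ln (real n)\<bar>))"
  proof (rule integral_mono_AE')
    show "integrable M (\<lambda>\<omega>. exp (- \<bar>S k \<omega> + \<eta> k \<omega> - ln (real n)\<bar>))" by (rule integrable_const_bound[of _ 1]) auto
    show "AE \<omega> in M. (\<integral>v. indicator E (?w \<omega>, v) \<partial>distr M ?P ?u) \<le> exp (- \<bar>S k \<omega> + \<eta> k \<omega> - ln (real n)\<bar>)"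
    proof (rule AE_I2)
      fix \<omega> assume w: "\<omega> \<in> space M"
      let ?a = "exp (- S (Suc k) \<omega>)" and ?b = "exp (- S k \<omega>)"
      have slice: "(\<lambda>v. indicator E (?w \<omega>, v) :: real) \<in> borel_measurable ?P"
      proof -
        have "(\<lambda>v. (?w \<omega>, v)) \<in> measurable ?P (?P \<Otimes>\<^sub>M ?P)"
          by (rule measurable_Pair1') (simp add: space_PiM)
        from measurable_compose[OF this borel_measurable_indicator[OF E_sets]] show ?thesis .
      qed
      have "(\<integral>v. indicator E (?w \<omega>, v) \<partial>distr M ?P ?u) = expectation (\<lambda>\<omega>'. indicator E (?w \<omega>, ?u \<omega>') :: real)"
        by (rule integral_distr[OF um slice])
      also have "\<dots> = expectation (indicator {\<omega>' \<in> space M. (?w \<omega>, ?u \<omega>') \<in> E})"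
        by (intro Bochner_Integration.integral_cong) (auto simp: indicator_def)
      also have "\<dots> = prob {\<omega>' \<in> space M. (?w \<omega>, ?u \<omega>') \<in> E}"
        unfolding Bochner_Integration.integral_indicator by (intro arg_cong[where f=prob]) auto
      also have "\<dots> \<le> exp (- \<bar>- ln (?b - ?a) - ln (real n)\<bar>)"
        unfolding mem[OF w]
      proof (rule prob_mismatch_fixed[OF _ _ _ n])
        show "?a < ?b" using xi_pos[OF w, of k] by (simp add: S_def)
        show "?b \<le> 1" using S_nonneg[OF w] by simp
      qed simp
      also have "- ln (?b - ?a) = S k \<omega> + \<eta> k \<omega>" unfolding diff[OF w] by simp
      finally show "(\<integral>v. indicator E (?w \<omega>, v) \<partial>distr M ?P ?u) \<le> exp (- \<bar>S k \<omega> + \<eta> k \<omega> - ln (real n)\<bar>)" .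
    qed
  qed auto
  finally show ?thesis .
qed

text \<open>The two counts differ by at most the number of boxes that are small and hit or large and missed. The
  expected number of these is finite by the estimate for the perturbed walk.\<close>

lemma prob_occupied_N_diff:
  assumes n: "1 \<le> n" and c: "0 < c"
  shows "prob {\<omega> \<in> space M. c < \<bar>real (occupied_boxes W U n \<omega>) - real (N (ln (real n)) \<omega>)\<bar>} \<le> (8 * real (med 1) + 1) / c"
proof -
  let ?x = "ln (real n)"
  let ?O = "\<lambda>\<omega>. {k. \<exists>i\<in>{1..n}. U i \<omega> \<in> {exp (- S (Suc k) \<omega>)<..<exp (- S k \<omega>)}}"
  let ?B = "\<lambda>\<omega>. {k. S k \<omega> + \<eta> k \<omega> \<le> ?x}"
  let ?M = "\<lambda>k. {\<omega> \<in> space M. (\<exists>i\<in>{1..n}. U i \<omega> \<in> {exp (- S (Suc k) \<omega>)<..<exp (- S k \<omega>)}) \<longleftrightarrow> ?x < S k \<omega> + \<eta> k \<omega>}"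
  have M_ev [measurable]: "?M k \<in> events" for k
  proof -
    have [measurable]: "Measurable.pred M (\<lambda>\<omega>. \<exists>i\<in>{1..n}. U i \<omega> \<in> {exp (- S (Suc k) \<omega>)<..<exp (- S k \<omega>)})"
      using hit_measurable[of n k] by (simp add: pred_def)
    show ?thesis by measurable
  qed
  have [measurable]: "(\<lambda>\<omega>. real (occupied_boxes W U n \<omega>)) \<in> borel_measurable M"
    by (rule occupied_boxes_measurable)
  have bound: "AE \<omega> in M. ennreal \<bar>real (occupied_boxes W U n \<omega>) - real (N ?x \<omega>)\<bar> \<le> (\<Sum>k. indicator (?M k) \<omega>)"
    using AE_unbounded AE_space
  proof eventually_elim
    case (elim \<omega>)
    have finO: "finite (?O \<omega>)"
    proof -
      have "finite {k. U i \<omega> \<in> {exp (- S (Suc k) \<omega>)<..<exp (- S k \<omega>)}}" for i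
      proof -
        have "j = k" if "U i \<omega> \<in> {exp (- S (Suc k) \<omega>)<..<exp (- S k \<omega>)}" "U i \<omega> \<in> {exp (- S (Suc j) \<omega>)<..<exp (- S j \<omega>)}" for j k
        proof (rule ccontr)
          assume "j \<noteq> k"
          then consider "Suc j \<le> k" | "Suc k \<le> j" by linarith
          then show False
          proof cases
            case 1
            then have "exp (- S k \<omega>) \<le> exp (- S (Suc j) \<omega>)" using S_mono[OF elim(2)] by simp
            with that show False by simp
          next
            case 2
            then have "exp (- S j \<omega>) \<le> exp (- S (Suc k) \<omega>)" using S_mono[OF elim(2)] by simp
            with that show False by simp
          qed
        qed
        then have "\<exists>k. {k. U i \<omega> \<in> {exp (- S (Suc k) \<omega>)<..<exp (- S k \<omega>)}} \<subseteq> {k}" by blast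
        then show ?thesis using finite_subset by blast
      qed
      then show ?thesis by simp
    qed
    have finB: "finite (?B \<omega>)"
    proof -
      have "?B \<omega> \<subseteq> {..<\<rho> ?x \<omega>}"
      proof
        fix k assume "k \<in> ?B \<omega>"
        then have "S k \<omega> \<le> ?x" using eta_nonneg[OF elim(2), of k] by simp
        then show "k \<in> {..<\<rho> ?x \<omega>}" using less_rho_iff[OF elim(2), of ?x k] elim(1) by simp
      qed
      then show ?thesis by (rule finite_subset) simp
    qed
    let ?D = "(?O \<omega> - ?B \<omega>) \<union> (?B \<omega> - ?O \<omega>)"
    have D: "k \<in> ?D \<longleftrightarrow> \<omega> \<in> ?M k" for k using elim(2) by auto
    have "\<bar>real (card (?O \<omega>)) - real (card (?B \<omega>))\<bar> \<le> real (card ?D)"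
    proof -
      have "card (?O \<omega>) \<le> card (?B \<omega> \<union> ?D)" "card (?B \<omega>) \<le> card (?O \<omega> \<union> ?D)"
        using finO finB by (auto intro!: card_mono)
      moreover have "card (?B \<omega> \<union> ?D) \<le> card (?B \<omega>) + card ?D" "card (?O \<omega> \<union> ?D) \<le> card (?O \<omega>) + card ?D"
        by (rule card_Un_le)+
      ultimately show ?thesis by linarith
    qed
    moreover have "(\<Sum>k. indicator (?M k) \<omega> :: ennreal) = of_nat (card ?D)"
    proof -
      have "(\<Sum>k. indicator (?M k) \<omega> :: ennreal) = (\<Sum>k\<in>?D. indicator (?M k) \<omega>)"
        using finO finB D by (intro suminf_finite) (auto simp: indicator_def)
      also have "\<dots> = (\<Sum>k\<in>?D. 1)" using D by (intro sum.cong) (auto simp: indicator_def)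
      finally show ?thesis by simp
    qed
    ultimately show ?case
      unfolding occupied_boxes_eq[OF elim(2)] N_def by (simp add: ennreal_of_nat_eq_real_of_nat ennreal_leI)
  qed
  have "(\<integral>\<^sup>+\<omega>. ennreal \<bar>real (occupied_boxes W U n \<omega>) - real (N ?x \<omega>)\<bar> \<partial>M) \<le> (\<integral>\<^sup>+\<omega>. (\<Sum>k. indicator (?M k) \<omega>) \<partial>M)"
    by (rule nn_integral_mono_AE[OF bound])
  also have "\<dots> = (\<Sum>k. \<integral>\<^sup>+\<omega>. indicator (?M k) \<omega> \<partial>M)" by (rule nn_integral_suminf) measurable
  also have "\<dots> = (\<Sum>k. ennreal (prob (?M k)))"
    unfolding nn_integral_indicator[OF M_ev] emeasure_eq_measure ..
  also have "\<dots> \<le> ennreal (8 * real (med 1) + 1)"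
  proof (rule suminf_le_const[OF summableI])
    fix m
    have "(\<Sum>k<m. prob (?M k)) \<le> (\<Sum>k<m. expectation (\<lambda>\<omega>. exp (- \<bar>S k \<omega> + \<eta> k \<omega> - ?x\<bar>)))"
      by (intro sum_mono prob_mismatch n)
    also have "\<dots> \<le> 8 * real (med 1) + 1" by (rule sum_expectation_exp_T)
    finally have "ennreal (\<Sum>k<m. prob (?M k)) \<le> ennreal (8 * real (med 1) + 1)" by (rule ennreal_leI)
    moreover have "(\<Sum>k<m. ennreal (prob (?M k))) = ennreal (\<Sum>k<m. prob (?M k))" by (rule sum_ennreal) simp
    ultimately show "(\<Sum>k<m. ennreal (prob (?M k))) \<le> ennreal (8 * real (med 1) + 1)" by (simp only:)
  qed
  finally have nn: "(\<integral>\<^sup>+\<omega>. ennreal \<bar>real (occupied_boxes W U n \<omega>) - real (N ?x \<omega>)\<bar> \<partial>M) \<le> ennreal (8 * real (med 1) + 1)" .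
  let ?h = "\<lambda>\<omega>. \<bar>real (occupied_boxes W U n \<omega>) - real (N ?x \<omega>)\<bar>"
  have int: "integrable M ?h"
    using order_le_less_trans[OF nn ennreal_less_top] by (intro integrableI_bounded) auto
  have "ennreal (expectation ?h) \<le> ennreal (8 * real (med 1) + 1)"
    using nn nn_integral_eq_integral[OF int] by simp
  then have "expectation ?h \<le> 8 * real (med 1) + 1" by (subst (asm) ennreal_le_iff) auto
  have "prob {\<omega> \<in> space M. c < ?h \<omega>} \<le> prob {\<omega> \<in> space M. c \<le> ?h \<omega>}"
    by (intro finite_measure_mono) auto
  also have "\<dots> \<le> expectation ?h / c"
    using c by (intro integral_Markov_inequality_measure[OF int, where A="{}"]) auto
  also have "\<dots> \<le> (8 * real (med 1) + 1) / c"
    using c \<open>expectation ?h \<le> _\<close> by (intro divide_right_mono) auto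
  finally show ?thesis .
qed

end

section \<open>The limit theorem\<close>

theorem theorem1p1:
  fixes M :: "'a measure" and W0 :: "'a \<Rightarrow> real" and W U :: "nat \<Rightarrow> 'a \<Rightarrow> real"
    and f g :: "real \<Rightarrow> real" and \<mu> \<nu> :: "real measure"
  defines "\<nu> \<equiv> distr M borel (\<lambda>\<omega>. \<bar>ln (1 - W0 \<omega>)\<bar>)"
  assumes "prob_space M"
    and "W0 \<in> borel_measurable M"
    and "\<And>\<omega>. \<omega> \<in> space M \<Longrightarrow> W0 \<omega> \<in> {0<..<1}"
    and "non_lattice (distr M borel (\<lambda>\<omega>. \<bar>ln (W0 \<omega>)\<bar>))"
    and "\<And>k \<omega>. 1 \<le> k \<Longrightarrow> \<omega> \<in> space M \<Longrightarrow> W k \<omega> \<in> {0<..<1}"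
    and "\<And>k. 1 \<le> k \<Longrightarrow> distr M borel (W k) = distr M borel W0"
    and "prob_space.indep_vars M (\<lambda>_. borel) W {1..}"
    and "\<And>i. 1 \<le> i \<Longrightarrow> distr M borel (U i) = uniform_measure lborel {0..1}"
    and "prob_space.indep_vars M (\<lambda>_. borel) U {1..}"
    and "prob_space.indep_var M
           (PiM {1..} (\<lambda>_. borel)) (\<lambda>\<omega>. \<lambda>k\<in>{1..}. W k \<omega>)
           (PiM {1..} (\<lambda>_. borel)) (\<lambda>\<omega>. \<lambda>i\<in>{1..}. U i \<omega>)"
    and "\<And>x. 0 \<le> x \<Longrightarrow> 0 \<le> f x"
    and "\<And>c. bounded (g ` {0..c})"
    and "\<And>n::nat. 1 \<le> n \<Longrightarrow> set_integrable \<nu> {0..ln (real n)} (\<lambda>y. g (ln (real n) - y))"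
    and "real_distribution \<mu>"
    and "\<And>c. \<mu> \<noteq> return borel c"
    and "weak_conv_along
           (\<lambda>x. distr M borel (\<lambda>\<omega>. (real (rho_star W x \<omega>) - g x) / f x)) \<mu> at_top"
  shows "weak_conv_m
           (\<lambda>n. distr M borel
              (\<lambda>\<omega>. (real (occupied_boxes W U n \<omega>) - centering \<nu> g n) / f (ln (real n)))) \<mu>
       \<and> weak_conv_m
           (\<lambda>n. distr M borel
              (\<lambda>\<omega>. (real (N_star W (ln (real n)) \<omega>) - centering \<nu> g n) / f (ln (real n)))) \<mu>"
proof -
  note prob = assms(2) and W0 = assms(3) and W0_range = assms(4) and lattice = assms(5)
    and W_range = assms(6) and W_law = assms(7) and conv = assms(17)
  interpret prob_space M by (rule prob)
  interpret mu: real_distribution \<mu> by (rule assms(15))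
  interpret B: bernoulli_sieve M W U
  proof (rule bernoulli_sieve.intro[OF prob bernoulli_sieve_axioms.intro])
    show "distr M borel (W k) = distr M borel (W 1)" if "1 \<le> k" for k
      unfolding W_law[OF that] W_law[OF order_refl] ..
  qed (fact assms)+
  have W1: "distr M borel W0 = distr M borel (W 1)" by (rule W_law[symmetric]) simp
  have W1_meas [measurable]: "W 1 \<in> borel_measurable M" by (rule B.W_measurable) simp
  have transfer: "distr M borel (\<lambda>\<omega>. h (W0 \<omega>)) = distr M borel (\<lambda>\<omega>. h (W 1 \<omega>))"
    if h: "h \<in> borel_measurable borel" for h :: "real \<Rightarrow> real"
  proof -
    have "distr (distr M borel W0) borel h = distr (distr M borel (W 1)) borel h" by (simp only: W1)
    then show ?thesis using h W0 W1_meas by (simp add: distr_distr comp_def)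
  qed
  have abs_ln: "\<bar>ln w\<bar> = - ln w" if "0 < w" "w < 1" for w :: real
    using ln_less_zero[OF that] by simp
  have nu: "\<nu> = B.\<nu>"
  proof -
    have "\<nu> = distr M borel (\<lambda>\<omega>. \<bar>ln (1 - W 1 \<omega>)\<bar>)"
      unfolding \<nu>_def by (rule transfer) measurable
    also have "\<dots> = distr M borel (B.\<eta> 0)"
      using W_range[of 1] by (intro distr_cong refl) (auto simp: B.\<eta>_def abs_ln)
    finally show ?thesis unfolding B.\<nu>_def .
  qed
  have nondeg: "\<not> (AE \<omega> in M. B.\<xi> 0 \<omega> = c)" for c
  proof
    assume c: "AE \<omega> in M. B.\<xi> 0 \<omega> = c"
    then have "AE \<omega> in M. 0 < c" using AE_space by eventually_elim (use B.xi_pos in auto)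
    then have "0 < c" by simp
    have "distr M borel (\<lambda>\<omega>. \<bar>ln (W0 \<omega>)\<bar>) = distr M borel (\<lambda>\<omega>. \<bar>ln (W 1 \<omega>)\<bar>)" by (rule transfer) measurable
    also have "\<dots> = distr M borel (B.\<xi> 0)"
      using W_range[of 1] by (intro distr_cong refl) (auto simp: B.\<xi>_def abs_ln)
    finally have "distr M borel (\<lambda>\<omega>. \<bar>ln (W0 \<omega>)\<bar>) = distr M borel (B.\<xi> 0)" .
    moreover have "AE y in distr M borel (B.\<xi> 0). y = c" using c by (subst AE_distr_iff) auto
    ultimately have "AE y in distr M borel (\<lambda>\<omega>. \<bar>ln (W0 \<omega>)\<bar>). y = c" by (simp only:)
    then have "AE y in distr M borel (\<lambda>\<omega>. \<bar>ln (W0 \<omega>)\<bar>). \<exists>k::int. y = c * of_int k"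
      by eventually_elim (auto intro: exI[of _ "1::int"])
    with lattice \<open>0 < c\<close> show False unfolding non_lattice_def by blast
  qed
  have conv_rho: "weak_conv_along (\<lambda>x. distr M borel (\<lambda>\<omega>. (real (B.\<rho> x \<omega>) - g x) / f x)) \<mu> at_top"
    unfolding weak_conv_along_def
  proof (intro allI impI)
    fix t assume "isCont (cdf \<mu>) t"
    then have "((\<lambda>x. cdf (distr M borel (\<lambda>\<omega>. (real (rho_star W x \<omega>) - g x) / f x)) t) \<longlongrightarrow> cdf \<mu> t) at_top"
      using conv unfolding weak_conv_along_def by blast
    then show "((\<lambda>x. cdf (distr M borel (\<lambda>\<omega>. (real (B.\<rho> x \<omega>) - g x) / f x)) t) \<longlongrightarrow> cdf \<mu> t) at_top"
    proof (rule Lim_transform_eventually)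
      show "\<forall>\<^sub>F x in at_top. cdf (distr M borel (\<lambda>\<omega>. (real (rho_star W x \<omega>) - g x) / f x)) t
          = cdf (distr M borel (\<lambda>\<omega>. (real (B.\<rho> x \<omega>) - g x) / f x)) t"
        using eventually_ge_at_top[of 0]
      proof eventually_elim
        case (elim x)
        have [measurable]: "(\<lambda>\<omega>. real (rho_star W x \<omega>)) \<in> borel_measurable M" by (rule B.rho_star_measurable)
        have "distr M borel (\<lambda>\<omega>. (real (rho_star W x \<omega>) - g x) / f x) = distr M borel (\<lambda>\<omega>. (real (B.\<rho> x \<omega>) - g x) / f x)"
          using B.AE_rho_star[OF elim] by (intro distr_cong_AE) (auto elim!: eventually_mono)
        then show ?case by simp
      qed
    qed
  qed
  interpret P: passage_limit M B.\<xi> B.\<eta> \<mu> f g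
    by (intro passage_limit.intro passage_limit_axioms.intro B.perturbed_walk_axioms mu.real_distribution_axioms)
       (fact nondeg assms(16) assms(12) assms(13) conv_rho)+
  have ln_top: "filterlim (\<lambda>n. ln (real n)) at_top sequentially"
    by (rule filterlim_compose[OF ln_at_top filterlim_real_sequentially])
  let ?N = "\<lambda>n \<omega>. (real (N_star W (ln (real n)) \<omega>) - centering \<nu> g n) / f (ln (real n))"
  let ?K = "\<lambda>n \<omega>. (real (occupied_boxes W U n \<omega>) - centering \<nu> g n) / f (ln (real n))"
  have N_meas [measurable]: "(\<lambda>\<omega>. real (N_star W x \<omega>)) \<in> borel_measurable M" for x by (rule B.N_star_measurable)
  have K_meas [measurable]: "(\<lambda>\<omega>. real (occupied_boxes W U n \<omega>)) \<in> borel_measurable M" for n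
    by (rule B.occupied_boxes_measurable)
  have conv_seq: "weak_conv_along (\<lambda>n. distr M borel (\<lambda>\<omega>. (real (B.\<rho> (ln (real n)) \<omega>) - g (ln (real n))) / f (ln (real n)))) \<mu> sequentially"
    using conv_rho unfolding weak_conv_along_def by (auto intro: filterlim_compose[OF _ ln_top])
  have conv_N: "weak_conv_along (\<lambda>n. distr M borel (?N n)) \<mu> sequentially"
  proof (rule weak_conv_along_perturb[OF prob mu.real_distribution_axioms _ _ conv_seq])
    fix \<delta> \<epsilon> :: real assume "0 < \<delta>" "0 < \<epsilon>"
    from eventually_compose_filterlim[OF P.N_close[OF this] ln_top] eventually_ge_at_top[of 1]
    show "\<forall>\<^sub>F n in sequentially. prob {\<omega> \<in> space M. \<delta> < \<bar>(real (B.\<rho> (ln (real n)) \<omega>) - g (ln (real n))) / f (ln (real n)) - ?N n \<omega>\<bar>} \<le> \<epsilon>"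
    proof eventually_elim
      case (elim n)
      have "set_integrable B.\<nu> {0..ln (real n)} (\<lambda>y. g (ln (real n) - y))" using assms(14)[OF elim(2)] unfolding nu .
      with elim(1) have "prob {\<omega> \<in> space M. \<delta> < \<bar>(real (B.\<rho> (ln (real n)) \<omega>) - g (ln (real n))) / f (ln (real n))
          - (real (B.N (ln (real n)) \<omega>) - (LINT y:{0..ln (real n)}|B.\<nu>. g (ln (real n) - y))) / f (ln (real n))\<bar>} \<le> \<epsilon>"
        by blast
      moreover have "{\<omega> \<in> space M. \<delta> < \<bar>(real (B.\<rho> (ln (real n)) \<omega>) - g (ln (real n))) / f (ln (real n)) - ?N n \<omega>\<bar>}
        = {\<omega> \<in> space M. \<delta> < \<bar>(real (B.\<rho> (ln (real n)) \<omega>) - g (ln (real n))) / f (ln (real n))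
          - (real (B.N (ln (real n)) \<omega>) - (LINT y:{0..ln (real n)}|B.\<nu>. g (ln (real n) - y))) / f (ln (real n))\<bar>}"
        unfolding centering_def nu using B.N_star_eq by (intro Collect_cong) auto
      ultimately show ?case by simp
    qed
  qed measurable
  have conv_K: "weak_conv_along (\<lambda>n. distr M borel (?K n)) \<mu> sequentially"
  proof (rule weak_conv_along_perturb[OF prob mu.real_distribution_axioms _ _ conv_N])
    fix \<delta> \<epsilon> :: real assume \<delta>: "0 < \<delta>" and \<epsilon>: "0 < \<epsilon>"
    let ?C = "8 * real (B.med 1) + 1"
    have "\<forall>\<^sub>F x in at_top. max 1 (?C / (\<delta> * \<epsilon>)) \<le> f x" using P.filterlim_f unfolding filterlim_at_top by blast
    from eventually_compose_filterlim[OF this ln_top] eventually_ge_at_top[of 1]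
    show "\<forall>\<^sub>F n in sequentially. prob {\<omega> \<in> space M. \<delta> < \<bar>?N n \<omega> - ?K n \<omega>\<bar>} \<le> \<epsilon>"
    proof eventually_elim
      case (elim n)
      let ?f = "f (ln (real n))"
      have f: "1 \<le> ?f" "?C / (\<delta> * \<epsilon>) \<le> ?f" using elim(1) by auto
      have "{\<omega> \<in> space M. \<delta> < \<bar>?N n \<omega> - ?K n \<omega>\<bar>}
         = {\<omega> \<in> space M. \<delta> * ?f < \<bar>real (occupied_boxes W U n \<omega>) - real (B.N (ln (real n)) \<omega>)\<bar>}"
      proof (intro Collect_cong conj_cong refl)
        fix \<omega> assume w: "\<omega> \<in> space M"
        have "?N n \<omega> - ?K n \<omega> = (real (B.N (ln (real n)) \<omega>) - real (occupied_boxes W U n \<omega>)) / ?f"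
          unfolding B.N_star_eq[OF w] diff_divide_distrib by simp
        then show "\<delta> < \<bar>?N n \<omega> - ?K n \<omega>\<bar> \<longleftrightarrow> \<delta> * ?f < \<bar>real (occupied_boxes W U n \<omega>) - real (B.N (ln (real n)) \<omega>)\<bar>"
          using f by (simp add: less_divide_eq abs_minus_commute)
      qed
      then have "prob {\<omega> \<in> space M. \<delta> < \<bar>?N n \<omega> - ?K n \<omega>\<bar>} \<le> ?C / (\<delta> * ?f)"
        using B.prob_occupied_N_diff[OF elim(2), of "\<delta> * ?f"] f \<delta> by simp
      also have "\<dots> \<le> \<epsilon>" using f \<delta> \<epsilon> by (simp add: divide_le_eq mult_ac)
      finally show ?case .
    qed
  qed measurable
  show ?thesis using conv_K conv_N unfolding weak_conv_along_sequentially by blast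
qed

end
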